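(* Let $\sigma$ satisfy Condition $O_N$. Let $\delta_0\le\lambda\le\mu<1$, $0<r\le r_0$, and $Y\in\Sigma^r(\lambda)$ with $Y=q\,\zeta_i(\lambda',\rho)+(1-q)\,\pi_i(\rho')$, where $q\in[0,1]$, $1\le i\le N$, $\delta_0\le\lambda'\le\lambda$, $\rho,\rho'\in\mathbb B_r$ and $\zeta_i(\lambda',\rho)-\pi_i(\rho')\in\Gamma$. Let $X_j=\zeta_j(\mu,\rho)$ and $X_j'=\zeta_j(\mu,\rho')$ ($1\le j\le N$). Then for every bounded open $G\subset\mathbb R^{n+1}$ and $0<\tau<1$ there exists $(\varphi,\psi,g)\in C_0^\infty(G;\mathbb R^m\times\mathbb R^{m\times n}\times\mathbb R^{m\times n})$ such that: (a) $\operatorname{div}\psi=0$, $\operatorname{div}g=\varphi$ and $Y+(D\varphi,\partial_t\psi)\in\Sigma^r(\mu)$ in $G$; (b) $\|\varphi\|_{L^\infty(G)}+\|\partial_t\varphi\|_{L^\infty(G)}+\|\partial_tg\|_{L^\infty(G)}<\tau$; (c) there exist pairwise disjoint open sets $G_1',\dots,G_N',G_1'',\dots,G_N''\subset\subset G$ such that, with $G_j=G_j'\cup G_j''$, $Y+(D\varphi,\partial_t\psi)=\chi_{G_j'}X_j+\chi_{G_j''}X_j'\in S_j^r(\mu)$ in $G_j$ for all $j$, $$|G_i|\ge(1-\tau)\Big[(1-q)\nu_i^i(\mu,\rho')+q\Big(\tfrac{\lambda'}{\mu}+\big(1-\tfrac{\lambda'}{\mu}\big)\nu_i^i(\mu,\rho)\Big)\Big]|G|,$$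 $$|G_j|\ge(1-\tau)\Big[(1-q)\nu_i^j(\mu,\rho')+q\big(1-\tfrac{\lambda'}{\mu}\big)\nu_i^j(\mu,\rho)\Big]|G|\quad(j\ne i);$$ in particular $\sum_j|G_j|\ge(1-\tau)|G|$.
   Context: Wave cone $\Gamma=\{(p\otimes a,B):p\in\mathbb R^m,\ a\in\mathbb R^n\setminus\{0\},\ Ba=0\}$, $p\otimes a=pa^T$. $\mathbb B_r,\bar{\mathbb B}_r$: open/closed balls about $0$ in $\mathbb R^{m\times n}\times\mathbb R^{m\times n}$, elements written $\rho=(\rho^1,\rho^2)$. Condition $O_N$ ($N\ge2$): $\sigma$ continuous with graph $\mathcal K$; there are $r_0>0$, $0<\delta_1<\delta_2<1$, continuous $(\kappa_i,\gamma_i)\colon\bar{\mathbb B}_{r_0}\to[1/\delta_2,1/\delta_1]\times\Gamma$ with $\sum_i\gamma_i\equiv0$ such that with $\pi_1(\rho)=\rho$, $\pi_i(\rho)=\rho+\gamma_1(\rho)+\dots+\gamma_{i-1}(\rho)$, $\xi_i(\rho)=\pi_i(\rho)+\kappa_i(\rho)\gamma_i(\rho)$: (P1)(i) $\xi_i(\rho)\in\mathcal K$ on $\bar{\mathbb B}_{r_0}$; (ii) the sets $\xi_i^1(\bar{\mathbb B}_{r_0})$ ($1\le i\le N$) are pairwise disjoint, as are the sets $\pi_i^1(\bar{\mathbb B}_{r_0})$; (P2) with $S_i^r(\lambda)=\{\lambda\xi_i(\rho)+(1-\lambda)\pi_i(\rho):\rho\in\mathbb B_r\}$, there is $\delta_0\in(\delta_2,1)$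 such that for $0<r\le r_0$ and $\lambda\in\{0\}\cup[\delta_0,1)$, $S_1^r(\lambda),\dots,S_N^r(\lambda)$ are open and pairwise disjoint. Derived: $\zeta_i(\lambda,\rho)=\lambda\xi_i(\rho)+(1-\lambda)\pi_i(\rho)$, $\chi_i(\rho)=1/\kappa_i(\rho)$; $L_i^r(\lambda)=\bigcup\{[\alpha,\beta]:\alpha\in S_i^r(\lambda),\beta\in S_i^r(0),\alpha-\beta\in\Gamma\}$, $L^r(\lambda)=\bigcup_iL_i^r(\lambda)$, $\Sigma^r(\lambda)=\bigcup_{\delta_0\le\lambda'\le\lambda}L^r(\lambda')$ ($\delta_0\le\lambda<1$). Coefficients $\nu_i^j(\mu,\rho)$: for $\delta_2<\mu\le1$, let $t_k=\chi_k(\rho)/\mu$ ($N$-periodic in $k$), indices mod $N$, $\Pi=\prod_{k=1}^N(1-t_k)$; then $\nu_i^{i-1}=t_{i-1}/(1-\Pi)$ and $\nu_i^j=(1-t_{i-1})\cdots(1-t_{j+1})t_j/(1-\Pi)$ for $i-N\le j\le i-2$. $D,\operatorname{div}$ (row-wise), $\partial_t$ act in $(x,t)\in\mathbb R^n\times\mathbb R$; $\chi_E$ denotes the indicator of $E$. *)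

theory Defs
  imports "HOL-Analysis.Analysis"
begin

type_synonym ('n,'m) mat = "real^'n^'m"
type_synonym ('n,'m) mpair = "(real^'n^'m) \<times> (real^'n^'m)"

definition outer :: "real^'m \<Rightarrow> real^'n \<Rightarrow> real^'n^'m" where
  "outer p a = (\<chi> i j. p$i * a$j)"

definition wave_cone :: "('n::finite,'m::finite) mpair set" where
  "wave_cone = {(outer p a, B) | p a B. a \<noteq> 0 \<and> B *v a = 0}"

definition graphK :: "(real^'n^'m \<Rightarrow> real^'n^'m) \<Rightarrow> ('n,'m) mpair set" where
  "graphK \<sigma> = {(A, \<sigma> A) | A. True}"

definition pi_map :: "(nat \<Rightarrow> ('n::finite,'m::finite) mpair \<Rightarrow> ('n,'m) mpair) \<Rightarrow> nat \<Rightarrow> ('n,'m) mpair \<Rightarrow> ('n,'m) mpair" where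
  "pi_map \<gamma> i \<rho> = \<rho> + (\<Sum>k\<in>{1..<i}. \<gamma> k \<rho>)"

definition xi_map :: "(nat \<Rightarrow> ('n::finite,'m::finite) mpair \<Rightarrow> real) \<Rightarrow> (nat \<Rightarrow> ('n,'m) mpair \<Rightarrow> ('n,'m) mpair) \<Rightarrow> nat \<Rightarrow> ('n,'m) mpair \<Rightarrow> ('n,'m) mpair" where
  "xi_map \<kappa> \<gamma> i \<rho> = pi_map \<gamma> i \<rho> + \<kappa> i \<rho> *\<^sub>R \<gamma> i \<rho>"

definition zeta_map :: "(nat \<Rightarrow> ('n::finite,'m::finite) mpair \<Rightarrow> real) \<Rightarrow> (nat \<Rightarrow> ('n,'m) mpair \<Rightarrow> ('n,'m) mpair) \<Rightarrow> nat \<Rightarrow> real \<Rightarrow> ('n,'m) mpair \<Rightarrow> ('n,'m) mpair" where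
  "zeta_map \<kappa> \<gamma> i lam \<rho> = lam *\<^sub>R xi_map \<kappa> \<gamma> i \<rho> + (1 - lam) *\<^sub>R pi_map \<gamma> i \<rho>"

definition S_set :: "(nat \<Rightarrow> ('n::finite,'m::finite) mpair \<Rightarrow> real) \<Rightarrow> (nat \<Rightarrow> ('n,'m) mpair \<Rightarrow> ('n,'m) mpair) \<Rightarrow> nat \<Rightarrow> real \<Rightarrow> real \<Rightarrow> ('n,'m) mpair set" where
  "S_set \<kappa> \<gamma> i r lam = zeta_map \<kappa> \<gamma> i lam ` ball 0 r"

definition L_i_set :: "(nat \<Rightarrow> ('n::finite,'m::finite) mpair \<Rightarrow> real) \<Rightarrow> (nat \<Rightarrow> ('n,'m) mpair \<Rightarrow> ('n,'m) mpair) \<Rightarrow> nat \<Rightarrow> real \<Rightarrow> real \<Rightarrow> ('n,'m) mpair set" where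
  "L_i_set \<kappa> \<gamma> i r lam = \<Union>{closed_segment \<alpha> \<beta> | \<alpha> \<beta>.
      \<alpha> \<in> S_set \<kappa> \<gamma> i r lam \<and> \<beta> \<in> S_set \<kappa> \<gamma> i r 0 \<and> \<alpha> - \<beta> \<in> wave_cone}"

definition L_set :: "nat \<Rightarrow> (nat \<Rightarrow> ('n::finite,'m::finite) mpair \<Rightarrow> real) \<Rightarrow> (nat \<Rightarrow> ('n,'m) mpair \<Rightarrow> ('n,'m) mpair) \<Rightarrow> real \<Rightarrow> real \<Rightarrow> ('n,'m) mpair set" where
  "L_set N \<kappa> \<gamma> r lam = (\<Union>i\<in>{1..N}. L_i_set \<kappa> \<gamma> i r lam)"

definition Sigma_set :: "nat \<Rightarrow> (nat \<Rightarrow> ('n::finite,'m::finite) mpair \<Rightarrow> real) \<Rightarrow> (nat \<Rightarrow> ('n,'m) mpair \<Rightarrow> ('n,'m) mpair) \<Rightarrow> real \<Rightarrow> real \<Rightarrow> real \<Rightarrow> ('n,'m) mpair set" where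
  "Sigma_set N \<kappa> \<gamma> \<delta>0 r lam = (\<Union>lam'\<in>{\<delta>0..lam}. L_set N \<kappa> \<gamma> r lam')"

definition cond_O :: "(real^'n^'m \<Rightarrow> real^'n^'m) \<Rightarrow> nat \<Rightarrow> real \<Rightarrow> real \<Rightarrow> real \<Rightarrow> real
    \<Rightarrow> (nat \<Rightarrow> ('n::finite,'m::finite) mpair \<Rightarrow> real) \<Rightarrow> (nat \<Rightarrow> ('n,'m) mpair \<Rightarrow> ('n,'m) mpair) \<Rightarrow> bool" where
  "cond_O \<sigma> N r0 \<delta>1 \<delta>2 \<delta>0 \<kappa> \<gamma> \<longleftrightarrow>
     N \<ge> 2 \<and> continuous_on UNIV \<sigma> \<and>
     r0 > 0 \<and> 0 < \<delta>1 \<and> \<delta>1 < \<delta>2 \<and> \<delta>2 < 1 \<and>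
     (\<forall>i\<in>{1..N}. continuous_on (cball 0 r0) (\<kappa> i) \<and> continuous_on (cball 0 r0) (\<gamma> i)) \<and>
     (\<forall>i\<in>{1..N}. \<forall>\<rho>\<in>cball 0 r0. \<kappa> i \<rho> \<in> {1/\<delta>2..1/\<delta>1} \<and> \<gamma> i \<rho> \<in> wave_cone) \<and>
     (\<forall>\<rho>\<in>cball 0 r0. (\<Sum>i\<in>{1..N}. \<gamma> i \<rho>) = 0) \<and>
     \<comment> \<open>(P1)(i)\<close>
     (\<forall>i\<in>{1..N}. \<forall>\<rho>\<in>cball 0 r0. xi_map \<kappa> \<gamma> i \<rho> \<in> graphK \<sigma>) \<and>
     \<comment> \<open>(P1)(ii)\<close>
     (\<forall>i\<in>{1..N}. \<forall>j\<in>{1..N}. i \<noteq> j \<longrightarrow>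
        (fst \<circ> xi_map \<kappa> \<gamma> i) ` cball 0 r0 \<inter> (fst \<circ> xi_map \<kappa> \<gamma> j) ` cball 0 r0 = {} \<and>
        (fst \<circ> pi_map \<gamma> i) ` cball 0 r0 \<inter> (fst \<circ> pi_map \<gamma> j) ` cball 0 r0 = {}) \<and>
     \<comment> \<open>(P2)\<close>
     \<delta>2 < \<delta>0 \<and> \<delta>0 < 1 \<and>
     (\<forall>r lam. 0 < r \<and> r \<le> r0 \<and> (lam = 0 \<or> (\<delta>0 \<le> lam \<and> lam < 1)) \<longrightarrow>
        (\<forall>i\<in>{1..N}. open (S_set \<kappa> \<gamma> i r lam)) \<and>
        (\<forall>i\<in>{1..N}. \<forall>j\<in>{1..N}. i \<noteq> j \<longrightarrow> S_set \<kappa> \<gamma> i r lam \<inter> S_set \<kappa> \<gamma> j r lam = {}))"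

(* coefficients \<nu>_i^j(\<mu>,\<rho>), for 1 \<le> i, j \<le> N; j is identified with its representative
   in [i-N, i-1] modulo N, i.e. j \<equiv> i - d with d \<in> {1..N} *)
definition nu_coef :: "nat \<Rightarrow> (nat \<Rightarrow> ('n::finite,'m::finite) mpair \<Rightarrow> real) \<Rightarrow> real \<Rightarrow> ('n,'m) mpair \<Rightarrow> nat \<Rightarrow> nat \<Rightarrow> real" where
  "nu_coef N \<kappa> mu \<rho> i j =
    (let t = (\<lambda>k::int. (1 / \<kappa> (nat ((k - 1) mod int N) + 1) \<rho>) / mu);
         P = (\<Prod>k\<in>{1..int N}. 1 - t k);
         d = (if (int i - int j) mod int N = 0 then N else nat ((int i - int j) mod int N))
     in (\<Prod>l\<in>{1..<d}. 1 - t (int i - int l)) * t (int i - int d) / (1 - P))"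

fun Ck :: "nat \<Rightarrow> ('a::real_normed_vector \<Rightarrow> 'b::real_normed_vector) \<Rightarrow> bool" where
  "Ck 0 f = continuous_on UNIV f"
| "Ck (Suc k) f = ((\<forall>z. f differentiable (at z)) \<and> (\<forall>v. Ck k (\<lambda>z. frechet_derivative f (at z) v)))"

definition smooth_fun :: "('a::real_normed_vector \<Rightarrow> 'b::real_normed_vector) \<Rightarrow> bool" where
  "smooth_fun f \<longleftrightarrow> (\<forall>k. Ck k f)"

definition tsupport :: "('a::real_normed_vector \<Rightarrow> 'b::real_normed_vector) \<Rightarrow> 'a set" where
  "tsupport f = closure {z. f z \<noteq> 0}"

definition Cc_inf :: "'a::real_normed_vector set \<Rightarrow> ('a \<Rightarrow> 'b::real_normed_vector) \<Rightarrow> bool" where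
  "Cc_inf G f \<longleftrightarrow> smooth_fun f \<and> compact (tsupport f) \<and> tsupport f \<subseteq> G"

definition dx :: "((real^'n::finite) \<times> real \<Rightarrow> 'b::real_normed_vector) \<Rightarrow> (real^'n::finite) \<times> real \<Rightarrow> 'n \<Rightarrow> 'b" where
  "dx f z j = frechet_derivative f (at z) (axis j 1, 0)"

definition dt :: "((real^'n::finite) \<times> real \<Rightarrow> 'b::real_normed_vector) \<Rightarrow> (real^'n::finite) \<times> real \<Rightarrow> 'b" where
  "dt f z = frechet_derivative f (at z) (0, 1)"

definition Dx :: "((real^'n::finite) \<times> real \<Rightarrow> real^'m) \<Rightarrow> (real^'n::finite) \<times> real \<Rightarrow> real^'n^'m" where
  "Dx f z = (\<chi> i j. dx f z j $ i)"

definition divx :: "((real^'n::finite) \<times> real \<Rightarrow> real^'n^'m) \<Rightarrow> (real^'n::finite) \<times> real \<Rightarrow> real^'m" where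
  "divx f z = (\<chi> i. \<Sum>j\<in>UNIV. dx f z j $ i $ j)"

definition compactly_in :: "'a::metric_space set \<Rightarrow> 'a set \<Rightarrow> bool" where
  "compactly_in A G \<longleftrightarrow> compact (closure A) \<and> closure A \<subseteq> G"

end

theory Submission
  imports Defs
begin

text \<open>
  Everything is built from one scalar potential \<open>w(z) = \<theta>(z) F(k l(z)) / k\<^sup>2\<close>, where \<open>\<theta>\<close> is a cutoff, \<open>l\<close> a linear
  form and \<open>F''\<close> a smooth periodic profile of mean zero that takes almost only the values \<open>1 - s\<close> and \<open>- s\<close>: up
  to \<open>O(1/k)\<close> the Hessian of \<open>w\<close> is \<open>\<theta> F''(k l) l \<otimes> l\<close>. For a direction \<open>(p \<otimes> a, B)\<close> of the wave cone with
  \<open>|a| = 1\<close> take \<open>l(x, t) = a \<bullet> x + b t\<close> with small \<open>b > 0\<close>; then \<open>g = w p \<otimes> a\<close>, \<open>\<phi> = (\<partial>\<^sub>a w) p\<close> and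
  \<open>\<psi>\<^sub>i\<^sub>j = (B\<^sub>i\<^sub>j \<partial>\<^sub>a w - a\<^sub>j \<partial>\<^sub>B\<^sub>i w) / b\<close> satisfy both divergence constraints identically, and \<open>(D\<phi>, \<partial>\<^sub>t\<psi>)\<close>
  oscillates between \<open>(1 - s) (p \<otimes> a, B)\<close> and \<open>- s (p \<otimes> a, B)\<close>.

  Such laminates can be nested. Since \<open>\<pi>\<^sub>i\<^sub>+\<^sub>1 = t\<^sub>i \<zeta>\<^sub>i(\<mu>) + (1 - t\<^sub>i) \<pi>\<^sub>i\<close> cyclically, splitting the leftover phase
  \<open>\<pi>\<^sub>i\<close> again and again produces the values \<open>\<zeta>\<^sub>j(\<mu>)\<close> with the weights \<open>\<nu>\<^sub>i\<^sup>j\<close>, the unique solution of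
  \<open>\<nu>\<^sub>i\<^sub>+\<^sub>1 = t\<^sub>i e\<^sub>i + (1 - t\<^sub>i) \<nu>\<^sub>i\<close>. Finally \<open>\<zeta>\<^sub>i(\<lambda>')\<close> lies on \<open>[\<zeta>\<^sub>i(\<mu>), \<pi>\<^sub>i]\<close> and \<open>Y\<close> on
  \<open>[\<zeta>\<^sub>i(\<lambda>', \<rho>), \<pi>\<^sub>i(\<rho>')]\<close>. The values stay in \<open>\<Sigma>\<close> because each set \<open>L\<^sub>i\<close> is open: a segment may be
  translated without changing its direction.
\<close>

section \<open>Calculus of smooth functions\<close>

text \<open>The obstacle is to hit prescribed values exactly on most of an arbitrary bounded open G
  without destroying the differential constraints. Cutting off the potential \<open>w\<close>, not
  the fields, keeps the constraints, as they hold for every smooth \<open>w\<close>. Where the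
  cutoff is identically 1 and the profile sits on a plateau, the Hessian is exactly a multiple of
  \<open>l \<otimes> l\<close>; these sets are open, so a further laminate fits inside them.
  Integration by parts against the cutoff gives the volume fractions on G itself, so G need not be
  decomposed into cubes. Mean zero of \<open>F''\<close> makes \<open>F'\<close> bounded;
  \<open>F\<close> may then grow linearly, which is harmless since \<open>l\<close> is bounded on
  the support. Volume losses stay additive until the very end, so that losses of nested steps add
  up. Only finitely many nestings are used: the leftover weight, geometric in their number, is
  absorbed into the additive loss because G has finite measure. The points \<rho> and \<rho>' have
  separate cycles, so targets carry a label naming their point.\<close>

definition ddir :: "'a::real_normed_vector \<Rightarrow> ('a \<Rightarrow> 'b::real_normed_vector) \<Rightarrow> 'a \<Rightarrow> 'b" where
  "ddir v f z = frechet_derivative f (at z) v"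

lemma ddir_eq: "(f has_derivative f') (at z) \<Longrightarrow> ddir v f z = f' v"
  unfolding ddir_def using frechet_derivative_at by metis

lemma Ck_SucI:
  assumes "\<And>z. (f has_derivative f' z) (at z)" and "\<And>v. Ck k (\<lambda>z. f' z v)"
  shows "Ck (Suc k) f"
proof -
  have "frechet_derivative f (at z) v = f' z v" for z v
    using assms(1) frechet_derivative_at by metis
  moreover have "f differentiable (at z)" for z
    using assms(1) unfolding differentiable_def by blast
  ultimately show ?thesis using assms(2) by simp
qed

lemma Ck_SucD:
  assumes "Ck (Suc k) f"
  shows "(f has_derivative (\<lambda>v. ddir v f z)) (at z)" "Ck k (ddir v f)"
  using assms by (simp_all add: ddir_def[abs_def] frechet_derivative_works)

lemma Ck_Suc_imp: "Ck (Suc k) f \<Longrightarrow> Ck k f"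
proof (induction k arbitrary: f)
  case 0
  then show ?case
    by (simp add: continuous_on_eq_continuous_at differentiable_imp_continuous_within)
next
  case (Suc k)
  show ?case
    by (rule Ck_SucI[OF Ck_SucD(1)[OF Suc.prems]]) (rule Suc.IH[OF Ck_SucD(2)[OF Suc.prems]])
qed

lemma Ck_const: "Ck k (\<lambda>z. c)"
proof (induction k arbitrary: c)
  case (Suc k)
  show ?case by (rule Ck_SucI[where f' = "\<lambda>_ _. 0"]) (auto intro: Suc)
qed simp

lemma Ck_bounded_linear: "bounded_linear L \<Longrightarrow> Ck k f \<Longrightarrow> Ck k (\<lambda>z. L (f z))"
proof (induction k arbitrary: f)
  case 0
  then show ?case by (simp add: bounded_linear.continuous_on)
next
  case (Suc k)
  show ?case
    by (rule Ck_SucI[OF bounded_linear.has_derivative[OF Suc.prems(1) Ck_SucD(1)[OF Suc.prems(2)]]])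
       (use Suc Ck_SucD(2)[OF Suc.prems(2)] in blast)
qed

lemma Ck_add: "Ck k f \<Longrightarrow> Ck k g \<Longrightarrow> Ck k (\<lambda>z. f z + g z)"
proof (induction k arbitrary: f g)
  case 0
  then show ?case by (simp add: continuous_on_add)
next
  case (Suc k)
  show ?case
    by (rule Ck_SucI[OF has_derivative_add[OF Ck_SucD(1)[OF Suc.prems(1)] Ck_SucD(1)[OF Suc.prems(2)]]])
       (use Suc Ck_SucD(2)[OF Suc.prems(1)] Ck_SucD(2)[OF Suc.prems(2)] in blast)
qed

text \<open>Any bounded bilinear product is treated at once, since both real multiplication and the
  inner product are needed. The product rule leaves one factor undifferentiated, hence the use of
  \<open>Ck_Suc_imp\<close>.\<close>

lemma (in bounded_bilinear) Ck_prod: "Ck k f \<Longrightarrow> Ck k g \<Longrightarrow> Ck k (\<lambda>z. prod (f z) (g z))"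
proof (induction k arbitrary: f g)
  case 0
  then show ?case by (simp add: continuous_on)
next
  case (Suc k)
  show ?case
    by (rule Ck_SucI[OF FDERIV[OF Ck_SucD(1)[OF Suc.prems(1)] Ck_SucD(1)[OF Suc.prems(2)]]])
       (intro Ck_add Suc.IH Ck_SucD(2)[OF Suc.prems(1)] Ck_SucD(2)[OF Suc.prems(2)]
         Ck_Suc_imp[OF Suc.prems(1)] Ck_Suc_imp[OF Suc.prems(2)])
qed

text \<open>Because the inner function is real valued, the derivative of the composition is a
  product of the scalars \<open>ddir v u z\<close> and \<open>ddir 1 H (u z)\<close>, and the
  induction closes with the product lemma.\<close>

lemma Ck_compose_real:
  fixes H :: "real \<Rightarrow> real"
  shows "Ck k H \<Longrightarrow> Ck k u \<Longrightarrow> Ck k (\<lambda>z. H (u z))"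
proof (induction k arbitrary: H u)
  case 0
  then show ?case by (auto intro: continuous_on_compose2)
next
  case (Suc k)
  have H: "(\<lambda>v. ddir (ddir v u z) H t) = (\<lambda>v. ddir v u z * ddir 1 H t)" for z t
  proof
    fix v
    show "ddir (ddir v u z) H t = ddir v u z * ddir 1 H t"
      using linear_scale[OF has_derivative_linear[OF Ck_SucD(1)[OF Suc.prems(1), of t]], of "ddir v u z" 1] by simp
  qed
  have "((\<lambda>z. H (u z)) has_derivative (\<lambda>v. ddir v u z * ddir 1 H (u z))) (at z)" for z
    using has_derivative_compose[OF Ck_SucD(1)[OF Suc.prems(2)] Ck_SucD(1)[OF Suc.prems(1)]]
    by (simp only: H)
  then show ?case
    by (rule Ck_SucI) (rule bounded_bilinear.Ck_prod[OF bounded_bilinear_mult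
        Ck_SucD(2)[OF Suc.prems(2)] Suc.IH[OF Ck_SucD(2)[OF Suc.prems(1)] Ck_Suc_imp[OF Suc.prems(2)]]])
qed

text \<open>Coinduction for smoothness: a class of functions closed under directional derivatives
  can be differentiated forever, which spares formulas for derivatives of order n.\<close>

lemma smooth_fun_coinduct:
  assumes "P f" and step: "\<And>f. P f \<Longrightarrow> \<exists>f'. (\<forall>z. (f has_derivative f' z) (at z)) \<and> (\<forall>v. P (\<lambda>z. f' z v))"
  shows "smooth_fun f"
proof -
  have "P f \<Longrightarrow> Ck k f" for k f
  proof (induction k arbitrary: f)
    case 0
    then obtain f' where "\<And>z. (f has_derivative f' z) (at z)" using step[OF 0] by metis
    then show ?case
      by (simp add: continuous_on_eq_continuous_at) (metis has_derivative_continuous)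
  next
    case (Suc k)
    obtain f' where f': "\<And>z. (f has_derivative f' z) (at z)" "\<And>v. P (\<lambda>z. f' z v)"
      using step[OF Suc.prems] by metis
    show ?case by (rule Ck_SucI[OF f'(1)]) (rule Suc.IH[OF f'(2)])
  qed
  then show ?thesis using assms(1) by (simp add: smooth_fun_def)
qed

lemma smooth_fun_has_derivative: "smooth_fun f \<Longrightarrow> (f has_derivative (\<lambda>v. ddir v f z)) (at z)"
  unfolding smooth_fun_def using Ck_SucD(1) by blast

lemma smooth_fun_ddir: "smooth_fun f \<Longrightarrow> smooth_fun (ddir v f)"
  unfolding smooth_fun_def using Ck_SucD(2) by blast

lemma smooth_fun_continuous_on: "smooth_fun f \<Longrightarrow> continuous_on S f"
  unfolding smooth_fun_def using Ck.simps(1) continuous_on_subset by blast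

lemma smooth_fun_bounded_linear: "bounded_linear L \<Longrightarrow> smooth_fun f \<Longrightarrow> smooth_fun (\<lambda>z. L (f z))"
  by (simp add: smooth_fun_def Ck_bounded_linear)

lemma smooth_fun_const: "smooth_fun (\<lambda>z. c)"
  by (simp add: smooth_fun_def Ck_const)

lemma smooth_fun_id: "smooth_fun (\<lambda>z. z)"
  unfolding smooth_fun_def
proof
  fix k show "Ck k (\<lambda>z::'a. z)"
    by (rule Ck_Suc_imp, rule Ck_SucI[OF has_derivative_ident]) (rule Ck_const)
qed

lemma smooth_fun_linear: "bounded_linear L \<Longrightarrow> smooth_fun L"
  using smooth_fun_bounded_linear[OF _ smooth_fun_id] .

lemma smooth_fun_add: "smooth_fun f \<Longrightarrow> smooth_fun g \<Longrightarrow> smooth_fun (\<lambda>z. f z + g z)"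
  by (simp add: smooth_fun_def Ck_add)

lemma smooth_fun_sum: "(\<And>i. i \<in> I \<Longrightarrow> smooth_fun (f i)) \<Longrightarrow> smooth_fun (\<lambda>z. \<Sum>i\<in>I. f i z)"
proof (induction I rule: infinite_finite_induct)
  case (insert i I)
  have "smooth_fun (\<lambda>z. f i z + (\<Sum>i\<in>I. f i z))"
    by (rule smooth_fun_add) (use insert in simp_all)
  then show ?case using insert by simp
qed (simp_all add: smooth_fun_const)

lemma smooth_fun_mult:
  fixes f g :: "'a::real_normed_vector \<Rightarrow> real"
  shows "smooth_fun f \<Longrightarrow> smooth_fun g \<Longrightarrow> smooth_fun (\<lambda>z. f z * g z)"
  unfolding smooth_fun_def using bounded_bilinear.Ck_prod[OF bounded_bilinear_mult] by blast

lemma smooth_fun_compose_real: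
  fixes H :: "real \<Rightarrow> real"
  shows "smooth_fun H \<Longrightarrow> smooth_fun u \<Longrightarrow> smooth_fun (\<lambda>z. H (u z))"
  unfolding smooth_fun_def using Ck_compose_real by blast

lemma smooth_fun_inner_self:
  fixes f :: "'a::real_normed_vector \<Rightarrow> 'b::real_inner"
  shows "smooth_fun f \<Longrightarrow> smooth_fun (\<lambda>z. f z \<bullet> f z)"
  unfolding smooth_fun_def using bounded_bilinear.Ck_prod[OF bounded_bilinear_inner] by blast

lemma smooth_fun_antiderivative:
  fixes h F :: "real \<Rightarrow> real"
  assumes "smooth_fun h" "\<And>x. (F has_real_derivative h x) (at x)"
  shows "smooth_fun F"
  unfolding smooth_fun_def
proof
  fix k
  have F: "(F has_derivative (\<lambda>v. h x * v)) (at x)" for x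
    using assms(2) by (simp add: has_field_derivative_def)
  have "Ck (Suc k) F"
    by (rule Ck_SucI[OF F]) (intro bounded_bilinear.Ck_prod[OF bounded_bilinear_mult] Ck_const assms(1)[unfolded smooth_fun_def, rule_format])
  then show "Ck k F" by (rule Ck_Suc_imp)
qed

lemma smooth_fun_deriv_chain:
  fixes D :: "nat \<Rightarrow> real \<Rightarrow> real"
  assumes "\<And>n x. (D n has_real_derivative D (Suc n) x) (at x)"
  shows "smooth_fun (D n)"
\<comment> \<open>The factor \<open>c\<close> is needed because the derivative of \<open>D n\<close>
  in direction v is v times \<open>D (Suc n)\<close>.\<close>
proof (rule smooth_fun_coinduct[where P = "\<lambda>f. \<exists>c n. f = (\<lambda>x. D n x * c)"])
  show "\<exists>c m. D n = (\<lambda>x. D m x * c)" by (intro exI[of _ 1] exI[of _ n]) simp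
  fix f assume "\<exists>c n. f = (\<lambda>x. D n x * c)"
  then obtain c n where f: "f = (\<lambda>x. D n x * c)" by blast
  have "(f has_derivative (\<lambda>v. D (Suc n) z * (c * v))) (at z)" for z
    unfolding f using has_derivative_mult_left[OF assms[of n z, unfolded has_field_derivative_def], of c]
    by (simp add: ac_simps)
  moreover have "\<forall>v. \<exists>c' m. (\<lambda>z. D (Suc n) z * (c * v)) = (\<lambda>x. D m x * c')" by blast
  ultimately show "\<exists>f'. (\<forall>z. (f has_derivative f' z) (at z)) \<and> (\<forall>v. \<exists>c n. (\<lambda>z. f' z v) = (\<lambda>x. D n x * c))"
    by (intro exI[of _ "\<lambda>z v. D (Suc n) z * (c * v)"]) blast
qed

lemma smooth_fun_cos: "smooth_fun (cos :: real \<Rightarrow> real)"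
proof -
  \<comment> \<open>The n-th derivative of the cosine is a phase shift by n quarter periods.\<close>
  define D :: "nat \<Rightarrow> real \<Rightarrow> real" where "D n x = cos (x + of_nat n * (pi / 2))" for n x
  have "(D n has_real_derivative D (Suc n) x) (at x)" for n x
    unfolding D_def
    by (rule derivative_eq_intros refl | simp add: minus_sin_cos_eq add_divide_distrib distrib_right add_ac)+
  then have "smooth_fun (D 0)" by (rule smooth_fun_deriv_chain)
  then show ?thesis by (simp add: D_def[abs_def])
qed

lemma smooth_fun_diff: "smooth_fun f \<Longrightarrow> smooth_fun g \<Longrightarrow> smooth_fun (\<lambda>z. f z - g z)"
  using smooth_fun_add[OF _ smooth_fun_bounded_linear[OF bounded_linear_minus[OF bounded_linear_ident]]]
  by simp

lemma smooth_fun_norm_power2: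
  fixes f :: "'a::real_normed_vector \<Rightarrow> 'b::real_inner"
  shows "smooth_fun f \<Longrightarrow> smooth_fun (\<lambda>z. (norm (f z))\<^sup>2)"
  unfolding power2_norm_eq_inner by (rule smooth_fun_inner_self)

lemma smooth_fun_line:
  fixes f :: "'a::real_normed_vector \<Rightarrow> real"
  assumes "smooth_fun f"
  shows "((\<lambda>x. f (z + x *\<^sub>R u)) has_real_derivative ddir u f (z + x *\<^sub>R u)) (at x)"
proof -
  have "((\<lambda>x. f (z + x *\<^sub>R u)) has_derivative (\<lambda>y. ddir (y *\<^sub>R u) f (z + x *\<^sub>R u))) (at x)"
    by (rule has_derivative_compose[OF _ smooth_fun_has_derivative[OF assms]])
       (auto intro!: derivative_eq_intros)
  moreover have "ddir (y *\<^sub>R u) f (z + x *\<^sub>R u) = ddir u f (z + x *\<^sub>R u) * y" for y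
    using linear_scale[OF has_derivative_linear[OF smooth_fun_has_derivative[OF assms]]] by simp
  ultimately show ?thesis by (simp add: has_field_derivative_def)
qed

text \<open>The second difference is symmetric in u and v, whereas two applications of the mean
  value theorem turn it into a mixed derivative in a fixed order; exchanging u and v yields the
  other order.\<close>

lemma second_difference_mvt:
  fixes f :: "'a::real_normed_vector \<Rightarrow> real"
  assumes f: "smooth_fun f" and "0 < h"
  obtains x y where "0 < x" "x < h" "0 < y" "y < h"
    "f (z + h *\<^sub>R u + h *\<^sub>R v) - f (z + h *\<^sub>R u) - f (z + h *\<^sub>R v) + f z
       = h * h * ddir v (ddir u f) (z + x *\<^sub>R u + y *\<^sub>R v)"
proof -
  let ?\<phi> = "\<lambda>x. f ((z + h *\<^sub>R v) + x *\<^sub>R u) - f (z + x *\<^sub>R u)"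
  let ?\<phi>' = "\<lambda>x. ddir u f ((z + h *\<^sub>R v) + x *\<^sub>R u) - ddir u f (z + x *\<^sub>R u)"
  have "(?\<phi> has_real_derivative ?\<phi>' x) (at x)" for x
    by (intro DERIV_diff smooth_fun_line[OF f])
  then obtain x where x: "0 < x" "x < h" "?\<phi> h - ?\<phi> 0 = (h - 0) * ?\<phi>' x"
    using MVT2[OF \<open>0 < h\<close>, of ?\<phi> ?\<phi>'] by blast
  obtain y where y: "0 < y" "y < h"
    "ddir u f ((z + x *\<^sub>R u) + h *\<^sub>R v) - ddir u f ((z + x *\<^sub>R u) + 0 *\<^sub>R v)
      = (h - 0) * ddir v (ddir u f) ((z + x *\<^sub>R u) + y *\<^sub>R v)"
    using MVT2[OF \<open>0 < h\<close>, of "\<lambda>y. ddir u f ((z + x *\<^sub>R u) + y *\<^sub>R v)"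
      "\<lambda>y. ddir v (ddir u f) ((z + x *\<^sub>R u) + y *\<^sub>R v)"]
      smooth_fun_line[OF smooth_fun_ddir[OF f]] by blast
  have "f (z + h *\<^sub>R u + h *\<^sub>R v) - f (z + h *\<^sub>R u) - f (z + h *\<^sub>R v) + f z = ?\<phi> h - ?\<phi> 0"
    by (simp add: add_ac)
  also have "\<dots> = h * (ddir u f ((z + x *\<^sub>R u) + h *\<^sub>R v) - ddir u f ((z + x *\<^sub>R u) + 0 *\<^sub>R v))"
    using x(3) by (simp add: add_ac)
  also have "\<dots> = h * h * ddir v (ddir u f) (z + x *\<^sub>R u + y *\<^sub>R v)"
    using y(3) by simp
  finally show thesis using that x y by blast
qed

text \<open>Both mixed derivatives, at points near z, equal the same second difference over
  \<open>h * h\<close>; continuity moves these points to z. This symmetry is what makes the row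
  divergence of \<open>wave_psi\<close> vanish.\<close>

lemma ddir_commute:
  fixes f :: "'a::real_normed_vector \<Rightarrow> real"
  assumes f: "smooth_fun f"
  shows "ddir u (ddir v f) z = ddir v (ddir u f) z"
proof -
  have "\<bar>ddir u (ddir v f) z - ddir v (ddir u f) z\<bar> \<le> 2 * e" if "e > 0" for e
  proof -
    have near: "\<exists>d>0. \<forall>z'. norm (z' - z) < d \<longrightarrow> \<bar>ddir a (ddir b f) z' - ddir a (ddir b f) z\<bar> < e" for a b
    proof -
      have "isCont (ddir a (ddir b f)) z"
        using smooth_fun_continuous_on[OF smooth_fun_ddir[OF smooth_fun_ddir[OF f]], of UNIV]
        by (simp add: continuous_on_eq_continuous_at)
      then show ?thesis using \<open>e > 0\<close> unfolding continuous_at_eps_delta dist_norm by auto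
    qed
    obtain d1 where d1: "d1 > 0" "\<And>z'. norm (z' - z) < d1 \<Longrightarrow> \<bar>ddir u (ddir v f) z' - ddir u (ddir v f) z\<bar> < e"
      using near by blast
    obtain d2 where d2: "d2 > 0" "\<And>z'. norm (z' - z) < d2 \<Longrightarrow> \<bar>ddir v (ddir u f) z' - ddir v (ddir u f) z\<bar> < e"
      using near by blast
    \<comment> \<open>Small enough to keep both intermediate points within d1 and d2 of z; the added
      1 avoids a zero denominator.\<close>
    define h where "h = min d1 d2 / (norm u + norm v + 1)"
    have h: "h > 0" "h * (norm u + norm v) < min d1 d2"
    proof -
      have pos: "norm u + norm v + 1 > 0" by (simp add: add_nonneg_pos)
      then show "h > 0" using d1 d2 by (simp add: h_def)
      have "h * (norm u + norm v + 1) = min d1 d2" using pos by (simp add: h_def)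
      then have "h * (norm u + norm v) = min d1 d2 - h" by (simp add: algebra_simps)
      then show "h * (norm u + norm v) < min d1 d2" using \<open>h > 0\<close> by linarith
    qed
    have close: "norm (x *\<^sub>R a + y *\<^sub>R b) < min d1 d2"
      if "0 < x" "x < h" "0 < y" "y < h" "norm a + norm b = norm u + norm v" for x y and a b :: 'a
    proof -
      have "norm (x *\<^sub>R a + y *\<^sub>R b) \<le> x * norm a + y * norm b"
        using norm_triangle_ineq[of "x *\<^sub>R a" "y *\<^sub>R b"] that by simp
      also have "\<dots> \<le> h * norm a + h * norm b"
        by (intro add_mono mult_right_mono) (use that in auto)
      also have "\<dots> = h * (norm u + norm v)" using that(5) by (simp add: distrib_left[symmetric])
      finally show ?thesis using h(2) by simp
    qed
    obtain x y where xy: "0 < x" "x < h" "0 < y" "y < h"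
      "f (z + h *\<^sub>R u + h *\<^sub>R v) - f (z + h *\<^sub>R u) - f (z + h *\<^sub>R v) + f z
       = h * h * ddir v (ddir u f) (z + x *\<^sub>R u + y *\<^sub>R v)"
      using second_difference_mvt[OF f h(1)] by metis
    obtain x' y' where xy': "0 < x'" "x' < h" "0 < y'" "y' < h"
      "f (z + h *\<^sub>R v + h *\<^sub>R u) - f (z + h *\<^sub>R v) - f (z + h *\<^sub>R u) + f z
       = h * h * ddir u (ddir v f) (z + x' *\<^sub>R v + y' *\<^sub>R u)"
      using second_difference_mvt[OF f h(1)] by metis
    have "h * h * ddir v (ddir u f) (z + x *\<^sub>R u + y *\<^sub>R v) = h * h * ddir u (ddir v f) (z + x' *\<^sub>R v + y' *\<^sub>R u)"
      unfolding xy(5)[symmetric] xy'(5)[symmetric] by (simp add: add_ac)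
    then have "ddir v (ddir u f) (z + x *\<^sub>R u + y *\<^sub>R v) = ddir u (ddir v f) (z + x' *\<^sub>R v + y' *\<^sub>R u)"
      using h(1) by simp
    moreover have "\<bar>ddir v (ddir u f) (z + x *\<^sub>R u + y *\<^sub>R v) - ddir v (ddir u f) z\<bar> < e"
      using close[OF xy(1-4), of u v] by (intro d2(2)) (simp add: add.assoc)
    moreover have "\<bar>ddir u (ddir v f) (z + x' *\<^sub>R v + y' *\<^sub>R u) - ddir u (ddir v f) z\<bar> < e"
      using close[OF xy'(1-4), of v u] by (intro d1(2)) (simp add: add.assoc add.commute)
    ultimately show ?thesis by linarith
  qed
  from this[of "\<bar>ddir u (ddir v f) z - ddir v (ddir u f) z\<bar> / 4"] show ?thesis by force
qed

text \<open>The polynomial in 1/x makes the family closed under differentiation;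
  \<open>flat 1\<close> is the classical function exp(-1/x), extended by 0.\<close>

definition flat :: "real poly \<Rightarrow> real \<Rightarrow> real" where
  "flat p x = (if x > 0 then poly p (1 / x) * exp (- (1 / x)) else 0)"

lemma poly_exp_tendsto_0: "((\<lambda>y::real. poly p y * exp (- y)) \<longlongrightarrow> 0) at_top"
proof -
  have "((\<lambda>y::real. \<Sum>i\<le>degree p. coeff p i * (y ^ i / exp y)) \<longlongrightarrow> (\<Sum>i\<le>degree p. coeff p i * 0)) at_top"
    by (intro tendsto_sum tendsto_mult_left tendsto_power_div_exp_0)
  then show ?thesis by (simp add: poly_altdef sum_distrib_right exp_minus divide_inverse mult.assoc)
qed

text \<open>The chain rule factor 1/x^2 is the polynomial \<open>[:0, 0, 1:]\<close> evaluated at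
  1/x. At 0 the right difference quotient is again a polynomial times an exponential in 1/h, which
  tends to 0.\<close>

lemma flat_has_derivative:
  "(flat p has_real_derivative flat ([:0, 0, 1:] * (p - pderiv p)) x) (at x)"
proof (cases x "0::real" rule: linorder_cases)
  case greater
  have "((\<lambda>x. poly p (1 / x) * exp (- (1 / x))) has_real_derivative
      flat ([:0, 0, 1:] * (p - pderiv p)) x) (at x)"
    using greater
    by (auto intro!: derivative_eq_intros simp: flat_def field_simps power2_eq_square)
  then show ?thesis
    by (rule has_field_derivative_transform_within_open[where S = "{0<..}"]) (use greater in \<open>auto simp: flat_def\<close>)
next
  case less
  have "((\<lambda>x. 0) has_real_derivative flat ([:0, 0, 1:] * (p - pderiv p)) x) (at x)"
    using less by (simp add: flat_def)
  then show ?thesis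
    by (rule has_field_derivative_transform_within_open[where S = "{..<0}"]) (use less in \<open>auto simp: flat_def\<close>)
next
  case equal
  have "((\<lambda>h. poly (pCons 0 p) (inverse h) * exp (- inverse h)) \<longlongrightarrow> 0) (at_right (0::real))"
    by (rule filterlim_compose[OF poly_exp_tendsto_0 filterlim_inverse_at_top_right])
  then have "((\<lambda>h. flat p h / h) \<longlongrightarrow> 0) (at_right 0)"
    by (rule Lim_transform_eventually)
       (auto simp: flat_def field_simps eventually_at_right_less intro: eventually_mono[OF eventually_at_right_less])
  moreover have "((\<lambda>h. flat p h / h) \<longlongrightarrow> 0) (at_left 0)"
    by (rule tendsto_eventually) (auto simp: flat_def eventually_at_filter)
  ultimately have "((\<lambda>h. flat p h / h) \<longlongrightarrow> 0) (at 0)" by (simp add: filterlim_split_at)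
  then show ?thesis using equal by (simp add: has_field_derivative_iff flat_def)
qed

lemma smooth_fun_flat: "smooth_fun (flat p)"
proof (rule smooth_fun_coinduct[where P = "\<lambda>f. \<exists>p. f = flat p"])
  show "\<exists>q. flat p = flat q" by blast
  fix f assume "\<exists>p. f = flat p"
  then obtain p where f: "f = flat p" by blast
  let ?q = "[:0, 0, 1:] * (p - pderiv p)"
  have "(f has_derivative (\<lambda>v. flat ?q z * v)) (at z)" for z
    unfolding f using flat_has_derivative by (simp add: has_field_derivative_def)
  moreover have "(\<lambda>z. flat ?q z * v) = flat (smult v ?q)" for v
    by (auto simp: flat_def fun_eq_iff)
  ultimately show "\<exists>f'. (\<forall>z. (f has_derivative f' z) (at z)) \<and> (\<forall>v. \<exists>p. (\<lambda>z. f' z v) = flat p)"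
    by (intro exI[of _ "\<lambda>z v. flat ?q z * v"]) blast
qed

section \<open>Smooth steps and cutoff functions\<close>

lemma ex_antiderivative:
  fixes h :: "real \<Rightarrow> real"
  assumes "continuous_on UNIV h"
  obtains F where "\<And>x. (F has_real_derivative h x) (at x)" "F 0 = 0"
proof -
  obtain F where F: "\<And>x. (F has_real_derivative h x) (at x)"
    using einterval_antiderivative[of "-\<infinity>" "\<infinity>" h] assms
    by (auto simp: has_real_derivative_iff_has_vector_derivative continuous_on_eq_continuous_at)
  have "((\<lambda>x. F x - F 0) has_real_derivative h x) (at x)" for x
    using DERIV_diff[OF F[of x] DERIV_const[of "F 0" "at x"]] by simp
  then show thesis by (intro that[of "\<lambda>x. F x - F 0"]) auto
qed

text \<open>The primitive of the bump \<open>flat 1 y * flat 1 (1 - y)\<close>, which lives on the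
  unit interval, divided by its total mass.\<close>

lemma smooth_step:
  obtains S :: "real \<Rightarrow> real" where "smooth_fun S" "\<And>y. 0 \<le> S y" "\<And>y. S y \<le> 1"
    "\<And>y. y \<le> 0 \<Longrightarrow> S y = 0" "\<And>y. 1 \<le> y \<Longrightarrow> S y = 1"
proof -
  define b where "b y = flat 1 y * flat 1 (1 - y)" for y
  have "smooth_fun (\<lambda>y::real. 1 - y)" by (intro smooth_fun_diff smooth_fun_const smooth_fun_id)
  then have b: "smooth_fun b"
    unfolding b_def[abs_def] by (intro smooth_fun_mult smooth_fun_flat smooth_fun_compose_real[OF smooth_fun_flat])
  have b0: "b y \<ge> 0" for y by (simp add: b_def flat_def)
  obtain q where q: "\<And>x. (q has_real_derivative b x) (at x)" "q 0 = 0"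
    using ex_antiderivative[OF smooth_fun_continuous_on[OF b]] by blast
  have mono: "q x \<le> q y" if "x \<le> y" for x y
    using DERIV_nonneg_imp_nondecreasing[OF that, of q] q(1) b0 by blast
  have "q 0 < q 1"
    by (rule DERIV_pos_imp_increasing_open)
       (use q(1) in \<open>auto simp: b_def flat_def intro!: exI continuous_at_imp_continuous_on DERIV_isCont\<close>)
  then have q1: "q 1 > 0" using q(2) by simp
  have left: "q y = 0" if "y \<le> 0" for y
  proof (cases "y = 0")
    case False
    then obtain x where "y < x" "x < 0" "q 0 - q y = (0 - y) * b x"
      using MVT2[of y 0 q b] q(1) \<open>y \<le> 0\<close> by auto
    then show ?thesis using q(2) by (simp add: b_def flat_def)
  qed (use q in simp)
  have right: "q y = q 1" if "1 \<le> y" for y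
  proof (cases "y = 1")
    case False
    then obtain x where "1 < x" "x < y" "q y - q 1 = (y - 1) * b x"
      using MVT2[of 1 y q b] q(1) \<open>1 \<le> y\<close> by auto
    then show ?thesis by (simp add: b_def flat_def)
  qed simp
  define S where "S y = 1 / q 1 * q y" for y
  have "smooth_fun S"
    unfolding S_def[abs_def]
    by (intro smooth_fun_mult smooth_fun_const smooth_fun_antiderivative[OF b q(1)])
  moreover have "0 \<le> S y \<and> S y \<le> 1" for y
    using mono[of 0 y] mono[of y 1] left[of y] right[of y] q1 q(2) by (cases "y \<le> 0"; cases "1 \<le> y") (auto simp: S_def)
  moreover have "S y = 0" if "y \<le> 0" for y using left[OF that] by (simp add: S_def)
  moreover have "S y = 1" if "1 \<le> y" for y using right[OF that] q1 by (simp add: S_def)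
  ultimately show thesis using that by blast
qed

text \<open>Inner regularity supplies a compact subset of almost full measure, covered by finitely
  many balls inside G; a sum of bumps on these balls is positive on it and is flattened by a smooth
  step. The set K has to be open, so that all derivatives of the cutoff vanish on it.\<close>

lemma smooth_cutoff:
  fixes G :: "'a::euclidean_space set"
  assumes "open G" "bounded G" "0 < e"
  obtains \<theta> :: "'a \<Rightarrow> real" and K where "Cc_inf G \<theta>" "\<And>z. 0 \<le> \<theta> z" "\<And>z. \<theta> z \<le> 1" "open K"
    "\<And>z. z \<in> K \<Longrightarrow> \<theta> z = 1" "measure lborel G - e \<le> measure lborel K"
proof -
  have Gs: "G \<in> sets lebesgue" "G \<in> lmeasurable"
    using assms(1,2) by (auto simp: lmeasurable_open)
  obtain T where T: "closed T" "T \<subseteq> G" "G - T \<in> lmeasurable" "emeasure lebesgue (G - T) < ennreal e"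
    using sets_lebesgue_inner_closed[OF Gs(1) \<open>0 < e\<close>] .
  have "compact T" using T assms(2) by (simp add: bounded_subset compact_eq_bounded_closed)
  have "\<forall>z\<in>T. \<exists>r>0. cball z r \<subseteq> G"
    using T(2) assms(1) open_contains_cball by (metis subsetD)
  then obtain r where r: "\<And>z. z \<in> T \<Longrightarrow> r z > 0" "\<And>z. z \<in> T \<Longrightarrow> cball z (r z) \<subseteq> G" by metis
  have "T \<subseteq> (\<Union>z\<in>T. ball z (r z))" using r(1) by auto
  then obtain D where D: "D \<subseteq> T" "finite D" "T \<subseteq> (\<Union>z\<in>D. ball z (r z))"
    using compactE_image[OF \<open>compact T\<close>, of T "\<lambda>z. ball z (r z)"] by auto
  define s where "s z = (\<Sum>d\<in>D. flat 1 ((r d)\<^sup>2 - (norm (z - d))\<^sup>2))" for z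
  have "smooth_fun (\<lambda>z. (r d)\<^sup>2 - (norm (z - d))\<^sup>2)" for d
    by (intro smooth_fun_diff smooth_fun_norm_power2 smooth_fun_const smooth_fun_id)
  then have s: "smooth_fun s"
    unfolding s_def[abs_def] by (intro smooth_fun_sum smooth_fun_compose_real[OF smooth_fun_flat])
  have term0: "flat 1 x \<ge> 0" for x :: real by (simp add: flat_def)
  have sub: "z \<in> (\<Union>d\<in>D. cball d (r d))" if "s z \<noteq> 0" for z
  proof -
    have "\<exists>d\<in>D. flat 1 ((r d)\<^sup>2 - (norm (z - d))\<^sup>2) \<noteq> 0"
    proof (rule ccontr)
      assume "\<not> (\<exists>d\<in>D. flat 1 ((r d)\<^sup>2 - (norm (z - d))\<^sup>2) \<noteq> 0)"
      then have "s z = 0" unfolding s_def by (intro sum.neutral) simp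
      then show False using that by simp
    qed
    then obtain d where d: "d \<in> D" "flat 1 ((r d)\<^sup>2 - (norm (z - d))\<^sup>2) \<noteq> 0" by blast
    have "0 < (r d)\<^sup>2 - (norm (z - d))\<^sup>2"
      by (rule ccontr) (use d(2) in \<open>simp add: flat_def\<close>)
    then have "(norm (z - d))\<^sup>2 < (r d)\<^sup>2" by simp
    moreover have "0 < r d" using r(1) d(1) D(1) by blast
    ultimately have "norm (z - d) < r d" by (meson less_imp_le power2_less_imp_less)
    then have "z \<in> cball d (r d)" by (simp add: dist_norm norm_minus_commute)
    then show ?thesis using d(1) by blast
  qed
  have pos: "s z > 0" if zT: "z \<in> T" for z
  proof -
    obtain d where d: "d \<in> D" "z \<in> ball d (r d)" using D(3) zT by blast
    then have "(norm (z - d))\<^sup>2 < (r d)\<^sup>2"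
      by (intro power_strict_mono) (auto simp: dist_norm norm_minus_commute)
    then have "0 < flat 1 ((r d)\<^sup>2 - (norm (z - d))\<^sup>2)"
      by (simp add: flat_def)
    then show ?thesis unfolding s_def using d D(2) by (intro sum_pos2[OF _ d(1)] term0) auto
  qed
  obtain m where m: "m > 0" "\<And>z. z \<in> T \<Longrightarrow> m \<le> s z"
  proof (cases "T = {}")
    case False
    then obtain x where "x \<in> T" "\<And>z. z \<in> T \<Longrightarrow> s x \<le> s z"
      using continuous_attains_inf[OF \<open>compact T\<close> False smooth_fun_continuous_on[OF s]] by blast
    then show ?thesis using that pos by blast
  qed (use that[of 1] in auto)
  obtain S :: "real \<Rightarrow> real" where S: "smooth_fun S" "\<And>y. 0 \<le> S y" "\<And>y. S y \<le> 1"
    "\<And>y. y \<le> 0 \<Longrightarrow> S y = 0" "\<And>y. 1 \<le> y \<Longrightarrow> S y = 1" by (rule smooth_step, rule that)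
  \<comment> \<open>As s is at least m on T, the factor 2 / m makes the step reach 1 as soon as s
    exceeds m / 2, that is, on an open set containing T.\<close>
  define \<theta> where "\<theta> z = S (2 / m * s z)" for z
  define K where "K = {z. s z > m / 2}"
  have "smooth_fun \<theta>" unfolding \<theta>_def[abs_def]
    by (intro smooth_fun_compose_real[OF S(1)] smooth_fun_mult smooth_fun_const s)
  moreover have "tsupport \<theta> \<subseteq> (\<Union>d\<in>D. cball d (r d))"
    unfolding tsupport_def
  proof (rule closure_minimal)
    show "{z. \<theta> z \<noteq> 0} \<subseteq> (\<Union>d\<in>D. cball d (r d))"
    proof
      fix z assume "z \<in> {z. \<theta> z \<noteq> 0}"
      then have "s z \<noteq> 0" using S(4)[of 0] by (auto simp: \<theta>_def)
      then show "z \<in> (\<Union>d\<in>D. cball d (r d))" by (rule sub)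
    qed
    show "closed (\<Union>d\<in>D. cball d (r d))" using D(2) by auto
  qed
  moreover have "(\<Union>d\<in>D. cball d (r d)) \<subseteq> G" using r(2) D(1) by (intro UN_least) auto
  moreover have "compact (tsupport \<theta>)"
    using assms(2) calculation(2,3)
    by (simp add: tsupport_def compact_eq_bounded_closed bounded_subset[of G])
  ultimately have "Cc_inf G \<theta>" unfolding Cc_inf_def by blast
  moreover have "open K"
    unfolding K_def by (intro open_Collect_less continuous_intros smooth_fun_continuous_on[OF s])
  moreover have K1: "\<theta> z = 1" if "z \<in> K" for z
    using that m(1) unfolding K_def \<theta>_def by (intro S(5)) (simp add: field_simps)
  moreover have "measure lborel G - e \<le> measure lborel K"
  proof -
    have "T \<subseteq> K"
    proof
      fix z assume "z \<in> T"
      from m(2)[OF this] m(1) show "z \<in> K" by (simp add: K_def)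
    qed
    have "K \<subseteq> {z. \<theta> z \<noteq> 0}" using K1 by auto
    also have "\<dots> \<subseteq> tsupport \<theta>" unfolding tsupport_def by (rule closure_subset)
    also have "\<dots> \<subseteq> G" using \<open>Cc_inf G \<theta>\<close> unfolding Cc_inf_def by blast
    finally have "K \<subseteq> G" .
    then have Km: "K \<in> lmeasurable" using \<open>open K\<close> assms(2) by (simp add: bounded_subset lmeasurable_open)
    have "G \<subseteq> K \<union> (G - T)" using \<open>T \<subseteq> K\<close> by blast
    then have "measure lebesgue G \<le> measure lebesgue (K \<union> (G - T))"
      by (rule measure_mono_fmeasurable) (use Gs Km T(3) in auto)
    also have "\<dots> \<le> measure lebesgue K + measure lebesgue (G - T)"
      by (rule measure_Un_le) (use Km T(3) in auto)
    also have "measure lebesgue (G - T) \<le> e"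
      using T(4) \<open>0 < e\<close> unfolding measure_def by (simp add: enn2real_leI less_imp_le)
    finally show ?thesis
      using assms(1) \<open>open K\<close> by (simp add: measure_completion)
  qed
  ultimately show thesis using that S(2,3) by (simp add: \<theta>_def)
qed

section \<open>Oscillating profiles and averaging\<close>

lemma bounded_of_periodic:
  fixes q :: "real \<Rightarrow> real"
  assumes cont: "continuous_on UNIV q" and per: "\<And>x. q (x + 2 * pi) = q x"
  obtains Q where "\<And>x. \<bar>q x\<bar> \<le> Q"
proof -
  have nat: "q (x + real n * (2 * pi)) = q x" for x n
  proof (induction n)
    case (Suc n)
    have "q (x + real (Suc n) * (2 * pi)) = q ((x + real n * (2 * pi)) + 2 * pi)"
      by (simp add: algebra_simps)
    then show ?case using per Suc by simp
  qed simp
  have int: "q (x + of_int i * (2 * pi)) = q x" for x i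
  proof (cases "i \<ge> 0")
    case True
    then show ?thesis using nat[of x "nat i"] by simp
  next
    case False
    then show ?thesis using nat[of "x + of_int i * (2 * pi)" "nat (- i)"] by simp
  qed
  have "compact (q ` {0..2 * pi})"
    by (intro compact_continuous_image continuous_on_subset[OF cont]) auto
  then obtain Q where "\<forall>y\<in>q ` {0..2 * pi}. norm y \<le> Q"
    using compact_imp_bounded[of "q ` {0..2 * pi}"] unfolding bounded_iff by blast
  then have Q: "\<bar>q x\<bar> \<le> Q" if "x \<in> {0..2 * pi}" for x using that by simp
  have "\<bar>q x\<bar> \<le> Q" for x
  proof -
    define i where "i = \<lfloor>x / (2 * pi)\<rfloor>"
    have "of_int i \<le> x / (2 * pi)" "x / (2 * pi) \<le> of_int i + 1"
      unfolding i_def by linarith+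
    then have "of_int i * (2 * pi) \<le> x" "x \<le> (of_int i + 1) * (2 * pi)"
      by (simp_all add: field_simps)
    then have "x + of_int (- i) * (2 * pi) \<in> {0..2 * pi}" by (auto simp: algebra_simps)
    then show ?thesis using Q int by metis
  qed
  then show thesis using that by blast
qed

lemma periodic_antiderivative_diff:
  fixes p q :: "real \<Rightarrow> real"
  assumes q: "\<And>x. (q has_real_derivative p x) (at x)" and per: "\<And>x. p (x + 2 * pi) = p x"
  shows "q (x + 2 * pi) - q x = q (y + 2 * pi) - q y"
proof -
  have "((\<lambda>x. q (x + 2 * pi) - q x) has_real_derivative p (x + 2 * pi) - p x) (at x)" for x
    by (intro DERIV_diff q) (use q DERIV_shift in blast)
  then have "((\<lambda>x. q (x + 2 * pi) - q x) has_real_derivative 0) (at x)" for x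
    using per by simp
  then show ?thesis using DERIV_isconst_all[of "\<lambda>x. q (x + 2 * pi) - q x" x y] by blast
qed

text \<open>Equal values of q at the ends of one period mean that p has mean zero; then q is
  periodic itself, hence bounded.\<close>

lemma periodic_antiderivative_bounded:
  fixes p q :: "real \<Rightarrow> real"
  assumes q: "\<And>x. (q has_real_derivative p x) (at x)" and per: "\<And>x. p (x + 2 * pi) = p x"
    and mean: "q pi = q (- pi)"
  obtains Q where "\<And>x. \<bar>q x\<bar> \<le> Q"
proof (rule bounded_of_periodic[of q])
  show "continuous_on UNIV q"
    using q by (auto intro!: continuous_at_imp_continuous_on DERIV_isCont)
  show "q (x + 2 * pi) = q x" for x
    using periodic_antiderivative_diff[OF q per, of x "- pi"] mean by simp
qed (use that in blast)

text \<open>Increments of an antiderivative replace integrals here, so that means of profiles can be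
  estimated from the sign of a derivative alone.\<close>

lemma antiderivative_diff_le:
  fixes p q :: "real \<Rightarrow> real"
  assumes q: "\<And>x. (q has_real_derivative p x) (at x)" and "a \<le> b"
    and le: "\<And>x. a \<le> x \<Longrightarrow> x \<le> b \<Longrightarrow> p x \<le> c"
  shows "q b - q a \<le> c * (b - a)"
proof -
  have "q b - c * b \<le> q a - c * a"
  proof (rule DERIV_nonpos_imp_nonincreasing[OF \<open>a \<le> b\<close>])
    fix x assume "a \<le> x" "x \<le> b"
    then show "\<exists>y. ((\<lambda>x. q x - c * x) has_real_derivative y) (at x) \<and> y \<le> 0"
      using le by (intro exI[of _ "p x - c"]) (auto intro!: derivative_eq_intros q)
  qed
  then show ?thesis by (simp add: algebra_simps)
qed

lemma antiderivative_diff_ge: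
  fixes p q :: "real \<Rightarrow> real"
  assumes q: "\<And>x. (q has_real_derivative p x) (at x)" and "a \<le> b"
    and ge: "\<And>x. a \<le> x \<Longrightarrow> x \<le> b \<Longrightarrow> c \<le> p x"
  shows "c * (b - a) \<le> q b - q a"
  using antiderivative_diff_le[of "\<lambda>x. - q x" "\<lambda>x. - p x" a b "- c", OF DERIV_minus[OF q]] assms(2,3)
  by simp

lemma cos_ge_cos_iff: "\<bar>x\<bar> \<le> pi \<Longrightarrow> 0 \<le> y \<Longrightarrow> y \<le> pi \<Longrightarrow> cos y \<le> cos x \<longleftrightarrow> \<bar>x\<bar> \<le> y"
  using cos_mono_le_eq[of y "\<bar>x\<bar>"] by simp

text \<open>The steps \<open>A\<close> and \<open>B\<close> have means at most, respectively at least, \<open>s\<close>, so a convex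
  combination of them has mean exactly \<open>s\<close>.\<close>
lemma oscillation_profile:
  fixes s e :: real
  assumes "0 < e" "e < s" "s + e < 1"
  obtains h f :: "real \<Rightarrow> real" and Q where "smooth_fun h" "\<And>x. - s \<le> h x" "\<And>x. h x \<le> 1 - s"
    "\<And>x. cos x > cos (pi * (s - e)) \<Longrightarrow> h x = 1 - s"
    "\<And>x. cos x < cos (pi * (s + e)) \<Longrightarrow> h x = - s"
    "\<And>x. (f has_real_derivative h x) (at x)" "\<And>x. \<bar>f x\<bar> \<le> Q"
proof -
  define c1 c2 c3 where "c1 = cos (pi * (s - e))" and "c2 = cos (pi * s)" and "c3 = cos (pi * (s + e))"
  have "pi * (s + e) < pi * 1" by (intro mult_strict_left_mono) (use assms in auto)
  then have c: "c3 < c2" "c2 < c1"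
    unfolding c1_def c2_def c3_def using assms by (auto intro!: cos_monotone_0_pi simp: algebra_simps)
  obtain S :: "real \<Rightarrow> real" where S: "smooth_fun S" "\<And>y. 0 \<le> S y" "\<And>y. S y \<le> 1"
    "\<And>y. y \<le> 0 \<Longrightarrow> S y = 0" "\<And>y. 1 \<le> y \<Longrightarrow> S y = 1" by (rule smooth_step, rule that)
  \<comment> \<open>On one period, A falls from 1 to 0 inside the interval |x| \<le> pi * s and B
    outside it, so the indicator of this interval, whose mean is s, lies between A and B.\<close>
  define A where "A x = S (1 / (c1 - c2) * (cos x - c2))" for x
  define B where "B x = S (1 / (c2 - c3) * (cos x - c3))" for x
  have A: "smooth_fun A" and B: "smooth_fun B"
    unfolding A_def[abs_def] B_def[abs_def]
    by (intro smooth_fun_compose_real[OF S(1)] smooth_fun_mult smooth_fun_diff smooth_fun_const smooth_fun_cos)+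
  have A01: "0 \<le> A x" "A x \<le> 1" and B01: "0 \<le> B x" "B x \<le> 1" for x
    using S(2,3) by (simp_all add: A_def B_def)
  have A0: "A x = 0" if "cos x \<le> c2" for x
    unfolding A_def using that c by (intro S(4)) (simp add: field_simps)
  have A1: "A x = 1" if "c1 \<le> cos x" for x
    unfolding A_def using that c by (intro S(5)) (simp add: field_simps)
  have B0: "B x = 0" if "cos x \<le> c3" for x
    unfolding B_def using that c by (intro S(4)) (simp add: field_simps)
  have B1: "B x = 1" if "c2 \<le> cos x" for x
    unfolding B_def using that c by (intro S(5)) (simp add: field_simps)
  obtain a where a: "\<And>x. (a has_real_derivative A x) (at x)"
    using ex_antiderivative[OF smooth_fun_continuous_on[OF A]] by blast
  obtain b where b: "\<And>x. (b has_real_derivative B x) (at x)"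
    using ex_antiderivative[OF smooth_fun_continuous_on[OF B]] by blast
  have s: "0 < s" "s < 1" using assms by auto
  have ps: "0 \<le> pi * s" "pi * s \<le> pi" using s by (auto simp: mult_left_le)
  have cos_in: "c2 \<le> cos x \<longleftrightarrow> \<bar>x\<bar> \<le> pi * s" if "\<bar>x\<bar> \<le> pi" for x
    unfolding c2_def using cos_ge_cos_iff[OF that ps] .
  have cos_out: "cos x \<le> c2" if "\<bar>x\<bar> \<le> pi" "pi * s \<le> \<bar>x\<bar>" for x
    unfolding c2_def using cos_monotone_0_pi_le[OF ps(1) that(2,1)] by simp
  have mA: "a pi - a (- pi) \<le> 2 * pi * s"
  proof -
    have "a (- (pi * s)) - a (- pi) \<le> 0 * (- (pi * s) - - pi)"
      by (rule antiderivative_diff_le[OF a]) (use ps in \<open>auto simp: A0 cos_out\<close>)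
    moreover have "a (pi * s) - a (- (pi * s)) \<le> 1 * (pi * s - - (pi * s))"
      by (rule antiderivative_diff_le[OF a]) (use ps A01 in auto)
    moreover have "a pi - a (pi * s) \<le> 0 * (pi - pi * s)"
      by (rule antiderivative_diff_le[OF a]) (use ps in \<open>auto simp: A0 cos_out\<close>)
    ultimately show ?thesis by simp
  qed
  have mB: "2 * pi * s \<le> b pi - b (- pi)"
  proof -
    have "0 * (- (pi * s) - - pi) \<le> b (- (pi * s)) - b (- pi)"
      by (rule antiderivative_diff_ge[OF b]) (use ps B01 in auto)
    moreover have "1 * (pi * s - - (pi * s)) \<le> b (pi * s) - b (- (pi * s))"
    proof (rule antiderivative_diff_ge[OF b])
      fix x assume "- (pi * s) \<le> x" "x \<le> pi * s"
      then have "\<bar>x\<bar> \<le> pi * s" by simp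
      then have "c2 \<le> cos x" using ps(2) cos_in[of x] by linarith
      then show "1 \<le> B x" using B1 by simp
    qed (use ps in auto)
    moreover have "0 * (pi - pi * s) \<le> b pi - b (pi * s)"
      by (rule antiderivative_diff_ge[OF b]) (use ps B01 in auto)
    ultimately show ?thesis by simp
  qed
  \<comment> \<open>The increment over one period that corresponds to mean s lies between those of a
    and b, which yields the mixing parameter u.\<close>
  have "2 * pi * s \<in> closed_segment (a pi - a (- pi)) (b pi - b (- pi))"
    using mA mB by (simp add: closed_segment_eq_real_ivl)
  then obtain u where u: "0 \<le> u" "u \<le> 1"
    "2 * pi * s = (1 - u) * (a pi - a (- pi)) + u * (b pi - b (- pi))"
    unfolding in_segment by auto
  \<comment> \<open>Where A and B are both 1 or both 0, the value of u does not matter and h is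
    exactly 1 - s or - s.\<close>
  define h where "h x = (1 - u) * A x + u * B x - s" for x
  define f where "f x = (1 - u) * a x + u * b x - s * x" for x
  have hder: "(f has_real_derivative h x) (at x)" for x
    unfolding f_def[abs_def] h_def by (auto intro!: derivative_eq_intros a b)
  have "h (x + 2 * pi) = h x" for x by (simp add: h_def A_def B_def)
  moreover have "f pi = f (- pi)" using u(3) by (simp add: f_def algebra_simps)
  ultimately obtain Q where Q: "\<And>x. \<bar>f x\<bar> \<le> Q"
    using periodic_antiderivative_bounded[OF hder] by blast
  have "(1 - u) * A x + u * B x \<in> {0..1}" for x
    using convex_bound_le[OF A01(2) B01(2), of "1 - u" u] u A01 B01 by simp
  then have "- s \<le> h x" "h x \<le> 1 - s" for x by (auto simp: h_def)
  moreover have "smooth_fun h"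
    unfolding h_def[abs_def] by (intro smooth_fun_diff smooth_fun_add smooth_fun_mult smooth_fun_const A B)
  moreover have "h x = 1 - s" if "cos x > cos (pi * (s - e))" for x
    using that A1[of x] B1[of x] c by (simp add: h_def c1_def)
  moreover have "h x = - s" if "cos x < cos (pi * (s + e))" for x
    using that A0[of x] B0[of x] c by (simp add: h_def c3_def)
  ultimately show thesis using that hder Q by blast
qed

section \<open>Averages of rapidly oscillating functions\<close>

lemma integrable_compact_support:
  fixes u :: "'a::euclidean_space \<Rightarrow> real"
  assumes "continuous_on UNIV u" "compact K" "\<And>z. z \<notin> K \<Longrightarrow> u z = 0"
  shows "integrable lborel u"
proof -
  have "integrable lborel (\<lambda>z. indicator K z *\<^sub>R u z)"
    by (rule borel_integrable_compact) (use assms in \<open>auto intro: continuous_on_subset\<close>)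
  moreover have "(\<lambda>z. indicator K z *\<^sub>R u z) = u"
    using assms(3) by (auto simp: fun_eq_iff indicator_def)
  ultimately show ?thesis by simp
qed

lemma bounded_continuous_compact_support:
  fixes u :: "'a::euclidean_space \<Rightarrow> real"
  assumes "continuous_on UNIV u" "compact K" "\<And>z. z \<notin> K \<Longrightarrow> u z = 0"
  obtains M where "\<And>z. \<bar>u z\<bar> \<le> M"
proof -
  have "bounded (u ` K)"
    by (intro compact_imp_bounded compact_continuous_image continuous_on_subset[OF assms(1)] assms) auto
  then obtain M where "\<And>z. z \<in> K \<Longrightarrow> \<bar>u z\<bar> \<le> M" unfolding bounded_iff by auto
  then have "\<bar>u z\<bar> \<le> max M 0" for z
    using assms(3)[of z] by (cases "z \<in> K") (auto simp: le_max_iff_disj)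
  then show thesis using that by blast
qed

text \<open>Translation invariance of Lebesgue measure makes the integral of every difference
  quotient vanish, and dominated convergence passes to the derivative. The integration by parts
  below rests on this.\<close>

lemma integral_directional_derivative_eq_0:
  fixes u :: "'a::euclidean_space \<Rightarrow> real"
  assumes u: "\<And>z. (u has_derivative u' z) (at z)" and cont: "continuous_on UNIV (\<lambda>z. u' z v)"
    and K: "compact K" "\<And>z. z \<notin> K \<Longrightarrow> u z = 0" "\<And>z. z \<notin> K \<Longrightarrow> u' z v = 0"
  shows "(LINT z|lborel. u' z v) = 0"
proof -
  have ucont: "continuous_on UNIV u"
    using u by (auto intro!: continuous_at_imp_continuous_on has_derivative_continuous)
  have uint: "integrable lborel u" by (rule integrable_compact_support[OF ucont K(1,2)])
  have shift: "integrable lborel (\<lambda>z. u (c + z))" "(LINT z|lborel. u (c + z)) = (LINT z|lborel. u z)" for c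
  proof -
    have meas: "(+) c \<in> measurable lborel borel" "u \<in> borel_measurable borel"
      using ucont by (auto simp: borel_measurable_continuous_onI)
    show "integrable lborel (\<lambda>z. u (c + z))"
      using integrable_distr_eq[OF meas] uint by (simp add: lborel_distr_plus)
    show "(LINT z|lborel. u (c + z)) = (LINT z|lborel. u z)"
      using integral_distr[OF meas] by (simp add: lborel_distr_plus)
  qed
  obtain M where M: "\<And>z. \<bar>u' z v\<bar> \<le> M"
    by (rule bounded_continuous_compact_support[OF cont K(1,3)], assumption, rule that)
  have line: "((\<lambda>x. u (z + x *\<^sub>R v)) has_real_derivative u' (z + x *\<^sub>R v) v) (at x)" for z x
  proof -
    have "((\<lambda>x. u (z + x *\<^sub>R v)) has_derivative (\<lambda>y. u' (z + x *\<^sub>R v) (y *\<^sub>R v))) (at x)"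
      by (rule has_derivative_compose[OF _ u]) (auto intro!: derivative_eq_intros)
    then show ?thesis
      using linear_scale[OF has_derivative_linear[OF u]]
      by (simp add: has_field_derivative_def mult.commute[of _ "u' (z + x *\<^sub>R v) v"])
  qed
  define d where "d n z = (u (inverse (real (Suc n)) *\<^sub>R v + z) - u z) * real (Suc n)" for n z
  obtain R where R: "\<And>z. z \<in> K \<Longrightarrow> norm z \<le> R"
    using compact_imp_bounded[OF K(1)] unfolding bounded_iff by blast
  \<comment> \<open>The step lengths are at most 1, so all difference quotients vanish outside this
    ball.\<close>
  let ?W = "cball (0::'a) (R + norm v)"
  have bound: "norm (d n z) \<le> indicator ?W z *\<^sub>R M" for n z
  proof (cases "z \<in> ?W")
    case True
    have "0 < inverse (real (Suc n))" by simp
    from MVT2[OF this, of "\<lambda>x. u (z + x *\<^sub>R v)" "\<lambda>x. u' (z + x *\<^sub>R v) v"] line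
    obtain x where "u (z + inverse (real (Suc n)) *\<^sub>R v) - u z = inverse (real (Suc n)) * u' (z + x *\<^sub>R v) v"
      by auto
    then have "d n z = u' (z + x *\<^sub>R v) v" by (simp add: d_def add.commute field_simps)
    then show ?thesis using M True by simp
  next
    case False
    then have z: "norm z > R + norm v" by simp
    then have "u z = 0" using R[of z] K(2)[of z] by (smt (verit) norm_ge_zero)
    moreover have "norm (inverse (real (Suc n)) *\<^sub>R v + z) > R"
    proof -
      have "norm (inverse (real (Suc n)) *\<^sub>R v) \<le> 1 * norm v"
        unfolding norm_scaleR by (intro mult_right_mono) (auto simp: field_simps)
      then show ?thesis using z norm_triangle_ineq4[of "inverse (real (Suc n)) *\<^sub>R v + z" "inverse (real (Suc n)) *\<^sub>R v"]
        by simp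
    qed
    then have "u (inverse (real (Suc n)) *\<^sub>R v + z) = 0" using R K(2) by (meson not_le)
    ultimately show ?thesis using False by (simp add: d_def)
  qed
  have lim: "(\<lambda>n. d n z) \<longlonglongrightarrow> u' z v" for z
  proof -
    have "((\<lambda>h. (u (z + h *\<^sub>R v) - u z) / h) \<longlongrightarrow> u' z v) (at 0)"
      using line[of z 0] by (simp add: has_field_derivative_iff)
    moreover have "filterlim (\<lambda>n. inverse (real (Suc n))) (at 0) sequentially"
      unfolding filterlim_at using LIMSEQ_inverse_real_of_nat by auto
    ultimately have "(\<lambda>n. (u (z + inverse (real (Suc n)) *\<^sub>R v) - u z) / inverse (real (Suc n))) \<longlonglongrightarrow> u' z v"
      by (rule filterlim_compose)
    then show ?thesis by (simp add: d_def[abs_def] add.commute divide_inverse)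
  qed
  have "(\<lambda>n. LINT z|lborel. d n z) \<longlonglongrightarrow> (LINT z|lborel. u' z v)"
  proof (rule integral_dominated_convergence[where w = "\<lambda>z. indicator ?W z *\<^sub>R M"])
    show "integrable lborel (\<lambda>z. indicator ?W z *\<^sub>R M)"
      by (rule borel_integrable_compact) auto
    show "(\<lambda>z. u' z v) \<in> borel_measurable lborel"
      using cont by (simp add: borel_measurable_continuous_onI)
    show "d n \<in> borel_measurable lborel" for n
      unfolding d_def[abs_def] using shift(1) uint by (intro borel_measurable_times borel_measurable_diff) auto
  qed (use bound lim in auto)
  moreover have "(LINT z|lborel. d n z) = 0" for n
    unfolding d_def using shift uint by simp
  ultimately show ?thesis by (simp add: LIMSEQ_const_iff)
qed

lemma ddir_cong:
  assumes "smooth_fun g" "open U" "z \<in> U" "\<And>y. y \<in> U \<Longrightarrow> f y = g y"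
  shows "ddir v f z = ddir v g z"
proof -
  have "(f has_derivative (\<lambda>v. ddir v g z)) (at z)"
    by (rule has_derivative_transform_within_open[OF smooth_fun_has_derivative[OF assms(1)] assms(2,3)])
       (use assms(4) in simp)
  then show ?thesis by (rule ddir_eq)
qed

lemma ddir_const: "ddir v (\<lambda>z. c) z = 0"
  by (rule ddir_eq[where f' = "\<lambda>_. 0"]) simp

lemma ddir_locally_const:
  assumes "open U" "z \<in> U" "\<And>y. y \<in> U \<Longrightarrow> f y = c"
  shows "ddir v f z = 0"
  using ddir_cong[OF smooth_fun_const assms] by (simp add: ddir_const)

lemma tsupport_eq_0: "z \<notin> tsupport f \<Longrightarrow> f z = 0"
  unfolding tsupport_def using closure_subset[of "{z. f z \<noteq> 0}"] by blast

lemma open_Compl_tsupport: "open (- tsupport f)"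
  by (simp add: tsupport_def open_Compl)

lemma ddir_outside_tsupport: "z \<notin> tsupport f \<Longrightarrow> ddir v f z = 0"
  by (rule ddir_locally_const[of "- tsupport f"]) (auto simp: tsupport_eq_0 open_Compl_tsupport)

lemma ddir2_outside_tsupport: "z \<notin> tsupport f \<Longrightarrow> ddir u (ddir v f) z = 0"
  by (rule ddir_locally_const[of "- tsupport f"]) (auto simp: ddir_outside_tsupport open_Compl_tsupport)

text \<open>Integrating \<open>\<theta> (p - m)\<close> against the oscillation by parts gains a factor \<open>1 / k\<close>.\<close>
lemma oscillating_average:
  fixes \<theta> l :: "'a::euclidean_space \<Rightarrow> real" and p q :: "real \<Rightarrow> real"
  assumes \<theta>: "Cc_inf G \<theta>" and l: "bounded_linear l" "l v = 1"
    and p: "continuous_on UNIV p" "\<And>x. p (x + 2 * pi) = p x"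
    and q: "\<And>x. (q has_real_derivative p x) (at x)"
  obtains C where "\<And>k. 0 < k \<Longrightarrow>
    \<bar>(LINT z|lborel. \<theta> z * p (k * l z)) - (q pi - q (- pi)) / (2 * pi) * (LINT z|lborel. \<theta> z)\<bar> \<le> C / k"
proof -
  \<comment> \<open>m is the mean of p over a period, and r a bounded antiderivative of p -
    m.\<close>
  define m where "m = (q pi - q (- pi)) / (2 * pi)"
  define r where "r x = q x - m * x" for x
  have r: "(r has_real_derivative p x - m) (at x)" for x
    unfolding r_def[abs_def] by (auto intro!: derivative_eq_intros q)
  have "r pi = r (- pi)" by (simp add: r_def m_def field_simps)
  then obtain Q where Q: "\<And>x. \<bar>r x\<bar> \<le> Q"
    using periodic_antiderivative_bounded[OF r] p(2) by metis
  have sm: "smooth_fun \<theta>" and cK: "compact (tsupport \<theta>)" using \<theta> by (auto simp: Cc_inf_def)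
  have cl: "continuous_on S (\<lambda>z. k * l z)" for S k
    by (intro continuous_intros linear_continuous_on[OF l(1)])
  have cp: "continuous_on UNIV (\<lambda>z. p (k * l z))" for k
    using continuous_on_compose2[OF p(1) cl] by simp
  have "continuous_on UNIV r"
    using r by (auto intro!: continuous_at_imp_continuous_on DERIV_isCont)
  then have cr: "continuous_on UNIV (\<lambda>z. r (k * l z))" for k
    by (rule continuous_on_compose2[OF _ cl]) simp
  let ?C = "Q * (LINT z|lborel. \<bar>ddir v \<theta> z\<bar>)"
  have "\<bar>(LINT z|lborel. \<theta> z * p (k * l z)) - m * (LINT z|lborel. \<theta> z)\<bar> \<le> ?C / k" if "0 < k" for k
  proof -
    \<comment> \<open>The derivative of \<open>\<theta> z * r (k * l z)\<close>. In direction v,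
      where \<open>l v = 1\<close>, it is k times the wanted integrand plus an error bounded
      independently of k.\<close>
    define u' where "u' z w = \<theta> z * ((p (k * l z) - m) * (k * l w)) + ddir w \<theta> z * r (k * l z)" for z w
    have rder: "((\<lambda>z. r (k * l z)) has_derivative (\<lambda>w. (p (k * l z) - m) * (k * l w))) (at z)" for z
      by (rule has_derivative_compose[of "\<lambda>z. k * l z", OF _ r[unfolded has_field_derivative_def]])
         (intro has_derivative_mult_right bounded_linear_imp_has_derivative l(1))
    have u: "((\<lambda>z. \<theta> z * r (k * l z)) has_derivative u' z) (at z)" for z
      unfolding u'_def[abs_def] by (rule has_derivative_mult[OF smooth_fun_has_derivative[OF sm] rder])
    have int: "integrable lborel (\<lambda>z. \<theta> z * g z)" if "continuous_on UNIV g" for g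
      by (rule integrable_compact_support[OF _ cK])
         (auto intro!: continuous_intros smooth_fun_continuous_on[OF sm] that simp: tsupport_eq_0)
    have cd: "continuous_on UNIV (ddir v \<theta>)" by (rule smooth_fun_continuous_on[OF smooth_fun_ddir[OF sm]])
    have int1: "integrable lborel (\<lambda>z. ddir v \<theta> z * r (k * l z))"
      by (rule integrable_compact_support[OF _ cK])
         (auto intro!: continuous_intros cd cr simp: ddir_outside_tsupport)
    have int2: "integrable lborel (\<lambda>z. ddir v \<theta> z)"
      by (rule integrable_compact_support[OF cd cK]) (simp add: ddir_outside_tsupport)
    have int3: "integrable lborel (\<lambda>z. \<theta> z * p (k * l z))" "integrable lborel \<theta>"
      using int[OF cp, of k] int[of "\<lambda>_. 1"] by auto
    have u'v: "u' z v = k * (\<theta> z * p (k * l z) - m * \<theta> z) + ddir v \<theta> z * r (k * l z)" for z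
      unfolding u'_def l(2) by (simp add: algebra_simps)
    have "(LINT z|lborel. u' z v) = 0"
    proof (rule integral_directional_derivative_eq_0[OF u _ cK])
      show "continuous_on UNIV (\<lambda>z. u' z v)"
        unfolding u'v by (intro continuous_intros cp cd cr smooth_fun_continuous_on[OF sm])
    qed (auto simp: u'_def tsupport_eq_0 ddir_outside_tsupport)
    then have "k * ((LINT z|lborel. \<theta> z * p (k * l z)) - m * (LINT z|lborel. \<theta> z))
        = - (LINT z|lborel. ddir v \<theta> z * r (k * l z))"
      unfolding u'v using int1 int3 by simp
    moreover have "\<bar>LINT z|lborel. ddir v \<theta> z * r (k * l z)\<bar> \<le> (LINT z|lborel. Q * \<bar>ddir v \<theta> z\<bar>)"
    proof (rule order_trans[OF integral_abs_bound], rule integral_mono)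
      fix z show "\<bar>ddir v \<theta> z * r (k * l z)\<bar> \<le> Q * \<bar>ddir v \<theta> z\<bar>"
        using mult_right_mono[OF Q[of "k * l z"] abs_ge_zero[of "ddir v \<theta> z"]] by (simp add: abs_mult mult.commute)
    qed (use int1 int2 in auto)
    ultimately have "\<bar>k * ((LINT z|lborel. \<theta> z * p (k * l z)) - m * (LINT z|lborel. \<theta> z))\<bar> \<le> ?C" by simp
    then have "\<bar>(LINT z|lborel. \<theta> z * p (k * l z)) - m * (LINT z|lborel. \<theta> z)\<bar> * k \<le> ?C"
      using \<open>0 < k\<close> by (simp only: abs_mult abs_of_pos mult.commute[of k])
    then show ?thesis using \<open>0 < k\<close> by (simp only: pos_le_divide_eq)
  qed
  then show thesis using that unfolding m_def by blast
qed

text \<open>Up to the phase, a continuous p is squeezed on one period between the indicators of |x|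
  \<le> pi * \<alpha> and of |x| < pi * \<beta>; its mean is therefore at least \<alpha>, and the
  gap pays for its continuity. The cutoff costs e twice: once on \<open>G - K\<close>, once in
  comparing the integral of \<theta> with the measure of G. The phase lets the same bound serve sets
  where the cosine is small.\<close>

lemma oscillating_set_measure:
  fixes \<theta> l :: "'a::euclidean_space \<Rightarrow> real"
  assumes G: "open G" "bounded G"
    and \<theta>: "Cc_inf G \<theta>" "\<And>z. 0 \<le> \<theta> z" "\<And>z. \<theta> z \<le> 1"
    and K: "open K" "\<And>z. z \<in> K \<Longrightarrow> \<theta> z = 1" "measure lborel G - e \<le> measure lborel K"
    and l: "bounded_linear l" "l v = 1" and ab: "0 \<le> \<alpha>" "\<alpha> < \<beta>" "\<beta> \<le> 1"
  obtains C where "\<And>k. 0 < k \<Longrightarrow>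
    \<alpha> * measure lborel G - 2 * e - C / k \<le> measure lborel {z \<in> K. cos (\<phi> + k * l z) > cos (pi * \<beta>)}"
proof -
  define c0 c1 where "c0 = cos (pi * \<alpha>)" and "c1 = cos (pi * \<beta>)"
  have pab: "0 \<le> pi * \<alpha>" "pi * \<alpha> < pi * \<beta>" "pi * \<beta> \<le> pi" using ab by (auto simp: mult_left_le)
  then have c: "c1 < c0" unfolding c0_def c1_def by (intro cos_monotone_0_pi) auto
  define p where "p x = max 0 (min 1 ((cos (\<phi> + x) - c1) / (c0 - c1)))" for x
  have pcont: "continuous_on UNIV p" unfolding p_def[abs_def] using c by (intro continuous_intros) auto
  have pper: "p (x + 2 * pi) = p x" for x
    using cos_periodic[of "\<phi> + x"] by (simp add: p_def add.assoc)
  have p01: "0 \<le> p x" "p x \<le> 1" for x by (auto simp: p_def)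
  have p0: "p x = 0" if "\<not> cos (\<phi> + x) > c1" for x
  proof -
    have "(cos (\<phi> + x) - c1) / (c0 - c1) \<le> 0" using that c by (intro divide_nonpos_pos) auto
    then show ?thesis by (simp add: p_def)
  qed
  have p1: "1 \<le> p x" if "\<bar>\<phi> + x\<bar> \<le> pi * \<alpha>" for x
  proof -
    have "c0 \<le> cos (\<phi> + x)" unfolding c0_def using cos_ge_cos_iff[of "\<phi> + x" "pi * \<alpha>"] that pab by linarith
    then have "1 \<le> (cos (\<phi> + x) - c1) / (c0 - c1)" using c by (simp add: field_simps)
    then show ?thesis by (simp add: p_def)
  qed
  obtain q where q: "\<And>x. (q has_real_derivative p x) (at x)" using ex_antiderivative[OF pcont] by blast
  \<comment> \<open>The period is centred at - \<phi>, the midpoint of the plateau of p.\<close>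
  have mean: "2 * pi * \<alpha> \<le> q pi - q (- pi)"
  proof -
    have "0 * (- (pi * \<alpha>) - \<phi> - (- pi - \<phi>)) \<le> q (- (pi * \<alpha>) - \<phi>) - q (- pi - \<phi>)"
      by (rule antiderivative_diff_ge[OF q]) (use pab p01 in auto)
    moreover have "1 * (pi * \<alpha> - \<phi> - (- (pi * \<alpha>) - \<phi>)) \<le> q (pi * \<alpha> - \<phi>) - q (- (pi * \<alpha>) - \<phi>)"
      by (rule antiderivative_diff_ge[OF q]) (use pab p1 in auto)
    moreover have "0 * (pi - \<phi> - (pi * \<alpha> - \<phi>)) \<le> q (pi - \<phi>) - q (pi * \<alpha> - \<phi>)"
      by (rule antiderivative_diff_ge[OF q]) (use pab p01 in auto)
    moreover have "q (pi - \<phi>) - q (- pi - \<phi>) = q pi - q (- pi)"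
      using periodic_antiderivative_diff[OF q pper, of "- pi - \<phi>" "- pi"] by (simp add: algebra_simps)
    ultimately show ?thesis by simp
  qed
  obtain C where C: "\<And>k. 0 < k \<Longrightarrow>
    \<bar>(LINT z|lborel. \<theta> z * p (k * l z)) - (q pi - q (- pi)) / (2 * pi) * (LINT z|lborel. \<theta> z)\<bar> \<le> C / k"
    using oscillating_average[OF \<theta>(1) l pcont pper q] by blast
  have sm: "smooth_fun \<theta>" and cK: "compact (tsupport \<theta>)" and sub: "tsupport \<theta> \<subseteq> G"
    using \<theta>(1) by (auto simp: Cc_inf_def)
  have KG: "K \<subseteq> G"
  proof
    fix z assume "z \<in> K"
    then have "\<theta> z \<noteq> 0" using K(2) by simp
    then show "z \<in> G" using tsupport_eq_0[of z \<theta>] sub by blast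
  qed
  have fin: "emeasure lborel A < \<infinity>" if "A \<subseteq> G" for A
    using bounded_subset[OF G(2) that] emeasure_bounded_finite by blast
  have "\<alpha> * measure lborel G - 2 * e - C / k \<le> measure lborel {z \<in> K. cos (\<phi> + k * l z) > cos (pi * \<beta>)}"
    if "0 < k" for k
  proof -
    let ?E = "{z \<in> K. cos (\<phi> + k * l z) > cos (pi * \<beta>)}"
    have cl: "continuous_on UNIV (\<lambda>z. k * l z)"
      by (intro continuous_intros linear_continuous_on[OF l(1)])
    then have "open {z. cos (\<phi> + k * l z) > cos (pi * \<beta>)}"
      by (intro open_Collect_less continuous_on_const continuous_on_cos continuous_on_add)
    then have "open ?E" using open_Int[OF K(1)] by (simp add: Collect_conj_eq)
    have EG: "?E \<subseteq> G" using KG by blast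
    have sets: "?E \<in> sets lborel" "G - K \<in> sets lborel" "K \<in> sets lborel"
      using \<open>open ?E\<close> K(1) G(1) by auto
    have indint: "integrable lborel (indicator A :: 'a \<Rightarrow> real)" if "A \<in> sets lborel" "A \<subseteq> G" for A
      using that fin by simp
    have cp: "continuous_on UNIV (\<lambda>z. p (k * l z))"
      using continuous_on_compose2[OF pcont cl] by simp
    have int: "integrable lborel (\<lambda>z. \<theta> z * p (k * l z))"
      by (rule integrable_compact_support[OF _ cK])
         (auto intro!: continuous_intros smooth_fun_continuous_on[OF sm] cp simp: tsupport_eq_0)
    have int\<theta>: "integrable lborel \<theta>"
      by (rule integrable_compact_support[OF smooth_fun_continuous_on[OF sm] cK]) (simp add: tsupport_eq_0)
    have "(LINT z|lborel. \<theta> z * p (k * l z)) \<le> (LINT z|lborel. indicator ?E z + indicator (G - K) z)"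
    proof (rule integral_mono[OF int])
      show "integrable lborel (\<lambda>z. indicator ?E z + indicator (G - K) z :: real)"
        using indint[OF sets(1) EG] indint[OF sets(2)] by auto
      fix z
      have le1: "\<theta> z * p (k * l z) \<le> 1" using \<theta>(2,3) p01 mult_le_one by blast
      consider "z \<in> ?E" | "z \<in> K" "z \<notin> ?E" | "z \<in> G - K" | "z \<notin> G" using KG by blast
      then show "\<theta> z * p (k * l z) \<le> indicator ?E z + indicator (G - K) z"
      proof cases
        case 2
        then have "p (k * l z) = 0" by (intro p0) (simp add: c1_def)
        then show ?thesis by (simp add: indicator_def)
      next
        case 4
        then have "\<theta> z = 0" using sub tsupport_eq_0[of z \<theta>] by blast
        then show ?thesis by (simp add: indicator_def)
      qed (use le1 in \<open>auto simp: indicator_def\<close>)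
    qed
    also have "\<dots> = measure lborel ?E + measure lborel (G - K)"
      using indint[OF sets(1) EG] indint[OF sets(2)] sets by simp
    also have "measure lborel (G - K) = measure lborel G - measure lborel K"
      using fin[of G] G K(1) KG by (intro measure_Diff) auto
    finally have 1: "(LINT z|lborel. \<theta> z * p (k * l z)) \<le> measure lborel ?E + e" using K(3) by simp
    have "measure lborel K = (LINT z|lborel. indicator K z)" using sets(3) by simp
    also have "\<dots> \<le> (LINT z|lborel. \<theta> z)"
      by (rule integral_mono[OF indint[OF sets(3) KG] int\<theta>]) (use \<theta>(2) K(2) in \<open>auto simp: indicator_def\<close>)
    finally have 2: "measure lborel G - e \<le> (LINT z|lborel. \<theta> z)" using K(3) by simp
    have "e \<ge> 0"
    proof -
      have "measure lborel K \<le> measure lborel G"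
        by (rule measure_mono_fmeasurable[OF KG sets(3)]) (use fin[of G] G in \<open>simp add: fmeasurable_def\<close>)
      then show ?thesis using K(3) by simp
    qed
    have "\<alpha> * measure lborel G - e \<le> \<alpha> * (measure lborel G - e)"
      using \<open>e \<ge> 0\<close> ab mult_right_mono[of \<alpha> 1 e] by (simp add: algebra_simps)
    also have "\<dots> \<le> \<alpha> * (LINT z|lborel. \<theta> z)" using 2 ab by (intro mult_left_mono) auto
    also have "\<dots> \<le> (q pi - q (- pi)) / (2 * pi) * (LINT z|lborel. \<theta> z)"
      using mean \<theta>(2) by (intro mult_right_mono integral_nonneg_AE) (auto simp: field_simps)
    also have "\<dots> \<le> (LINT z|lborel. \<theta> z * p (k * l z)) + C / k" using C[OF that] by linarith
    finally show ?thesis using 1 by linarith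
  qed
  then show thesis using that by blast
qed

section \<open>The oscillating potential\<close>

lemma ddir_mult:
  fixes f g :: "'a::real_normed_vector \<Rightarrow> real"
  assumes "smooth_fun f" "(g has_derivative g') (at z)"
  shows "ddir v (\<lambda>z. f z * g z) z = f z * g' v + ddir v f z * g z"
  using has_derivative_mult[OF smooth_fun_has_derivative[OF assms(1)] assms(2)] by (rule ddir_eq)

text \<open>Each derivative that falls on the oscillating factor uses up one of the two factors 1 /
  k; only the term in which both derivatives do so is of order 1.\<close>

lemma ddir_scaled_oscillation:
  fixes \<theta> l :: "'a::real_normed_vector \<Rightarrow> real" and F f h :: "real \<Rightarrow> real"
  assumes \<theta>: "smooth_fun \<theta>" and l: "bounded_linear l" and k: "k > 0"
    and F: "\<And>x. (F has_real_derivative f x) (at x)" and f: "\<And>x. (f has_real_derivative h x) (at x)"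
  defines "w \<equiv> \<lambda>z. \<theta> z * (F (k * l z) / k\<^sup>2)"
  shows "ddir b w z = \<theta> z * (f (k * l z) / k * l b) + ddir b \<theta> z * (F (k * l z) / k\<^sup>2)"
    and "ddir a (ddir b w) z = \<theta> z * (h (k * l z) * (l a * l b))
      + f (k * l z) / k * (ddir a \<theta> z * l b + ddir b \<theta> z * l a)
      + ddir a (ddir b \<theta>) z * (F (k * l z) / k\<^sup>2)"
proof -
  have chain: "((\<lambda>z. g (k * l z) / c) has_derivative (\<lambda>v. g' (k * l z) * (k * l v) / c)) (at z)"
    if "\<And>x. (g has_real_derivative g' x) (at x)" for g g' :: "real \<Rightarrow> real" and z c
  proof -
    have "((\<lambda>z. g (k * l z)) has_derivative (\<lambda>v. g' (k * l z) * (k * l v))) (at z)"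
      by (rule has_derivative_compose[of "\<lambda>z. k * l z", OF _ that[unfolded has_field_derivative_def]])
         (intro has_derivative_mult_right bounded_linear_imp_has_derivative l)
    then show ?thesis by (rule bounded_linear.has_derivative[OF bounded_linear_divide])
  qed
  have Fd: "((\<lambda>z. F (k * l z) / k\<^sup>2) has_derivative (\<lambda>v. f (k * l z) / k * l v)) (at z)" for z
    using chain[OF F, of "k\<^sup>2" z] k by (simp add: power2_eq_square)
  have fd: "((\<lambda>z. f (k * l z) / k * l b) has_derivative (\<lambda>v. h (k * l z) * (l v * l b))) (at z)" for z
    using has_derivative_mult_left[OF chain[OF f, of k z], of "l b"] k by (simp add: mult.assoc)
  have 1: "ddir b w z = \<theta> z * (f (k * l z) / k * l b) + ddir b \<theta> z * (F (k * l z) / k\<^sup>2)" for z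
    unfolding w_def by (rule ddir_mult[OF \<theta> Fd])
  then show "ddir b w z = \<theta> z * (f (k * l z) / k * l b) + ddir b \<theta> z * (F (k * l z) / k\<^sup>2)" .
  have "((\<lambda>z. \<theta> z * (f (k * l z) / k * l b) + ddir b \<theta> z * (F (k * l z) / k\<^sup>2)) has_derivative
      (\<lambda>v. (\<theta> z * (h (k * l z) * (l v * l b)) + ddir v \<theta> z * (f (k * l z) / k * l b))
        + (ddir b \<theta> z * (f (k * l z) / k * l v) + ddir v (ddir b \<theta>) z * (F (k * l z) / k\<^sup>2)))) (at z)"
    by (intro has_derivative_add has_derivative_mult smooth_fun_has_derivative smooth_fun_ddir \<theta> Fd fd)
  then have "ddir a (ddir b w) z = (\<theta> z * (h (k * l z) * (l a * l b)) + ddir a \<theta> z * (f (k * l z) / k * l b))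
        + (ddir b \<theta> z * (f (k * l z) / k * l a) + ddir a (ddir b \<theta>) z * (F (k * l z) / k\<^sup>2))"
    unfolding 1[abs_def] by (rule ddir_eq)
  then show "ddir a (ddir b w) z = \<theta> z * (h (k * l z) * (l a * l b))
      + f (k * l z) / k * (ddir a \<theta> z * l b + ddir b \<theta> z * l a)
      + ddir a (ddir b \<theta>) z * (F (k * l z) / k\<^sup>2)"
    by (simp add: distrib_left mult.assoc mult.left_commute add.assoc mult.commute)
qed

lemma finite_uniform_bound:
  fixes f :: "'i \<Rightarrow> 'a \<Rightarrow> real"
  assumes "finite I" "\<And>i. i \<in> I \<Longrightarrow> \<exists>M. \<forall>z. \<bar>f i z\<bar> \<le> M"
  shows "\<exists>M\<ge>0. \<forall>i\<in>I. \<forall>z. \<bar>f i z\<bar> \<le> M"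
  using assms
proof (induction I rule: finite_induct)
  case (insert i I)
  obtain M where M: "M \<ge> 0" "\<forall>i\<in>I. \<forall>z. \<bar>f i z\<bar> \<le> M" using insert by auto
  obtain M' where M': "\<forall>z. \<bar>f i z\<bar> \<le> M'" using insert.prems by blast
  show ?case
  proof (intro exI[of _ "max M M'"] conjI ballI allI)
    fix j z assume "j \<in> insert i I"
    then show "\<bar>f j z\<bar> \<le> max M M'" using M M' by (auto simp: le_max_iff_disj)
  qed (use M in simp)
qed auto

lemma compactly_in_tsupport:
  assumes "Cc_inf G \<theta>" "A \<subseteq> {z. \<theta> z \<noteq> 0}"
  shows "compactly_in A G"
proof -
  have sub: "closure A \<subseteq> tsupport \<theta>" unfolding tsupport_def using assms(2) by (rule closure_mono)
  moreover have "compact (tsupport \<theta>)" "tsupport \<theta> \<subseteq> G" using assms(1) by (auto simp: Cc_inf_def)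
  ultimately show ?thesis unfolding compactly_in_def
    using compact_Int_closed[of "tsupport \<theta>" "closure A"] by (auto simp: Int_absorb1)
qed

text \<open>The finite set V holds the directions in which errors have to be small. On E1 and E2 the
  Hessian is exact in all directions, because there the cutoff is constant and the profile sits on a
  plateau.\<close>

lemma oscillating_potential:
  fixes G :: "'a::euclidean_space set" and l :: "'a \<Rightarrow> real"
  assumes G: "open G" "bounded G" and l: "bounded_linear l" "l v = 1"
    and s: "0 < s" "s < 1" and V: "finite V" and e: "0 < e"
  obtains w H :: "'a \<Rightarrow> real" and E1 E2 where "Cc_inf G w" "\<And>z. - s \<le> H z" "\<And>z. H z \<le> 1 - s"
    "\<And>z. \<bar>w z\<bar> \<le> e" "\<And>a z. a \<in> V \<Longrightarrow> \<bar>ddir a w z\<bar> \<le> e"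
    "\<And>a b z. a \<in> V \<Longrightarrow> b \<in> V \<Longrightarrow> \<bar>ddir a (ddir b w) z - H z * (l a * l b)\<bar> \<le> e"
    "open E1" "open E2" "E1 \<inter> E2 = {}" "compactly_in E1 G" "compactly_in E2 G"
    "\<And>a b z. z \<in> E1 \<Longrightarrow> ddir a (ddir b w) z = (1 - s) * (l a * l b)"
    "\<And>a b z. z \<in> E2 \<Longrightarrow> ddir a (ddir b w) z = - s * (l a * l b)"
    "s * measure lborel G - e \<le> measure lborel E1" "(1 - s) * measure lborel G - e \<le> measure lborel E2"
proof -
  define M where "M = measure lborel G"
  have "M \<ge> 0" by (simp add: M_def)
  \<comment> \<open>The first bound keeps s - 2 * \<epsilon> and s + 2 * \<epsilon> inside (0,1);
    the second limits the volume lost to the transition layers to e / 4.\<close>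
  define \<epsilon> where "\<epsilon> = min (min s (1 - s) / 3) (e / (8 * (M + 1)))"
  have \<epsilon>: "0 < \<epsilon>" "2 * \<epsilon> < s" "s + 2 * \<epsilon> < 1"
  proof -
    have *: "\<epsilon> \<le> s / 3" "3 * \<epsilon> \<le> 1 - s"
      by (auto simp: \<epsilon>_def min_def field_simps)
    show "2 * \<epsilon> < s" using *(1) s by linarith
    show "s + 2 * \<epsilon> < 1" using *(2) s by linarith
    show "0 < \<epsilon>" using s e \<open>M \<ge> 0\<close> by (simp add: \<epsilon>_def)
  qed
  have \<epsilon>M: "2 * \<epsilon> * M \<le> e / 4"
  proof -
    have "\<epsilon> * M \<le> e / (8 * (M + 1)) * (M + 1)"
      using \<open>M \<ge> 0\<close> e by (intro mult_mono) (auto simp: \<epsilon>_def)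
    also have "\<dots> = e / 8" using \<open>M \<ge> 0\<close> by (simp add: field_simps)
    finally show ?thesis by simp
  qed
  obtain \<theta> :: "'a \<Rightarrow> real" and K where \<theta>: "Cc_inf G \<theta>" "\<And>z. 0 \<le> \<theta> z" "\<And>z. \<theta> z \<le> 1"
    and K: "open K" "\<And>z. z \<in> K \<Longrightarrow> \<theta> z = 1" "measure lborel G - e / 8 \<le> measure lborel K"
    by (rule smooth_cutoff[OF G, of "e / 8"]) (use e in simp, rule that)
  have sm: "smooth_fun \<theta>" and cK: "compact (tsupport \<theta>)" using \<theta>(1) by (auto simp: Cc_inf_def)
  obtain h f :: "real \<Rightarrow> real" and Q where h: "smooth_fun h" "\<And>x. - s \<le> h x" "\<And>x. h x \<le> 1 - s"
    "\<And>x. cos x > cos (pi * (s - \<epsilon>)) \<Longrightarrow> h x = 1 - s"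
    "\<And>x. cos x < cos (pi * (s + \<epsilon>)) \<Longrightarrow> h x = - s"
    and f: "\<And>x. (f has_real_derivative h x) (at x)" and Q: "\<And>x. \<bar>f x\<bar> \<le> Q"
    by (rule oscillation_profile[of \<epsilon> s]) (use \<epsilon> in simp, use \<epsilon> in simp, use \<epsilon> in simp, rule that)
  have "Q \<ge> 0" using Q[of 0] by linarith
  have smf: "smooth_fun f" by (rule smooth_fun_antiderivative[OF h(1) f])
  obtain F where F: "\<And>x. (F has_real_derivative f x) (at x)" "F 0 = 0"
    using ex_antiderivative[OF smooth_fun_continuous_on[OF smf]] by blast
  have smF: "smooth_fun F" by (rule smooth_fun_antiderivative[OF smf F(1)])
  \<comment> \<open>F need not be bounded, as f may have nonzero mean. Linear growth suffices: F is
    evaluated at k * l z, with l bounded on the support of \<theta>, and divided by the square of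
    k.\<close>
  have FQ: "\<bar>F x\<bar> \<le> Q * \<bar>x\<bar>" for x
    using field_differentiable_bound[OF convex_UNIV, of F f Q x 0] F Q by auto
  obtain C1 where C1: "\<And>k. 0 < k \<Longrightarrow> (s - 2 * \<epsilon>) * measure lborel G - 2 * (e / 8) - C1 / k
      \<le> measure lborel {z \<in> K. cos (0 + k * l z) > cos (pi * (s - \<epsilon>))}"
    by (rule oscillating_set_measure[OF G \<theta> K(1) _ K(3) l, of "s - 2 * \<epsilon>" "s - \<epsilon>" 0])
       (rule K(2), assumption, use \<epsilon> s in simp, use \<epsilon> in simp, use \<epsilon> s in simp, rule that)
  \<comment> \<open>The set where the cosine is small is reached by a phase shift by pi, which
    exchanges s and 1 - s.\<close>
  obtain C2 where C2: "\<And>k. 0 < k \<Longrightarrow> (1 - s - 2 * \<epsilon>) * measure lborel G - 2 * (e / 8) - C2 / k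
      \<le> measure lborel {z \<in> K. cos (pi + k * l z) > cos (pi * (1 - s - \<epsilon>))}"
    by (rule oscillating_set_measure[OF G \<theta> K(1) _ K(3) l, of "1 - s - 2 * \<epsilon>" "1 - s - \<epsilon>" pi])
       (rule K(2), assumption, use \<epsilon> s in simp, use \<epsilon> in simp, use \<epsilon> s in simp, rule that)
  obtain L where L: "L \<ge> 0" "\<And>a. a \<in> V \<Longrightarrow> \<bar>l a\<bar> \<le> L"
    using finite_uniform_bound[OF V, of "\<lambda>a _. l a"] by auto
  have "\<exists>T. \<forall>z. \<bar>ddir a \<theta> z\<bar> \<le> T" for a
    using bounded_continuous_compact_support[OF smooth_fun_continuous_on[OF smooth_fun_ddir[OF sm]] cK]
      ddir_outside_tsupport by metis
  then obtain T1 where T1: "T1 \<ge> 0" "\<And>a z. a \<in> V \<Longrightarrow> \<bar>ddir a \<theta> z\<bar> \<le> T1"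
    using finite_uniform_bound[OF V, of "\<lambda>a z. ddir a \<theta> z"] by auto
  have "\<exists>T. \<forall>z. \<bar>ddir a (ddir b \<theta>) z\<bar> \<le> T" for a b
    using bounded_continuous_compact_support[OF smooth_fun_continuous_on[OF smooth_fun_ddir[OF smooth_fun_ddir[OF sm]]] cK]
      ddir2_outside_tsupport by metis
  then obtain T2 where T2: "T2 \<ge> 0" "\<And>a b z. a \<in> V \<Longrightarrow> b \<in> V \<Longrightarrow> \<bar>ddir a (ddir b \<theta>) z\<bar> \<le> T2"
    using finite_uniform_bound[of "V \<times> V" "\<lambda>(a, b) z. ddir a (ddir b \<theta>) z"] V by force
  have "bounded (l ` tsupport \<theta>)"
    by (intro compact_imp_bounded compact_continuous_image linear_continuous_on l cK)
  then obtain R where R: "R > 0" "\<And>z. z \<in> tsupport \<theta> \<Longrightarrow> \<bar>l z\<bar> \<le> R"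
    unfolding bounded_pos by auto
  \<comment> \<open>B dominates the numerators of all bounds of the form constant / k, for w, its
    first derivatives and the Hessian error; k below brings these terms and the averaging errors
    down to e / 4.\<close>
  define B where "B = Q * R * (1 + T1 + T2) + Q * L * (1 + 2 * T1)"
  have B0: "B \<ge> 0" unfolding B_def using \<open>Q \<ge> 0\<close> L T1 T2 R by simp
  define k where "k = (B + \<bar>C1\<bar> + \<bar>C2\<bar> + 1) * 4 / e"
  have k: "k > 0" unfolding k_def using B0 e by (simp add: add_nonneg_pos)
  have small: "C / k \<le> e / 4" if "C \<le> B + \<bar>C1\<bar> + \<bar>C2\<bar>" for C
  proof -
    have "C / k \<le> (B + \<bar>C1\<bar> + \<bar>C2\<bar> + 1) / k" using that k by (intro divide_right_mono) auto
    also have "\<dots> = e / 4" unfolding k_def using B0 e by (simp add: field_simps add_nonneg_pos)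
    finally show ?thesis .
  qed
  define w where "w z = \<theta> z * (F (k * l z) / k\<^sup>2)" for z
  define H where "H z = \<theta> z * h (k * l z)" for z
  define E1 where "E1 = {z \<in> K. cos (k * l z) > cos (pi * (s - \<epsilon>))}"
  define E2 where "E2 = {z \<in> K. cos (k * l z) < cos (pi * (s + \<epsilon>))}"
  note wd = ddir_scaled_oscillation[OF sm l(1) k F(1) f, folded w_def[abs_def]]
  have Fk: "\<bar>F (k * l z) / k\<^sup>2\<bar> \<le> Q * R / k" if "z \<in> tsupport \<theta>" for z
  proof -
    have "\<bar>F (k * l z)\<bar> \<le> Q * (k * R)"
      using order_trans[OF FQ mult_left_mono[OF _ \<open>Q \<ge> 0\<close>], of "k * l z" "k * R"] R(2)[OF that] k
      by (simp add: abs_mult)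
    then show ?thesis using k by (simp add: abs_div power2_eq_square field_simps)
  qed
  have fk: "\<bar>f (k * l z) / k\<bar> \<le> Q / k" for z
    using Q[of "k * l z"] k by (simp add: abs_div divide_right_mono)
  have "B / k \<le> e / 4" by (rule small) simp
  then have e4: "x \<le> B / k \<Longrightarrow> x \<le> e" for x using e by linarith
  have w_bound: "\<bar>w z\<bar> \<le> e" for z
  proof (cases "z \<in> tsupport \<theta>")
    case True
    have "\<bar>w z\<bar> \<le> 1 * (Q * R / k)"
      unfolding w_def abs_mult using \<theta>(2,3) Fk[OF True] by (intro mult_mono) auto
    also have "\<dots> \<le> B / k"
      unfolding B_def using k \<open>Q \<ge> 0\<close> L T1 T2 R by (simp add: divide_right_mono distrib_left)
    finally show ?thesis by (rule e4)
  next
    case False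
    then show ?thesis using e by (simp add: w_def tsupport_eq_0)
  qed
  have dw_bound: "\<bar>ddir a w z\<bar> \<le> e" if a: "a \<in> V" for a z
  proof (cases "z \<in> tsupport \<theta>")
    case True
    have "\<bar>\<theta> z * (f (k * l z) / k * l a)\<bar> \<le> 1 * (Q / k * L)"
      unfolding abs_mult using \<theta>(2,3) fk L a \<open>Q \<ge> 0\<close> k by (intro mult_mono) auto
    moreover have "\<bar>ddir a \<theta> z * (F (k * l z) / k\<^sup>2)\<bar> \<le> T1 * (Q * R / k)"
      unfolding abs_mult using T1 Fk[OF True] a by (intro mult_mono) auto
    ultimately have "\<bar>ddir a w z\<bar> \<le> 1 * (Q / k * L) + T1 * (Q * R / k)"
      unfolding wd by linarith
    also have "\<dots> = (Q * L + T1 * (Q * R)) / k" by (simp add: add_divide_distrib)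
    also have "\<dots> \<le> B / k"
      unfolding B_def using k \<open>Q \<ge> 0\<close> L T1 T2 R by (intro divide_right_mono) (auto simp: algebra_simps)
    finally show ?thesis by (rule e4)
  next
    case False
    then show ?thesis using e by (simp add: wd tsupport_eq_0 ddir_outside_tsupport)
  qed
  have ddw_bound: "\<bar>ddir a (ddir b w) z - H z * (l a * l b)\<bar> \<le> e" if ab: "a \<in> V" "b \<in> V" for a b z
  proof (cases "z \<in> tsupport \<theta>")
    case True
    have "\<bar>f (k * l z) / k * (ddir a \<theta> z * l b + ddir b \<theta> z * l a)\<bar> \<le> Q / k * (2 * (T1 * L))"
    proof -
      have "\<bar>ddir a \<theta> z * l b\<bar> \<le> T1 * L" "\<bar>ddir b \<theta> z * l a\<bar> \<le> T1 * L"
        unfolding abs_mult using T1 L ab by (auto intro!: mult_mono)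
      then have "\<bar>ddir a \<theta> z * l b + ddir b \<theta> z * l a\<bar> \<le> 2 * (T1 * L)" by linarith
      then show ?thesis unfolding abs_mult[of "f (k * l z) / k"]
        using fk \<open>Q \<ge> 0\<close> k by (intro mult_mono) auto
    qed
    moreover have "\<bar>ddir a (ddir b \<theta>) z * (F (k * l z) / k\<^sup>2)\<bar> \<le> T2 * (Q * R / k)"
      unfolding abs_mult using T2 Fk[OF True] ab by (intro mult_mono) auto
    moreover have "ddir a (ddir b w) z - H z * (l a * l b)
        = f (k * l z) / k * (ddir a \<theta> z * l b + ddir b \<theta> z * l a) + ddir a (ddir b \<theta>) z * (F (k * l z) / k\<^sup>2)"
      unfolding wd H_def by (simp add: mult.assoc)
    ultimately have "\<bar>ddir a (ddir b w) z - H z * (l a * l b)\<bar> \<le> Q / k * (2 * (T1 * L)) + T2 * (Q * R / k)"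
      by linarith
    also have "\<dots> = (Q * (2 * (T1 * L)) + T2 * (Q * R)) / k" by (simp add: add_divide_distrib)
    also have "\<dots> \<le> B / k"
      unfolding B_def using k \<open>Q \<ge> 0\<close> L T1 T2 R by (intro divide_right_mono) (auto simp: algebra_simps)
    finally show ?thesis by (rule e4)
  next
    case False
    then show ?thesis
      using e by (simp add: wd H_def tsupport_eq_0 ddir_outside_tsupport ddir2_outside_tsupport)
  qed
  have exact: "ddir a (ddir b w) z = h (k * l z) * (l a * l b)" if "z \<in> K" for a b z
  proof -
    have d: "ddir a \<theta> y = 0" if "y \<in> K" for a y by (rule ddir_locally_const[OF K(1) that K(2)])
    have "ddir a (ddir b \<theta>) z = 0" by (rule ddir_locally_const[OF K(1) that d])
    then show ?thesis unfolding wd using d[OF that] K(2)[OF that] by simp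
  qed
  have "smooth_fun w"
    unfolding w_def[abs_def] divide_inverse
    by (intro smooth_fun_mult sm smooth_fun_compose_real[OF smF] smooth_fun_const smooth_fun_linear l(1))
  moreover have "tsupport w \<subseteq> tsupport \<theta>"
    unfolding tsupport_def by (intro closure_mono) (auto simp: w_def)
  ultimately have "Cc_inf G w"
    using \<theta>(1) cK compact_Int_closed[of "tsupport \<theta>" "tsupport w"]
    unfolding Cc_inf_def by (auto simp: Int_absorb1 tsupport_def)
  moreover have "- s \<le> H z" "H z \<le> 1 - s" for z
  proof -
    have "- s * 1 \<le> - s * \<theta> z" using \<theta>(3) s by (intro mult_left_mono_neg) auto
    also have "\<dots> \<le> H z" unfolding H_def using mult_left_mono[OF h(2) \<theta>(2)] by (simp add: mult.commute)
    finally show "- s \<le> H z" by simp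
    have "H z \<le> \<theta> z * (1 - s)" unfolding H_def by (rule mult_left_mono[OF h(3) \<theta>(2)])
    also have "\<dots> \<le> 1 * (1 - s)" using \<theta>(3) s by (intro mult_right_mono) auto
    finally show "H z \<le> 1 - s" by simp
  qed
  moreover have "continuous_on UNIV (\<lambda>z. cos (k * l z))"
    by (intro continuous_intros linear_continuous_on l(1))
  then have "open E1" "open E2"
    unfolding E1_def E2_def Collect_conj_eq Collect_mem_eq
    by (intro open_Int K(1) open_Collect_less continuous_on_const; assumption)+
  moreover have "E1 \<inter> E2 = {}"
  proof -
    have "pi * (s + \<epsilon>) \<le> pi" using \<epsilon> by (simp add: mult_left_le)
    then have "cos (pi * (s + \<epsilon>)) \<le> cos (pi * (s - \<epsilon>))"
      using \<epsilon> by (intro cos_monotone_0_pi_le) auto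
    then show ?thesis unfolding E1_def E2_def by auto
  qed
  moreover have "compactly_in E1 G" "compactly_in E2 G"
    by (rule compactly_in_tsupport[OF \<theta>(1)]; use K(2) in \<open>force simp: E1_def E2_def\<close>)+
  moreover have "ddir a (ddir b w) z = (1 - s) * (l a * l b)" if "z \<in> E1" for a b z
    using that h(4) exact by (simp add: E1_def)
  moreover have "ddir a (ddir b w) z = - s * (l a * l b)" if "z \<in> E2" for a b z
    using that h(5) exact by (simp add: E2_def)
  \<comment> \<open>Three losses of at most e / 4 each: the transition layer, the cutoff, and the
    averaging error C1 / k.\<close>
  moreover have "s * measure lborel G - e \<le> measure lborel E1"
  proof -
    have "C1 / k \<le> e / 4" using B0 by (intro small) linarith
    moreover have "(s - 2 * \<epsilon>) * M - 2 * (e / 8) - C1 / k \<le> measure lborel E1"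
      using C1[OF k] by (simp add: E1_def M_def)
    ultimately have "(s - 2 * \<epsilon>) * M - e \<le> measure lborel E1 - e / 2" by linarith
    then show ?thesis using \<epsilon>M e unfolding M_def[symmetric] left_diff_distrib by linarith
  qed
  moreover have "(1 - s) * measure lborel G - e \<le> measure lborel E2"
  proof -
    have "cos (pi * (1 - s - \<epsilon>)) = - cos (pi * (s + \<epsilon>))"
      using cos_pi_minus[of "pi * (s + \<epsilon>)"] by (simp add: algebra_simps)
    then have "E2 = {z \<in> K. cos (pi + k * l z) > cos (pi * (1 - s - \<epsilon>))}"
      unfolding E2_def by (simp add: cos_add)
    then have "(1 - s - 2 * \<epsilon>) * M - 2 * (e / 8) - C2 / k \<le> measure lborel E2"
      using C2[OF k] by (simp add: M_def)
    moreover have "C2 / k \<le> e / 4" using B0 by (intro small) linarith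
    ultimately have "(1 - s - 2 * \<epsilon>) * M - e \<le> measure lborel E2 - e / 2" by linarith
    then show ?thesis using \<epsilon>M e unfolding M_def[symmetric] left_diff_distrib by linarith
  qed
  ultimately show thesis using that w_bound dw_bound ddw_bound by presburger
qed

section \<open>Simple laminates\<close>

lemma dx_eq_ddir: "dx f z j = ddir (axis j 1, 0) f z"
  by (simp add: dx_def ddir_def)

lemma dt_eq_ddir: "dt f z = ddir (0, 1) f z"
  by (simp add: dt_def ddir_def)

lemma smooth_fun_scaleR_const: "smooth_fun u \<Longrightarrow> smooth_fun (\<lambda>z. u z *\<^sub>R c)"
  by (rule smooth_fun_bounded_linear[OF bounded_linear_scaleR_left])

lemma ddir_scaleR_const: "smooth_fun u \<Longrightarrow> ddir v (\<lambda>z. u z *\<^sub>R c) z = ddir v u z *\<^sub>R c"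
  by (rule ddir_eq[OF bounded_linear.has_derivative[OF bounded_linear_scaleR_left smooth_fun_has_derivative]])

lemma ddir_add: "smooth_fun f \<Longrightarrow> smooth_fun g \<Longrightarrow> ddir v (\<lambda>z. f z + g z) z = ddir v f z + ddir v g z"
  by (rule ddir_eq[OF has_derivative_add[OF smooth_fun_has_derivative smooth_fun_has_derivative]])

lemma ddir_diff: "smooth_fun f \<Longrightarrow> smooth_fun g \<Longrightarrow> ddir v (\<lambda>z. f z - g z) z = ddir v f z - ddir v g z"
  by (rule ddir_eq[OF has_derivative_diff[OF smooth_fun_has_derivative smooth_fun_has_derivative]])

lemma ddir_sum:
  "(\<And>i. i \<in> I \<Longrightarrow> smooth_fun (f i)) \<Longrightarrow> ddir v (\<lambda>z. \<Sum>i\<in>I. f i z) z = (\<Sum>i\<in>I. ddir v (f i) z)"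
  by (rule ddir_eq[OF has_derivative_sum[OF smooth_fun_has_derivative]])

text \<open>Collects the coordinate sum of a divergence into a single directional derivative, along
  a row of B or along a.\<close>

lemma ddir_linear_comb:
  fixes u :: "(real^'n::finite) \<times> real \<Rightarrow> real"
  assumes "smooth_fun u"
  shows "(\<Sum>j\<in>UNIV. x $ j * ddir (axis j 1, 0) u z) = ddir (x, 0) u z"
proof -
  have lin: "linear (\<lambda>v. ddir v u z)" by (rule has_derivative_linear[OF smooth_fun_has_derivative[OF assms]])
  have expand: "(x, 0) = (\<Sum>j\<in>UNIV. x $ j *\<^sub>R (axis j 1, 0 :: real))"
    by (simp add: prod_eq_iff fst_sum snd_sum vec_eq_iff axis_def if_distrib[of "(*) _"] cong: if_cong)
  show ?thesis unfolding expand linear_sum[OF lin] linear_scale[OF lin] by simp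
qed

lemma Cc_inf_vanishing:
  assumes "Cc_inf G w" "smooth_fun f" "\<And>z. z \<notin> tsupport w \<Longrightarrow> f z = 0"
  shows "Cc_inf G f"
proof -
  have "tsupport f \<subseteq> tsupport w"
    unfolding tsupport_def[of f] by (rule closure_minimal) (use assms(3) in \<open>auto simp: tsupport_def\<close>)
  moreover have "compact (tsupport w)" "tsupport w \<subseteq> G" using assms(1) by (auto simp: Cc_inf_def)
  ultimately show ?thesis
    using assms(2) compact_Int_closed[of "tsupport w" "tsupport f"]
    unfolding Cc_inf_def by (auto simp: Int_absorb1 tsupport_def)
qed

lemma Cc_inf_zero: "Cc_inf G (\<lambda>_. 0)"
  by (simp add: Cc_inf_def smooth_fun_const tsupport_def)

lemma norm_outer_le: "norm (outer p q) \<le> (\<Sum>i\<in>UNIV. \<bar>p $ i\<bar>) * (\<Sum>j\<in>UNIV. \<bar>q $ j\<bar>)"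
proof -
  have "norm (outer p q) \<le> (\<Sum>i\<in>UNIV. norm (outer p q $ i))"
    unfolding norm_vec_def[of "outer p q"] by (rule L2_set_le_sum) simp
  also have "\<dots> \<le> (\<Sum>i\<in>UNIV. \<Sum>j\<in>UNIV. \<bar>outer p q $ i $ j\<bar>)"
    by (intro sum_mono norm_le_l1_cart)
  also have "\<dots> = (\<Sum>i\<in>UNIV. \<bar>p $ i\<bar>) * (\<Sum>j\<in>UNIV. \<bar>q $ j\<bar>)"
    by (simp add: outer_def abs_mult sum_product)
  finally show ?thesis .
qed

lemma norm_Pair_le_add: "norm (x, y) \<le> norm x + norm y"
  using norm_triangle_ineq[of "(x, 0)" "(0, y)"] by simp

text \<open>The outer product is unchanged when the length of a is moved into p; unit length gives
  the phase slope 1 along a.\<close>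

lemma wave_cone_unit:
  assumes "\<eta> \<in> wave_cone"
  obtains p a B where "\<eta> = (outer p a, B)" "norm a = 1" "B *v a = 0"
proof -
  obtain p a B where *: "\<eta> = (outer p a, B)" "a \<noteq> 0" "B *v a = 0"
    using assms by (auto simp: wave_cone_def)
  show thesis
  proof (rule that)
    show "\<eta> = (outer (norm a *\<^sub>R p) (a /\<^sub>R norm a), B)"
      using * by (simp add: outer_def vec_eq_iff)
    show "norm (a /\<^sub>R norm a) = 1" using *(2) by simp
    show "B *v (a /\<^sub>R norm a) = 0" using *(3) by (simp add: matrix_vector_mult_scaleR)
  qed
qed

definition wave_phi where "wave_phi p a w z = ddir (a, 0) w z *\<^sub>R p"

text \<open>Written as scalar derivatives times constant matrices, the sum supplying the rows one by
  one, so that smoothness and differentiation reduce to the scalar w.\<close>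

definition wave_psi where
  "wave_psi b a B w z = ddir (a, 0) w z *\<^sub>R (B /\<^sub>R b)
     - (\<Sum>i\<in>UNIV. ddir (B $ i, 0) w z *\<^sub>R (outer (axis i 1) a /\<^sub>R b))"

definition wave_g where "wave_g p a w z = w z *\<^sub>R outer p a"

context
  fixes p :: "real^'m::finite" and a :: "real^'n::finite" and B :: "real^'n^'m" and b :: real
    and w :: "(real^'n) \<times> real \<Rightarrow> real"
  assumes w: "smooth_fun w"
begin

lemma smooth_wave: "smooth_fun (wave_phi p a w)" "smooth_fun (wave_psi b a B w)" "smooth_fun (wave_g p a w)"
  unfolding wave_phi_def[abs_def] wave_psi_def[abs_def] wave_g_def[abs_def]
  by (intro smooth_fun_diff smooth_fun_sum smooth_fun_scaleR_const smooth_fun_ddir w)+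

lemma ddir_wave:
  "ddir v (wave_phi p a w) z = ddir v (ddir (a, 0) w) z *\<^sub>R p"
  "ddir v (wave_psi b a B w) z = ddir v (ddir (a, 0) w) z *\<^sub>R (B /\<^sub>R b)
     - (\<Sum>i\<in>UNIV. ddir v (ddir (B $ i, 0) w) z *\<^sub>R (outer (axis i 1) a /\<^sub>R b))"
  "ddir v (wave_g p a w) z = ddir v w z *\<^sub>R outer p a"
  unfolding wave_phi_def[abs_def] wave_psi_def[abs_def] wave_g_def[abs_def]
  by (simp_all only: ddir_scaleR_const ddir_diff ddir_sum smooth_fun_scaleR_const smooth_fun_sum smooth_fun_ddir w)

lemma divx_wave_g: "divx (wave_g p a w) z = wave_phi p a w z"
proof -
  have "divx (wave_g p a w) z $ i = p $ i * (\<Sum>j\<in>UNIV. a $ j * ddir (axis j 1, 0) w z)" for i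
    by (simp add: divx_def dx_eq_ddir ddir_wave outer_def sum_distrib_left mult_ac)
  then show ?thesis by (simp add: vec_eq_iff ddir_linear_comb[OF w] wave_phi_def)
qed

text \<open>Component i is the commutator of the derivatives along \<open>(B $ i, 0)\<close> and
  \<open>(a, 0)\<close> applied to w, divided by b; it vanishes by symmetry of second
  derivatives.\<close>

lemma divx_wave_psi: "divx (wave_psi b a B w) z = 0"
proof -
  have row: "(\<Sum>k\<in>UNIV. ddir v (ddir (B $ k, 0) w) z *\<^sub>R (outer (axis k 1) a /\<^sub>R b)) $ i $ j
      = ddir v (ddir (B $ i, 0) w) z * (a $ j / b)" for i v j
  proof -
    have "(\<Sum>k\<in>UNIV. ddir v (ddir (B $ k, 0) w) z *\<^sub>R (outer (axis k 1) a /\<^sub>R b)) $ i $ j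
      = (\<Sum>k\<in>UNIV. if k = i then ddir v (ddir (B $ k, 0) w) z * (a $ j / b) else 0)"
      unfolding sum_component by (rule sum.cong) (auto simp: outer_def axis_def divide_inverse)
    then show ?thesis by simp
  qed
  have "dx (wave_psi b a B w) z j $ i $ j = (B $ i $ j * ddir (axis j 1, 0) (ddir (a, 0) w) z
      - a $ j * ddir (axis j 1, 0) (ddir (B $ i, 0) w) z) / b" for i j
    unfolding dx_eq_ddir ddir_wave(2) vector_minus_component row
    by (simp add: divide_inverse algebra_simps)
  then have "divx (wave_psi b a B w) z $ i = (\<Sum>j\<in>UNIV. (B $ i $ j * ddir (axis j 1, 0) (ddir (a, 0) w) z
      - a $ j * ddir (axis j 1, 0) (ddir (B $ i, 0) w) z) / b)" for i
    by (simp add: divx_def)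
  also have "\<dots> i = (ddir (B $ i, 0) (ddir (a, 0) w) z - ddir (a, 0) (ddir (B $ i, 0) w) z) / b" for i
    by (simp only: sum_divide_distrib[symmetric] sum_subtractf ddir_linear_comb[OF smooth_fun_ddir[OF w]])
  finally show ?thesis using ddir_commute[OF w] by (simp add: vec_eq_iff)
qed

text \<open>The right-hand side contains only Hessian entries minus their ideal values, which are c
  times products of values of the phase (0 for the rows of B). One identity thus gives both the
  estimate everywhere and the exact values on plateaux.\<close>

lemma wave_gradient:
  assumes "b \<noteq> 0"
  shows "(Dx (wave_phi p a w) z, dt (wave_psi b a B w) z) - c *\<^sub>R (outer p a, B)
    = (outer p (\<chi> j. ddir (axis j 1, 0) (ddir (a, 0) w) z - c * a $ j),
       (ddir (0, 1) (ddir (a, 0) w) z - c * b) *\<^sub>R (B /\<^sub>R b)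
         - (\<Sum>i\<in>UNIV. ddir (0, 1) (ddir (B $ i, 0) w) z *\<^sub>R (outer (axis i 1) a /\<^sub>R b)))"
proof -
  have "Dx (wave_phi p a w) z - c *\<^sub>R outer p a
      = outer p (\<chi> j. ddir (axis j 1, 0) (ddir (a, 0) w) z - c * a $ j)"
    by (simp add: Dx_def dx_eq_ddir ddir_wave outer_def vec_eq_iff algebra_simps)
  moreover have cB: "c *\<^sub>R B = (c * b) *\<^sub>R (B /\<^sub>R b)" using assms by simp
  have "dt (wave_psi b a B w) z - c *\<^sub>R B = (ddir (0, 1) (ddir (a, 0) w) z - c * b) *\<^sub>R (B /\<^sub>R b)
         - (\<Sum>i\<in>UNIV. ddir (0, 1) (ddir (B $ i, 0) w) z *\<^sub>R (outer (axis i 1) a /\<^sub>R b))"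
    unfolding dt_eq_ddir ddir_wave(2) cB scaleR_left_diff_distrib by (simp add: algebra_simps)
  ultimately show ?thesis by simp
qed

end

text \<open>The phase \<open>a \<bullet> x + b t\<close> has a small time component \<open>b\<close>: then \<open>\<partial>\<^sub>t \<phi>\<close> is small, while \<open>\<psi>\<close> carries the
  compensating factor \<open>1 / b\<close>.\<close>
lemma laminate_strict:
  fixes \<eta> :: "('n::finite, 'm::finite) mpair" and G :: "((real^'n) \<times> real) set"
  assumes \<eta>: "\<eta> \<in> wave_cone" and G: "open G" "bounded G" and s: "0 < s" "s < 1" and e: "0 < e"
  obtains \<phi> :: "(real^'n) \<times> real \<Rightarrow> real^'m" and \<psi> g :: "(real^'n) \<times> real \<Rightarrow> real^'n^'m" and E1 E2
  where "Cc_inf G \<phi>" "Cc_inf G \<psi>" "Cc_inf G g" "\<And>z. divx \<psi> z = 0" "\<And>z. divx g z = \<phi> z"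
    "\<And>z. norm (\<phi> z) \<le> e" "\<And>z. norm (dt \<phi> z) \<le> e" "\<And>z. norm (dt g z) \<le> e"
    "\<And>z. \<exists>c\<in>{-s..1-s}. norm ((Dx \<phi> z, dt \<psi> z) - c *\<^sub>R \<eta>) \<le> e"
    "open E1" "open E2" "E1 \<inter> E2 = {}" "compactly_in E1 G" "compactly_in E2 G"
    "\<And>z. z \<in> E1 \<Longrightarrow> (Dx \<phi> z, dt \<psi> z) = (1 - s) *\<^sub>R \<eta>"
    "\<And>z. z \<in> E2 \<Longrightarrow> (Dx \<phi> z, dt \<psi> z) = (- s) *\<^sub>R \<eta>"
    "s * measure lborel G - e \<le> measure lborel E1" "(1 - s) * measure lborel G - e \<le> measure lborel E2"
proof -
  obtain p a B where pB: "\<eta> = (outer p a, B)" "norm a = 1" "B *v a = 0"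
    using wave_cone_unit[OF \<eta>] .
  \<comment> \<open>The leading part of the time derivative of \<phi> is at most
    \<open>norm p * b\<close>, which this choice keeps below e / 2.\<close>
  define b where "b = e / (2 * (norm p + 1))"
  have b: "0 < b" unfolding b_def using e by (simp add: add_nonneg_pos)
  have pb: "norm p * b \<le> e / 2"
  proof -
    have "norm p * b \<le> (norm p + 1) * b" using b by (simp add: algebra_simps)
    also have "(norm p + 1) * b = e / 2"
    proof -
      have "x * (e / (2 * x)) = e / 2" if "x \<noteq> 0" for x using that by simp
      moreover have "norm p + 1 \<noteq> 0" using norm_ge_zero[of p] by linarith
      ultimately show ?thesis unfolding b_def by blast
    qed
    finally show ?thesis .
  qed
  define l :: "(real^'n) \<times> real \<Rightarrow> real" where "l = (\<lambda>(x, t). a \<bullet> x + b * t)"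
  have l: "bounded_linear l"
    unfolding l_def case_prod_beta
    by (intro bounded_linear_add bounded_linear_compose[OF bounded_linear_inner_right]
        bounded_linear_const_mult bounded_linear_fst bounded_linear_snd)
  have la: "l (a, 0) = 1" using pB(2) by (simp add: l_def dot_square_norm)
  have lt: "l (0, 1) = b" by (simp add: l_def)
  have lj: "l (axis j 1, 0) = a $ j" for j by (simp add: l_def inner_axis)
  \<comment> \<open>Here \<open>B *v a = 0\<close> enters: the phase is constant along the rows of
    B, so the correcting second term of \<open>wave_psi\<close> has no leading part.\<close>
  have lB: "l (B $ i, 0) = 0" for i
    using matrix_vector_mul_component[of B a i] pB(3) by (simp add: l_def inner_commute)
  define V :: "((real^'n) \<times> real) set"
    where "V = insert (a, 0) (insert (0, 1) (range (\<lambda>j. (axis j 1, 0)) \<union> range (\<lambda>i. (B $ i, 0))))"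
  have V: "finite V" "(a, 0) \<in> V" "(0, 1) \<in> V" "(axis j 1, 0) \<in> V" "(B $ i, 0) \<in> V" for i j
    by (auto simp: V_def)
  \<comment> \<open>The constant c2 contains 1 / b, hence the accuracy d of the potential is fixed
    only after b.\<close>
  define c1 c2 where "c1 = (\<Sum>i\<in>UNIV. \<bar>p $ i\<bar>) * real CARD('n)"
    and "c2 = norm (B /\<^sub>R b) + (\<Sum>i\<in>UNIV. norm (outer (axis i 1 :: real^'m) a /\<^sub>R b))"
  define C where "C = norm p + norm (outer p a) + c1 + c2 + 1"
  have c0: "0 \<le> c1" "0 \<le> c2" by (auto simp: c1_def c2_def intro!: add_nonneg_nonneg sum_nonneg mult_nonneg_nonneg)
  have C: "C \<ge> 1" unfolding C_def using c0 by simp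
  define d where "d = e / (2 * C)"
  have d: "0 < d" unfolding d_def using e C by simp
  have dC: "x * d \<le> e / 2" if "x \<le> C" for x
  proof -
    have "x * d \<le> C * d" using that d by (intro mult_right_mono) auto
    also have "\<dots> = e / 2" unfolding d_def using C by simp
    finally show ?thesis .
  qed
  obtain w H :: "(real^'n) \<times> real \<Rightarrow> real" and E1 E2 where w: "Cc_inf G w"
    and H: "\<And>z. - s \<le> H z" "\<And>z. H z \<le> 1 - s"
    and w0: "\<And>z. \<bar>w z\<bar> \<le> d" and w1: "\<And>a z. a \<in> V \<Longrightarrow> \<bar>ddir a w z\<bar> \<le> d"
    and w2: "\<And>a b z. a \<in> V \<Longrightarrow> b \<in> V \<Longrightarrow> \<bar>ddir a (ddir b w) z - H z * (l a * l b)\<bar> \<le> d"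
    and E: "open E1" "open E2" "E1 \<inter> E2 = {}" "compactly_in E1 G" "compactly_in E2 G"
    and E1: "\<And>a b z. z \<in> E1 \<Longrightarrow> ddir a (ddir b w) z = (1 - s) * (l a * l b)"
    and E2: "\<And>a b z. z \<in> E2 \<Longrightarrow> ddir a (ddir b w) z = - s * (l a * l b)"
    and mE: "s * measure lborel G - d \<le> measure lborel E1" "(1 - s) * measure lborel G - d \<le> measure lborel E2"
    by (rule oscillating_potential[OF G l la s V(1) d], rule that)
  have sw: "smooth_fun w" using w by (simp add: Cc_inf_def)
  note grad = wave_gradient[OF sw, where b = b and p = p and a = a and B = B, folded pB(1)]
  have de: "d \<le> e" using dC[of 1] C e by simp
  show thesis
  proof (rule that[of "wave_phi p a w" "wave_psi b a B w" "wave_g p a w" E1 E2])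
    show "Cc_inf G (wave_phi p a w)" "Cc_inf G (wave_psi b a B w)" "Cc_inf G (wave_g p a w)"
      by (rule Cc_inf_vanishing[OF w], rule smooth_wave[OF sw],
          simp add: wave_phi_def wave_psi_def wave_g_def ddir_outside_tsupport tsupport_eq_0)+
    show "divx (wave_psi b a B w) z = 0" "divx (wave_g p a w) z = wave_phi p a w z" for z
      by (rule divx_wave_psi[OF sw], rule divx_wave_g[OF sw])
    show "norm (wave_phi p a w z) \<le> e" for z
      using mult_left_mono[OF w1[OF V(2), of z] norm_ge_zero[of p]] dC[of "norm p"] c0 e
      by (simp add: wave_phi_def C_def mult.commute)
    show "norm (dt (wave_g p a w) z) \<le> e" for z
      using mult_left_mono[OF w1[OF V(3), of z] norm_ge_zero[of "outer p a"]] dC[of "norm (outer p a)"] c0 e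
      by (simp add: dt_eq_ddir ddir_wave[OF sw] C_def mult.commute)
    show "norm (dt (wave_phi p a w) z) \<le> e" for z
    proof -
      have "\<bar>H z\<bar> \<le> 1" using H[of z] s by linarith
      then have "\<bar>H z * b\<bar> \<le> b" using b by (simp add: abs_mult mult_left_le_one_le)
      then have "\<bar>ddir (0, 1) (ddir (a, 0) w) z\<bar> \<le> b + d"
        using w2[OF V(3,2), of z] by (simp add: la lt)
      then have "norm p * \<bar>ddir (0, 1) (ddir (a, 0) w) z\<bar> \<le> norm p * (b + d)" by (intro mult_left_mono) auto
      also have "\<dots> \<le> e" using pb dC[of "norm p"] c0 by (simp add: C_def distrib_left)
      finally show ?thesis by (simp add: dt_eq_ddir ddir_wave[OF sw] mult.commute)
    qed
    show "\<exists>c\<in>{-s..1-s}. norm ((Dx (wave_phi p a w) z, dt (wave_psi b a B w) z) - c *\<^sub>R \<eta>) \<le> e" for z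
    proof
      show "H z \<in> {-s..1-s}" using H by simp
      have "norm (outer p (\<chi> j. ddir (axis j 1, 0) (ddir (a, 0) w) z - H z * a $ j)) \<le> c1 * d"
      proof (rule order_trans[OF norm_outer_le])
        have "(\<Sum>j\<in>UNIV. \<bar>(\<chi> j. ddir (axis j 1, 0) (ddir (a, 0) w) z - H z * a $ j) $ j\<bar>) \<le> (\<Sum>j\<in>(UNIV :: 'n set). d)"
          using w2[OF V(4,2), where z = z] by (intro sum_mono) (simp add: la lj)
        also have "\<dots> = real CARD('n) * d" by simp
        finally show "(\<Sum>i\<in>UNIV. \<bar>p $ i\<bar>) * (\<Sum>j\<in>UNIV. \<bar>(\<chi> j. ddir (axis j 1, 0) (ddir (a, 0) w) z - H z * a $ j) $ j\<bar>) \<le> c1 * d"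
          unfolding c1_def mult.assoc by (intro mult_left_mono sum_nonneg) auto
      qed
      moreover have "norm ((ddir (0, 1) (ddir (a, 0) w) z - H z * b) *\<^sub>R (B /\<^sub>R b)
         - (\<Sum>i\<in>UNIV. ddir (0, 1) (ddir (B $ i, 0) w) z *\<^sub>R (outer (axis i 1 :: real^'m) a /\<^sub>R b))) \<le> c2 * d"
      proof (rule order_trans[OF norm_triangle_ineq4])
        have "norm ((ddir (0, 1) (ddir (a, 0) w) z - H z * b) *\<^sub>R (B /\<^sub>R b)) \<le> d * norm (B /\<^sub>R b)"
          unfolding norm_scaleR[of "ddir (0, 1) (ddir (a, 0) w) z - H z * b"]
          using w2[OF V(3,2), of z] by (intro mult_right_mono) (simp_all add: la lt)
        moreover have "norm (\<Sum>i\<in>UNIV. ddir (0, 1) (ddir (B $ i, 0) w) z *\<^sub>R (outer (axis i 1 :: real^'m) a /\<^sub>R b))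
            \<le> (\<Sum>i\<in>UNIV. d * norm (outer (axis i 1 :: real^'m) a /\<^sub>R b))"
        proof (rule sum_norm_le)
          fix i :: 'm
          show "norm (ddir (0, 1) (ddir (B $ i, 0) w) z *\<^sub>R (outer (axis i 1 :: real^'m) a /\<^sub>R b))
              \<le> d * norm (outer (axis i 1 :: real^'m) a /\<^sub>R b)"
            unfolding norm_scaleR[of "ddir (0, 1) (ddir (B $ i, 0) w) z"]
            using w2[OF V(3) V(5)[of i], of z] by (intro mult_right_mono) (simp_all add: lB)
        qed
        ultimately show "norm ((ddir (0, 1) (ddir (a, 0) w) z - H z * b) *\<^sub>R (B /\<^sub>R b))
           + norm (\<Sum>i\<in>UNIV. ddir (0, 1) (ddir (B $ i, 0) w) z *\<^sub>R (outer (axis i 1 :: real^'m) a /\<^sub>R b)) \<le> c2 * d"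
          unfolding c2_def distrib_right sum_distrib_left[symmetric] by (simp add: mult.commute)
      qed
      moreover have "c1 * d + c2 * d \<le> e"
        using dC[of "c1 + c2"] c0 e by (simp add: C_def distrib_right)
      ultimately show "norm ((Dx (wave_phi p a w) z, dt (wave_psi b a B w) z) - H z *\<^sub>R \<eta>) \<le> e"
        using b by (subst grad) (auto intro: order_trans[OF norm_Pair_le_add])
    qed
    have exact: "(Dx (wave_phi p a w) z, dt (wave_psi b a B w) z) = c *\<^sub>R \<eta>"
      if "\<And>u v. ddir u (ddir v w) z = c * (l u * l v)" for c z
    proof -
      have "(Dx (wave_phi p a w) z, dt (wave_psi b a B w) z) - c *\<^sub>R \<eta> = 0"
        using b by (subst grad) (auto simp: that la lt lj lB outer_def vec_eq_iff zero_prod_def)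
      then show ?thesis by simp
    qed
    show "(Dx (wave_phi p a w) z, dt (wave_psi b a B w) z) = (1 - s) *\<^sub>R \<eta>" if "z \<in> E1" for z
      by (rule exact) (rule E1[OF that])
    show "(Dx (wave_phi p a w) z, dt (wave_psi b a B w) z) = (- s) *\<^sub>R \<eta>" if "z \<in> E2" for z
      by (rule exact) (rule E2[OF that])
  qed (use E mE de in auto)
qed

section \<open>Perturbations attaining prescribed values\<close>

lemma Cc_inf_mono: "Cc_inf A f \<Longrightarrow> A \<subseteq> G \<Longrightarrow> Cc_inf G f"
  unfolding Cc_inf_def by blast

lemma Cc_inf_add:
  assumes "Cc_inf G f" "Cc_inf G g"
  shows "Cc_inf G (\<lambda>z. f z + g z)"
proof -
  have sub: "tsupport (\<lambda>z. f z + g z) \<subseteq> tsupport f \<union> tsupport g"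
    unfolding tsupport_def[of "\<lambda>z. f z + g z"]
  proof (rule closure_minimal)
    show "{z. f z + g z \<noteq> 0} \<subseteq> tsupport f \<union> tsupport g"
    proof
      fix z assume "z \<in> {z. f z + g z \<noteq> 0}"
      then have "f z \<noteq> 0 \<or> g z \<noteq> 0" by auto
      then show "z \<in> tsupport f \<union> tsupport g" using tsupport_eq_0[of z f] tsupport_eq_0[of z g] by blast
    qed
    show "closed (tsupport f \<union> tsupport g)" by (simp add: tsupport_def closed_Un)
  qed
  have "compact (tsupport f \<union> tsupport g)" using assms by (auto simp: Cc_inf_def)
  then have "compact (tsupport (\<lambda>z. f z + g z))"
    using compact_Int_closed[of "tsupport f \<union> tsupport g" "tsupport (\<lambda>z. f z + g z)"] sub
    by (simp add: Int_absorb1 tsupport_def[of "\<lambda>z. f z + g z"])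
  then show ?thesis using sub assms unfolding Cc_inf_def by (auto intro: smooth_fun_add)
qed

definition grad_pair where "grad_pair \<phi> \<psi> z = (Dx \<phi> z, dt \<psi> z)"

lemma grad_pair_add:
  assumes "smooth_fun \<phi>" "smooth_fun \<phi>'" "smooth_fun \<psi>" "smooth_fun \<psi>'"
  shows "grad_pair (\<lambda>z. \<phi> z + \<phi>' z) (\<lambda>z. \<psi> z + \<psi>' z) z = grad_pair \<phi> \<psi> z + grad_pair \<phi>' \<psi>' z"
  using assms by (simp add: grad_pair_def Dx_def dx_eq_ddir dt_eq_ddir ddir_add vec_eq_iff)

lemma grad_pair_outside:
  assumes "Cc_inf A \<phi>" "Cc_inf A \<psi>" "z \<notin> A"
  shows "grad_pair \<phi> \<psi> z = 0"
proof -
  have "z \<notin> tsupport \<phi>" "z \<notin> tsupport \<psi>" using assms unfolding Cc_inf_def by blast+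
  then show ?thesis
    by (simp add: grad_pair_def Dx_def dx_eq_ddir dt_eq_ddir ddir_outside_tsupport vec_eq_iff zero_prod_def)
qed

text \<open>The pointwise conditions are imposed on the whole space and not just on G, so that
  perturbations supported in different subsets can simply be added.\<close>

definition solves where
  "solves W Y G e \<phi> \<psi> g \<longleftrightarrow> Cc_inf G \<phi> \<and> Cc_inf G \<psi> \<and> Cc_inf G g \<and>
     (\<forall>z. divx \<psi> z = 0 \<and> divx g z = \<phi> z \<and> norm (\<phi> z) \<le> e \<and> norm (dt \<phi> z) \<le> e \<and> norm (dt g z) \<le> e \<and>
       Y + grad_pair \<phi> \<psi> z \<in> W)"

lemma solvesD:
  assumes "solves W Y G e \<phi> \<psi> g"
  shows "Cc_inf G \<phi>" "Cc_inf G \<psi>" "Cc_inf G g" "divx \<psi> z = 0" "divx g z = \<phi> z" "norm (\<phi> z) \<le> e"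
    "norm (dt \<phi> z) \<le> e" "norm (dt g z) \<le> e" "Y + grad_pair \<phi> \<psi> z \<in> W"
  using assms unfolding solves_def by blast+

text \<open>Quantifying over all domains makes the notion reusable inside the sets where an outer
  laminate has a constant value. Measuring the loss additively lets losses of nested steps add up
  and gives a meaning to weights that are zero or negative.\<close>

definition attains ::
    "('n::finite, 'm::finite) mpair set \<Rightarrow> ('j \<Rightarrow> ('n, 'm) mpair) \<Rightarrow> 'j set \<Rightarrow> ('n, 'm) mpair \<Rightarrow> ('j \<Rightarrow> real) \<Rightarrow> bool" where
  "attains W X J Y c \<longleftrightarrow> (\<forall>G e. open G \<longrightarrow> bounded G \<longrightarrow> 0 < e \<longrightarrow> (\<exists>\<phi> \<psi> g U. solves W Y G e \<phi> \<psi> g \<and>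
     (\<forall>j\<in>J. open (U j) \<and> compactly_in (U j) G \<and> (\<forall>z\<in>U j. Y + grad_pair \<phi> \<psi> z = X j) \<and>
       c j * measure lborel G - e \<le> measure lborel (U j)) \<and> disjoint_family_on U J))"

lemma attainsI:
  assumes "\<And>G e. open G \<Longrightarrow> bounded G \<Longrightarrow> 0 < e \<Longrightarrow> \<exists>\<phi> \<psi> g U. solves W Y G e \<phi> \<psi> g \<and>
     (\<forall>j\<in>J. open (U j) \<and> compactly_in (U j) G \<and> (\<forall>z\<in>U j. Y + grad_pair \<phi> \<psi> z = X j) \<and>
       c j * measure lborel G - e \<le> measure lborel (U j)) \<and> disjoint_family_on U J"
  shows "attains W X J Y c"
  using assms unfolding attains_def by blast

lemma attainsE:
  assumes "attains W X J Y c" "open G" "bounded G" "0 < e"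
  obtains \<phi> \<psi> g U where "solves W Y G e \<phi> \<psi> g" "\<And>j. j \<in> J \<Longrightarrow> open (U j)"
    "\<And>j. j \<in> J \<Longrightarrow> compactly_in (U j) G" "\<And>j z. j \<in> J \<Longrightarrow> z \<in> U j \<Longrightarrow> Y + grad_pair \<phi> \<psi> z = X j"
    "\<And>j. j \<in> J \<Longrightarrow> c j * measure lborel G - e \<le> measure lborel (U j)" "disjoint_family_on U J"
  using assms unfolding attains_def by metis

lemma grad_pair_zero: "grad_pair (\<lambda>_. 0) (\<lambda>_. 0) z = 0"
  by (simp add: grad_pair_def Dx_def dx_eq_ddir dt_eq_ddir ddir_const vec_eq_iff zero_prod_def)

lemma solves_zero:
  assumes "Y \<in> W" "0 < e"
  shows "solves W Y G e (\<lambda>_. 0) (\<lambda>_. 0) (\<lambda>_. 0)"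
  using assms
  by (simp add: solves_def Cc_inf_zero grad_pair_zero divx_def dx_eq_ddir dt_eq_ddir ddir_const vec_eq_iff)

lemma solves_mono: "solves W Y G e \<phi> \<psi> g \<Longrightarrow> e \<le> e' \<Longrightarrow> solves W Y G e' \<phi> \<psi> g"
  unfolding solves_def by (auto intro: order_trans)

lemma attains_zero: "Y \<in> W \<Longrightarrow> attains W X J Y (\<lambda>_. 0)"
  by (intro attainsI exI[of _ "\<lambda>_. 0"] exI[of _ "\<lambda>_. {}"])
     (simp add: solves_zero compactly_in_def disjoint_family_on_def)

lemma attains_target:
  assumes "X i \<in> W"
  shows "attains W X J (X i) (\<lambda>j. if j = i then 1 else 0)"
proof (rule attainsI)
  fix G :: "((real^'a) \<times> real) set" and e :: real
  assume G: "open G" "bounded G" and e: "0 < e"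
  obtain \<theta> :: "(real^'a) \<times> real \<Rightarrow> real" and K where K: "Cc_inf G \<theta>" "open K" "\<And>z. z \<in> K \<Longrightarrow> \<theta> z = 1"
    "measure lborel G - e \<le> measure lborel K"
    by (rule smooth_cutoff[OF G e], rule that)
  have "compactly_in K G" by (rule compactly_in_tsupport[OF K(1)]) (use K(3) in force)
  then show "\<exists>\<phi> \<psi> g U. solves W (X i) G e \<phi> \<psi> g \<and>
     (\<forall>j\<in>J. open (U j) \<and> compactly_in (U j) G \<and> (\<forall>z\<in>U j. X i + grad_pair \<phi> \<psi> z = X j) \<and>
       (if j = i then 1 else 0) * measure lborel G - e \<le> measure lborel (U j)) \<and> disjoint_family_on U J"
    using K(2,4) e assms
    by (intro exI[of _ "\<lambda>_. 0"] exI[of _ "\<lambda>j. if j = i then K else {}"])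
       (auto simp: solves_zero compactly_in_def disjoint_family_on_def grad_pair_zero)
qed

lemma attains_weaken:
  assumes "attains W X J Y c" "\<And>j. j \<in> J \<Longrightarrow> d j \<le> c j"
  shows "attains W X J Y d"
proof (rule attainsI)
  fix G :: "((real^'a) \<times> real) set" and e :: real
  assume G: "open G" "bounded G" "0 < e"
  obtain \<phi> \<psi> g U where *: "solves W Y G e \<phi> \<psi> g" "\<And>j. j \<in> J \<Longrightarrow> open (U j)"
    "\<And>j. j \<in> J \<Longrightarrow> compactly_in (U j) G" "\<And>j z. j \<in> J \<Longrightarrow> z \<in> U j \<Longrightarrow> Y + grad_pair \<phi> \<psi> z = X j"
    "\<And>j. j \<in> J \<Longrightarrow> c j * measure lborel G - e \<le> measure lborel (U j)" "disjoint_family_on U J"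
    by (rule attainsE[OF assms(1) G], rule that)
  have "d j * measure lborel G - e \<le> measure lborel (U j)" if "j \<in> J" for j
    using *(5)[OF that] mult_right_mono[OF assms(2)[OF that], of "measure lborel G"] by simp
  then show "\<exists>\<phi> \<psi> g U. solves W Y G e \<phi> \<psi> g \<and>
     (\<forall>j\<in>J. open (U j) \<and> compactly_in (U j) G \<and> (\<forall>z\<in>U j. Y + grad_pair \<phi> \<psi> z = X j) \<and>
       d j * measure lborel G - e \<le> measure lborel (U j)) \<and> disjoint_family_on U J"
    using * by (intro exI[of _ \<phi>] exI[of _ \<psi>] exI[of _ g] exI[of _ U]) auto
qed

text \<open>As G has finite measure, a deficit \<delta> in the weights costs at most \<delta> times
  this measure, which fits into the tolerance.\<close>

lemma attains_limit:
  assumes "\<And>\<delta>. 0 < \<delta> \<Longrightarrow> attains W X J Y (\<lambda>j. c j - \<delta>)"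
  shows "attains W X J Y c"
proof (rule attainsI)
  fix G :: "((real^'a) \<times> real) set" and e :: real
  assume G: "open G" "bounded G" and e: "0 < e"
  define M where "M = measure lborel G + 1"
  have M: "M > 0" by (simp add: M_def add_nonneg_pos)
  obtain \<phi> \<psi> g U where *: "solves W Y G (e / 2) \<phi> \<psi> g" "\<And>j. j \<in> J \<Longrightarrow> open (U j)"
    "\<And>j. j \<in> J \<Longrightarrow> compactly_in (U j) G" "\<And>j z. j \<in> J \<Longrightarrow> z \<in> U j \<Longrightarrow> Y + grad_pair \<phi> \<psi> z = X j"
    "\<And>j. j \<in> J \<Longrightarrow> (c j - e / (2 * M)) * measure lborel G - e / 2 \<le> measure lborel (U j)"
    "disjoint_family_on U J"
    by (rule attainsE[OF assms[of "e / (2 * M)"] G, of "e / 2"]) (use e M in simp, use e in simp, rule that)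
  have "e / (2 * M) * measure lborel G \<le> e / (2 * M) * M"
    using e M by (intro mult_left_mono) (auto simp: M_def)
  also have "\<dots> = e / 2" using M by simp
  finally have "c j * measure lborel G - e \<le> measure lborel (U j)" if "j \<in> J" for j
    using *(5)[OF that] unfolding left_diff_distrib by linarith
  moreover have "solves W Y G e \<phi> \<psi> g"
    using solves_mono[OF *(1)] e by simp
  ultimately show "\<exists>\<phi> \<psi> g U. solves W Y G e \<phi> \<psi> g \<and>
     (\<forall>j\<in>J. open (U j) \<and> compactly_in (U j) G \<and> (\<forall>z\<in>U j. Y + grad_pair \<phi> \<psi> z = X j) \<and>
       c j * measure lborel G - e \<le> measure lborel (U j)) \<and> disjoint_family_on U J"
    using * by (intro exI[of _ \<phi>] exI[of _ \<psi>] exI[of _ g] exI[of _ U]) auto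
qed

lemma compactly_in_mono: "compactly_in A B \<Longrightarrow> B \<subseteq> G \<Longrightarrow> compactly_in A G"
  unfolding compactly_in_def by blast

lemma compactly_in_Un: "compactly_in A G \<Longrightarrow> compactly_in B G \<Longrightarrow> compactly_in (A \<union> B) G"
  unfolding compactly_in_def by auto

lemma compactly_in_subset: "compactly_in A G \<Longrightarrow> A \<subseteq> G"
  unfolding compactly_in_def using closure_subset by blast

lemma measure_lborel_Un_disjoint:
  fixes A B :: "'a::euclidean_space set"
  assumes "open A" "open B" "bounded A" "bounded B" "A \<inter> B = {}"
  shows "measure lborel (A \<union> B) = measure lborel A + measure lborel B"
  using assms emeasure_bounded_finite[OF assms(3)] emeasure_bounded_finite[OF assms(4)]
  by (intro measure_Un_AE) (auto simp: fmeasurable_def)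

lemma divx_add:
  "smooth_fun f \<Longrightarrow> smooth_fun g \<Longrightarrow> divx (\<lambda>z. f z + g z) z = divx f z + divx g z"
  by (simp add: divx_def dx_eq_ddir ddir_add sum.distrib vec_eq_iff)

text \<open>An outer laminate oscillates between \<alpha> and \<beta>; perturbations for \<alpha>
  and for \<beta> are then inserted in E1 and E2, where its values are exactly \<alpha> and \<beta>.
  Elsewhere the outer laminate stays near the segment, hence in the open set W.\<close>

lemma attains_laminate_strict:
  assumes W: "open W" "closed_segment \<alpha> \<beta> \<subseteq> W" and cone: "\<alpha> - \<beta> \<in> wave_cone" and s: "0 < s" "s < 1"
    and c: "attains W X J \<alpha> c" "\<And>j. j \<in> J \<Longrightarrow> 0 \<le> c j \<and> c j \<le> 1"
    and d: "attains W X J \<beta> d" "\<And>j. j \<in> J \<Longrightarrow> 0 \<le> d j \<and> d j \<le> 1"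
  shows "attains W X J (s *\<^sub>R \<alpha> + (1 - s) *\<^sub>R \<beta>) (\<lambda>j. s * c j + (1 - s) * d j)"
proof (rule attainsI)
  fix G :: "((real^'a) \<times> real) set" and e :: real
  assume G: "open G" "bounded G" and e: "0 < e"
  define Y where "Y = s *\<^sub>R \<alpha> + (1 - s) *\<^sub>R \<beta>"
  \<comment> \<open>Compactness of the segment gives a uniform distance to the complement of
    W.\<close>
  obtain r where r: "r > 0" "(\<Union>x\<in>closed_segment \<alpha> \<beta>. ball x r) \<subseteq> W"
    using compact_subset_open_imp_ball_epsilon_subset[OF compact_segment W] by metis
  define e0 where "e0 = min (e / 4) (r / 2)"
  have e0: "0 < e0" "e0 \<le> e / 4" "e0 < r" using e r(1) by (auto simp: e0_def)
  obtain \<phi> \<psi> g E1 E2 where sol: "Cc_inf G \<phi>" "Cc_inf G \<psi>" "Cc_inf G g" "\<And>z. divx \<psi> z = 0" "\<And>z. divx g z = \<phi> z"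
    "\<And>z. norm (\<phi> z) \<le> e0" "\<And>z. norm (dt \<phi> z) \<le> e0" "\<And>z. norm (dt g z) \<le> e0"
    and near: "\<And>z. \<exists>c\<in>{-s..1-s}. norm ((Dx \<phi> z, dt \<psi> z) - c *\<^sub>R (\<alpha> - \<beta>)) \<le> e0"
    and E: "open E1" "open E2" "E1 \<inter> E2 = {}" "compactly_in E1 G" "compactly_in E2 G"
    and E1: "\<And>z. z \<in> E1 \<Longrightarrow> (Dx \<phi> z, dt \<psi> z) = (1 - s) *\<^sub>R (\<alpha> - \<beta>)"
    and E2: "\<And>z. z \<in> E2 \<Longrightarrow> (Dx \<phi> z, dt \<psi> z) = (- s) *\<^sub>R (\<alpha> - \<beta>)"
    and mE: "s * measure lborel G - e0 \<le> measure lborel E1" "(1 - s) * measure lborel G - e0 \<le> measure lborel E2"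
    by (rule laminate_strict[OF cone G s e0(1)], rule that)
  have EG: "E1 \<subseteq> G" "E2 \<subseteq> G" using E(4,5) by (auto dest: compactly_in_subset)
  have bE: "bounded E1" "bounded E2" using EG G(2) by (auto intro: bounded_subset)
  have e4: "0 < e / 4" using e by simp
  obtain \<phi>1 \<psi>1 g1 U1 where s1: "solves W \<alpha> E1 (e / 4) \<phi>1 \<psi>1 g1"
    and U1: "\<And>j. j \<in> J \<Longrightarrow> open (U1 j)" "\<And>j. j \<in> J \<Longrightarrow> compactly_in (U1 j) E1"
    "\<And>j z. j \<in> J \<Longrightarrow> z \<in> U1 j \<Longrightarrow> \<alpha> + grad_pair \<phi>1 \<psi>1 z = X j"
    "\<And>j. j \<in> J \<Longrightarrow> c j * measure lborel E1 - e / 4 \<le> measure lborel (U1 j)" "disjoint_family_on U1 J"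
    by (rule attainsE[OF c(1) E(1) bE(1) e4], rule that)
  obtain \<phi>2 \<psi>2 g2 U2 where s2: "solves W \<beta> E2 (e / 4) \<phi>2 \<psi>2 g2"
    and U2: "\<And>j. j \<in> J \<Longrightarrow> open (U2 j)" "\<And>j. j \<in> J \<Longrightarrow> compactly_in (U2 j) E2"
    "\<And>j z. j \<in> J \<Longrightarrow> z \<in> U2 j \<Longrightarrow> \<beta> + grad_pair \<phi>2 \<psi>2 z = X j"
    "\<And>j. j \<in> J \<Longrightarrow> d j * measure lborel E2 - e / 4 \<le> measure lborel (U2 j)" "disjoint_family_on U2 J"
    by (rule attainsE[OF d(1) E(2) bE(2) e4], rule that)
  note sol1 = solvesD[OF s1] and sol2 = solvesD[OF s2]
  define \<phi>' where "\<phi>' z = \<phi> z + (\<phi>1 z + \<phi>2 z)" for z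
  define \<psi>' where "\<psi>' z = \<psi> z + (\<psi>1 z + \<psi>2 z)" for z
  define g' where "g' z = g z + (g1 z + g2 z)" for z
  define U where "U j = U1 j \<union> U2 j" for j
  have Cc: "Cc_inf G \<phi>1" "Cc_inf G \<psi>1" "Cc_inf G g1" "Cc_inf G \<phi>2" "Cc_inf G \<psi>2" "Cc_inf G g2"
    using Cc_inf_mono[OF sol1(1) EG(1)] Cc_inf_mono[OF sol1(2) EG(1)] Cc_inf_mono[OF sol1(3) EG(1)]
      Cc_inf_mono[OF sol2(1) EG(2)] Cc_inf_mono[OF sol2(2) EG(2)] Cc_inf_mono[OF sol2(3) EG(2)] .
  have sm: "smooth_fun \<phi>" "smooth_fun \<psi>" "smooth_fun g" "smooth_fun \<phi>1" "smooth_fun \<psi>1" "smooth_fun g1"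
    "smooth_fun \<phi>2" "smooth_fun \<psi>2" "smooth_fun g2"
    using Cc sol(1-3) by (auto simp: Cc_inf_def)
  note sm12 = smooth_fun_add[OF sm(4,7)] smooth_fun_add[OF sm(5,8)] smooth_fun_add[OF sm(6,9)]
  have grad: "grad_pair \<phi>' \<psi>' z = grad_pair \<phi> \<psi> z + (grad_pair \<phi>1 \<psi>1 z + grad_pair \<phi>2 \<psi>2 z)" for z
    unfolding \<phi>'_def[abs_def] \<psi>'_def[abs_def] by (simp only: grad_pair_add sm sm12)
  have out1: "grad_pair \<phi>1 \<psi>1 z = 0" if "z \<notin> E1" for z using grad_pair_outside[OF sol1(1,2) that] .
  have out2: "grad_pair \<phi>2 \<psi>2 z = 0" if "z \<notin> E2" for z using grad_pair_outside[OF sol2(1,2) that] .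
  have val1: "Y + grad_pair \<phi>' \<psi>' z = \<alpha> + grad_pair \<phi>1 \<psi>1 z" if "z \<in> E1" for z
  proof -
    have "z \<notin> E2" using that E(3) by blast
    then show ?thesis using E1[OF that]
      by (simp add: grad out2 grad_pair_def[of \<phi> \<psi>] Y_def algebra_simps)
  qed
  have val2: "Y + grad_pair \<phi>' \<psi>' z = \<beta> + grad_pair \<phi>2 \<psi>2 z" if "z \<in> E2" for z
  proof -
    have "z \<notin> E1" using that E(3) by blast
    then show ?thesis using E2[OF that]
      by (simp add: grad out1 grad_pair_def[of \<phi> \<psi>] Y_def algebra_simps)
  qed
  have val0: "Y + grad_pair \<phi>' \<psi>' z \<in> W" if "z \<notin> E1" "z \<notin> E2" for z
  proof -
    obtain k where k: "k \<in> {-s..1-s}" "norm (grad_pair \<phi> \<psi> z - k *\<^sub>R (\<alpha> - \<beta>)) \<le> e0"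
      using near[of z] unfolding grad_pair_def by blast
    have "Y + k *\<^sub>R (\<alpha> - \<beta>) = (1 - (1 - s - k)) *\<^sub>R \<alpha> + (1 - s - k) *\<^sub>R \<beta>"
      by (simp add: Y_def algebra_simps)
    then have seg: "Y + k *\<^sub>R (\<alpha> - \<beta>) \<in> closed_segment \<alpha> \<beta>"
      unfolding in_segment using k(1) s by (intro exI[of _ "1 - s - k"]) auto
    have "dist (Y + k *\<^sub>R (\<alpha> - \<beta>)) (Y + grad_pair \<phi> \<psi> z) < r"
      using k(2) e0(3) by (simp add: dist_norm norm_minus_commute)
    then have "Y + grad_pair \<phi> \<psi> z \<in> (\<Union>x\<in>closed_segment \<alpha> \<beta>. ball x r)"
      by (intro UN_I[OF seg]) simp
    then have "Y + grad_pair \<phi> \<psi> z \<in> W" using r(2) by (rule subsetD[rotated])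
    then show ?thesis using that by (simp add: grad out1 out2)
  qed
  have inW: "Y + grad_pair \<phi>' \<psi>' z \<in> W" for z
  proof -
    consider "z \<in> E1" | "z \<in> E2" | "z \<notin> E1" "z \<notin> E2" by blast
    then show ?thesis
    proof cases
      case 1
      then show ?thesis using sol1(9) by (simp only: val1)
    next
      case 2
      then show ?thesis using sol2(9) by (simp only: val2)
    qed (rule val0)
  qed
  have tri: "norm (x + (y + w)) \<le> e" if "norm x \<le> e0" "norm y \<le> e / 4" "norm w \<le> e / 4" for x y w :: "'z::real_normed_vector"
    using norm_triangle_ineq[of x "y + w"] norm_triangle_ineq[of y w] that e0(2) e by linarith
  have "solves W Y G e \<phi>' \<psi>' g'"
    unfolding solves_def
  proof (intro conjI allI inW)
    show "Cc_inf G \<phi>'" "Cc_inf G \<psi>'" "Cc_inf G g'"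
      unfolding \<phi>'_def[abs_def] \<psi>'_def[abs_def] g'_def[abs_def] by (intro Cc_inf_add Cc sol)+
    fix z
    show "divx \<psi>' z = 0" "divx g' z = \<phi>' z"
      unfolding \<phi>'_def[abs_def] \<psi>'_def[abs_def] g'_def[abs_def]
      by (simp_all add: divx_add sm sm12 sol(4,5) sol1(4,5) sol2(4,5))
    show "norm (\<phi>' z) \<le> e" "norm (dt \<phi>' z) \<le> e" "norm (dt g' z) \<le> e"
      unfolding \<phi>'_def[abs_def] g'_def[abs_def] dt_eq_ddir ddir_add[OF sm(1) sm12(1)] ddir_add[OF sm(3) sm12(3)]
        ddir_add[OF sm(4,7)] ddir_add[OF sm(6,9)]
      unfolding dt_eq_ddir[symmetric] by (rule tri; fact sol sol1 sol2)+
  qed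
  moreover have "open (U j) \<and> compactly_in (U j) G \<and> (\<forall>z\<in>U j. Y + grad_pair \<phi>' \<psi>' z = X j) \<and>
       (s * c j + (1 - s) * d j) * measure lborel G - e \<le> measure lborel (U j)" if j: "j \<in> J" for j
  proof (intro conjI ballI)
    show "open (U j)" using U1(1) U2(1) j by (simp add: U_def open_Un)
    show "compactly_in (U j) G"
      unfolding U_def using U1(2)[OF j] U2(2)[OF j] EG by (intro compactly_in_Un) (auto intro: compactly_in_mono)
    have sub: "U1 j \<subseteq> E1" "U2 j \<subseteq> E2" using U1(2) U2(2) j by (auto dest: compactly_in_subset)
    show "Y + grad_pair \<phi>' \<psi>' z = X j" if "z \<in> U j" for z
    proof (cases "z \<in> U1 j")
      case True
      then have "z \<in> E1" using sub by blast
      then show ?thesis using U1(3)[OF j True] by (simp only: val1)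
    next
      case False
      then have z: "z \<in> U2 j" using that by (simp add: U_def)
      then have "z \<in> E2" using sub by blast
      then show ?thesis using U2(3)[OF j z] by (simp only: val2)
    qed
    have "measure lborel (U j) = measure lborel (U1 j) + measure lborel (U2 j)"
      unfolding U_def using sub bE E(3) U1(1)[OF j] U2(1)[OF j]
      by (intro measure_lborel_Un_disjoint) (auto intro: bounded_subset)
    \<comment> \<open>The outer loss e0 is scaled by a weight in [0,1]; with the two inner losses
      the total is four times e / 4.\<close>
    moreover have part: "x * y - e / 4 \<le> x * m" if "y - e0 \<le> m" "0 \<le> x \<and> x \<le> 1" for x y m
    proof -
      have "x * y - e0 \<le> x * (y - e0)" using mult_right_mono[of x 1 e0] that(2) e0(1) by (simp add: algebra_simps)
      also have "\<dots> \<le> x * m" using that by (intro mult_left_mono) auto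
      finally show ?thesis using e0(2) by linarith
    qed
    ultimately show "(s * c j + (1 - s) * d j) * measure lborel G - e \<le> measure lborel (U j)"
      using part[OF mE(1) c(2)[OF j]] part[OF mE(2) d(2)[OF j]] U1(4)[OF j] U2(4)[OF j]
      by (simp add: algebra_simps)
  qed
  moreover have "disjoint_family_on U J"
    unfolding disjoint_family_on_def
  proof (intro ballI impI)
    fix i j assume ij: "i \<in> J" "j \<in> J" "i \<noteq> j"
    then have "U1 i \<inter> U1 j = {}" "U2 i \<inter> U2 j = {}"
      using U1(5) U2(5) by (auto simp: disjoint_family_on_def)
    moreover have "U1 i \<subseteq> E1" "U1 j \<subseteq> E1" "U2 i \<subseteq> E2" "U2 j \<subseteq> E2"
      using U1(2) U2(2) ij by (auto dest: compactly_in_subset)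
    ultimately show "U i \<inter> U j = {}" using E(3) unfolding U_def by blast
  qed
  ultimately show "\<exists>\<phi> \<psi> g U. solves W (s *\<^sub>R \<alpha> + (1 - s) *\<^sub>R \<beta>) G e \<phi> \<psi> g \<and>
     (\<forall>j\<in>J. open (U j) \<and> compactly_in (U j) G \<and>
       (\<forall>z\<in>U j. s *\<^sub>R \<alpha> + (1 - s) *\<^sub>R \<beta> + grad_pair \<phi> \<psi> z = X j) \<and>
       (s * c j + (1 - s) * d j) * measure lborel G - e \<le> measure lborel (U j)) \<and> disjoint_family_on U J"
    unfolding Y_def[symmetric]
    by (intro exI[of _ \<phi>'] exI[of _ \<psi>'] exI[of _ g'] exI[of _ U]) blast
qed

text \<open>The degenerate weights 0 and 1 do occur, for instance as q, and require no
  oscillation.\<close>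

lemma attains_laminate:
  assumes "open W" "closed_segment \<alpha> \<beta> \<subseteq> W" "\<alpha> - \<beta> \<in> wave_cone" and s: "0 \<le> s" "s \<le> 1"
    and "attains W X J \<alpha> c" "\<And>j. j \<in> J \<Longrightarrow> 0 \<le> c j \<and> c j \<le> 1"
    and "attains W X J \<beta> d" "\<And>j. j \<in> J \<Longrightarrow> 0 \<le> d j \<and> d j \<le> 1"
  shows "attains W X J (s *\<^sub>R \<alpha> + (1 - s) *\<^sub>R \<beta>) (\<lambda>j. s * c j + (1 - s) * d j)"
proof -
  consider "s = 0" | "s = 1" | "0 < s" "s < 1" using s by linarith
  then show ?thesis
  proof cases
    case 3
    then show ?thesis using assms by (intro attains_laminate_strict) auto
  qed (use assms in auto)
qed

section \<open>The cyclic configuration\<close>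

definition cyc_succ :: "nat \<Rightarrow> nat \<Rightarrow> nat" where
  "cyc_succ N i = (if i = N then 1 else Suc i)"

lemma cyc_succ_surj:
  assumes "i \<in> {1..N}"
  obtains i' where "i' \<in> {1..N}" "i = cyc_succ N i'"
proof (cases "i = 1")
  case True
  then show thesis using that[of N] assms by (auto simp: cyc_succ_def)
next
  case False
  then show thesis using assms by (intro that[of "i - 1"]) (auto simp: cyc_succ_def)
qed

text \<open>Moving the window by one replaces a factor by its translate by a full period, so the
  product does not depend on where the window starts.\<close>

lemma prod_periodic_window:
  fixes f :: "int \<Rightarrow> real"
  assumes N: "1 \<le> N" and per: "\<And>k. f (k + int N) = f k"
  shows "(\<Prod>l\<in>{0..<N}. f (int i - int l)) = (\<Prod>k\<in>{1..int N}. f k)"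
proof -
  define S where "S i = (\<Prod>l\<in>{0..<N}. f (int i - int l))" for i
  obtain M where M: "N = Suc M" using N by (cases N) auto
  have step: "S (Suc i) = S i" for i
  proof -
    have "S (Suc i) = f (int (Suc i)) * (\<Prod>l\<in>{0..<M}. f (int i - int l))"
      unfolding S_def M by (subst prod.atLeast0_lessThan_Suc_shift) (simp add: algebra_simps)
    also have "f (int (Suc i)) = f (int i - int M)"
      using per[of "int i - int M"] by (simp add: M algebra_simps)
    also have "\<dots> * (\<Prod>l\<in>{0..<M}. f (int i - int l)) = S i"
      unfolding S_def M by (simp add: mult.commute)
    finally show ?thesis .
  qed
  have "S i = S 0" for i by (induction i) (simp_all add: step)
  then have "S i = S N" by metis
  also have "S N = (\<Prod>k\<in>{1..int N}. f k)"
    unfolding S_def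
    by (rule prod.reindex_bij_witness[of _ "\<lambda>k. nat (int N - k)" "\<lambda>l. int N - int l"]) auto
  finally show ?thesis by (simp add: S_def)
qed

text \<open>For i = j the distance is N and not 0: going backwards, an index meets itself only after
  a full turn.\<close>

definition cyc_dist :: "nat \<Rightarrow> nat \<Rightarrow> nat \<Rightarrow> nat" where
  "cyc_dist N i j = (if (int i - int j) mod int N = 0 then N else nat ((int i - int j) mod int N))"

text \<open>Integer indices let the backward product run below 1, so that the recursion in i becomes
  a plain shift.\<close>

definition cyc_weight :: "nat \<Rightarrow> (int \<Rightarrow> real) \<Rightarrow> nat \<Rightarrow> nat \<Rightarrow> real" where
  "cyc_weight N t i d = (\<Prod>l\<in>{1..<d}. 1 - t (int i - int l)) * t (int i - int d)
     / (1 - (\<Prod>k\<in>{1..int N}. 1 - t k))"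

lemma nu_coef_eq:
  "nu_coef N \<kappa> mu \<rho> i j
     = cyc_weight N (\<lambda>k. (1 / \<kappa> (nat ((k - 1) mod int N) + 1) \<rho>) / mu) i (cyc_dist N i j)"
  by (simp add: nu_coef_def cyc_weight_def cyc_dist_def Let_def)

text \<open>When i and d grow together, the last index i - d stays fixed and the backward product
  gains one factor at its front.\<close>

lemma cyc_weight_shift: "1 \<le> d \<Longrightarrow> cyc_weight N t (Suc i) (Suc d) = (1 - t (int i)) * cyc_weight N t i d"
proof -
  assume "1 \<le> d"
  then have "(\<Prod>l\<in>{1..<Suc d}. 1 - t (int (Suc i) - int l))
      = (1 - t (int i)) * (\<Prod>l\<in>{Suc 1..<Suc d}. 1 - t (int (Suc i) - int l))"
    by (subst prod.atLeast_Suc_lessThan) auto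
  also have "(\<Prod>l\<in>{Suc 1..<Suc d}. 1 - t (int (Suc i) - int l)) = (\<Prod>l\<in>{1..<d}. 1 - t (int i - int l))"
    by (subst prod.atLeast_Suc_lessThan_Suc_shift) simp
  finally show ?thesis by (simp add: cyc_weight_def)
qed

text \<open>After a full turn the collected factors make up the whole product P, and t / (1 - P) = t
  + P * t / (1 - P) closes the recursion: 1 / (1 - P) is the geometric series over all
  turns.\<close>

lemma cyc_weight_full:
  assumes "1 \<le> N" "\<And>k. t (k + int N) = t k" "(\<Prod>k\<in>{1..int N}. 1 - t k) \<noteq> 1"
  shows "cyc_weight N t (Suc i) 1 = t (int i) + (1 - t (int i)) * cyc_weight N t i N"
proof -
  define P where "P = (\<Prod>k\<in>{1..int N}. 1 - t k)"
  have "P = (\<Prod>l\<in>{0..<N}. 1 - t (int i - int l))"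
    unfolding P_def using assms(1,2) by (subst prod_periodic_window) auto
  also have "\<dots> = (1 - t (int i)) * (\<Prod>l\<in>{1..<N}. 1 - t (int i - int l))"
    using assms(1) by (subst prod.atLeast_Suc_lessThan) auto
  finally have P: "P = (1 - t (int i)) * (\<Prod>l\<in>{1..<N}. 1 - t (int i - int l))" .
  have "t (int i - int N) = t (int i)" using assms(2)[of "int i - int N"] by simp
  then have "(1 - t (int i)) * cyc_weight N t i N = P * t (int i) / (1 - P)"
    by (simp add: cyc_weight_def P_def[symmetric] P)
  moreover have "cyc_weight N t (Suc i) 1 = t (int i) / (1 - P)"
    by (simp add: cyc_weight_def P_def)
  moreover have "t (int i) / (1 - P) = t (int i) + P * t (int i) / (1 - P)"
    using assms(3) unfolding P_def[symmetric] by (simp add: field_simps)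
  ultimately show ?thesis by simp
qed

lemma nu_coef_cyc_succ:
  assumes N: "2 \<le> N" and i: "i \<in> {1..N}" and j: "j \<in> {1..N}"
    and t: "\<And>i. i \<in> {1..N} \<Longrightarrow> 0 < 1 / \<kappa> i \<rho> / mu \<and> 1 / \<kappa> i \<rho> / mu < 1"
  shows "nu_coef N \<kappa> mu \<rho> (cyc_succ N i) j
    = (1 / \<kappa> i \<rho> / mu) * (if j = i then 1 else 0) + (1 - 1 / \<kappa> i \<rho> / mu) * nu_coef N \<kappa> mu \<rho> i j"
    and "0 \<le> nu_coef N \<kappa> mu \<rho> i j"
proof -
  define t' where "t' = (\<lambda>k::int. (1 / \<kappa> (nat ((k - 1) mod int N) + 1) \<rho>) / mu)"
  have t'01: "0 < t' k" "t' k < 1" for k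
  proof -
    have "nat ((k - 1) mod int N) < N"
      using N by (simp add: nat_less_iff)
    then have "nat ((k - 1) mod int N) + 1 \<in> {1..N}" by simp
    from t[OF this] show "0 < t' k" "t' k < 1" by (simp_all only: t'_def)
  qed
  have per: "t' (k + int N) = t' k" for k
  proof -
    have "(k + int N - 1) mod int N = (k - 1) mod int N"
      using mod_add_self2[of "k - 1" "int N"] by (simp add: algebra_simps)
    then show ?thesis by (simp add: t'_def)
  qed
  have ti: "t' (int i) = 1 / \<kappa> i \<rho> / mu"
    using i by (auto simp: t'_def mod_pos_pos_trivial nat_diff_distrib)
  define P where "P = (\<Prod>k\<in>{1..int N}. 1 - t' k)"
  have "P = (1 - t' 1) * (\<Prod>k\<in>{1..int N} - {1}. 1 - t' k)"
    unfolding P_def using N by (intro prod.remove) auto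
  also have "\<dots> \<le> (1 - t' 1) * 1"
    using t'01 by (intro mult_left_mono prod_le_1) (auto simp: less_imp_le)
  finally have P: "P < 1" using t'01(1)[of 1] by simp
  have nu: "nu_coef N \<kappa> mu \<rho> i j = cyc_weight N t' i (cyc_dist N i j)" for i j
    unfolding t'_def by (rule nu_coef_eq)
  have "0 \<le> (\<Prod>l\<in>{1..<cyc_dist N i j}. 1 - t' (int i - int l))"
    using t'01 by (intro prod_nonneg) (auto simp: less_imp_le)
  then show "0 \<le> nu_coef N \<kappa> mu \<rho> i j"
    unfolding nu cyc_weight_def P_def[symmetric] using P t'01(1) by (simp add: less_imp_le)
  \<comment> \<open>For i = N the successor is 1 while the weight formula continues with N + 1;
    periodicity of \<open>t'\<close> identifies the two.\<close>
  have wrap: "nu_coef N \<kappa> mu \<rho> (cyc_succ N i) j = cyc_weight N t' (Suc i) (cyc_dist N (Suc i) j)"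
  proof (cases "i = N")
    case True
    have "(1 - int j) mod int N = (int (Suc N) - int j) mod int N"
      using mod_add_self2[of "1 - int j" "int N"] by (simp add: algebra_simps)
    then have "cyc_dist N 1 j = cyc_dist N (Suc N) j" by (simp add: cyc_dist_def)
    moreover have "t' (int (Suc N) - l) = t' (int 1 - l)" for l
      using per[of "1 - l"] by (simp add: algebra_simps)
    ultimately show ?thesis using True by (simp only: nu cyc_succ_def cyc_weight_def if_True refl)
  qed (simp add: nu cyc_succ_def)
  show "nu_coef N \<kappa> mu \<rho> (cyc_succ N i) j
    = (1 / \<kappa> i \<rho> / mu) * (if j = i then 1 else 0) + (1 - 1 / \<kappa> i \<rho> / mu) * nu_coef N \<kappa> mu \<rho> i j"
  \<comment> \<open>For j = i the distance drops from N to 1; otherwise it grows by one.\<close>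
  proof (cases "j = i")
    case True
    then have "cyc_dist N i j = N" "cyc_dist N (Suc i) j = 1"
      using N by (auto simp: cyc_dist_def)
    then show ?thesis
      unfolding wrap unfolding nu using cyc_weight_full[of N t' i, OF _ per] P N True by (simp add: ti P_def)
  next
    case False
    define m where "m = (int i - int j) mod int N"
    have m: "0 \<le> m" "m < int N" unfolding m_def using N by auto
    have "m \<noteq> 0"
    proof
      assume "m = 0"
      then have "int N dvd int i - int j" unfolding m_def by auto
      moreover have "\<bar>int i - int j\<bar> < int N" using i j by auto
      moreover have "int i - int j \<noteq> 0" using False by simp
      ultimately show False using dvd_imp_le_int[of "int i - int j" "int N"] by linarith
    qed
    have "(int (Suc i) - int j) mod int N = (m + 1) mod int N"
      unfolding m_def by (simp add: mod_simps algebra_simps)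
    also have "\<dots> = (if m + 1 = int N then 0 else m + 1)" using m by auto
    finally have "cyc_dist N (Suc i) j = Suc (nat m)"
      using m \<open>m \<noteq> 0\<close> by (auto simp: cyc_dist_def nat_add_distrib)
    moreover have "cyc_dist N i j = nat m" using \<open>m \<noteq> 0\<close> by (simp add: cyc_dist_def m_def)
    moreover have "1 \<le> nat m" using m \<open>m \<noteq> 0\<close> by linarith
    ultimately show ?thesis
      unfolding wrap unfolding nu using cyc_weight_shift[of "nat m" N t' i] False by (simp add: ti)
  qed
qed

text \<open>Going once around the cycle contracts the deviation of the sum from \<open>1\<close>.\<close>
lemma nu_coef_sum:
  assumes N: "2 \<le> N" and i: "i \<in> {1..N}"
    and t: "\<And>i. i \<in> {1..N} \<Longrightarrow> 0 < 1 / \<kappa> i \<rho> / mu \<and> 1 / \<kappa> i \<rho> / mu < 1"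
  shows "(\<Sum>j\<in>{1..N}. nu_coef N \<kappa> mu \<rho> i j) = 1"
proof -
  define s where "s i = \<bar>(\<Sum>j\<in>{1..N}. nu_coef N \<kappa> mu \<rho> i j) - 1\<bar>" for i
  have step: "s (cyc_succ N i) = (1 - 1 / \<kappa> i \<rho> / mu) * s i" if "i \<in> {1..N}" for i
  proof -
    have "(\<Sum>j\<in>{1..N}. nu_coef N \<kappa> mu \<rho> (cyc_succ N i) j)
      = (\<Sum>j\<in>{1..N}. (1 / \<kappa> i \<rho> / mu) * (if j = i then 1 else 0) + (1 - 1 / \<kappa> i \<rho> / mu) * nu_coef N \<kappa> mu \<rho> i j)"
    proof (rule sum.cong[OF refl])
      fix j assume "j \<in> {1..N}"
      then show "nu_coef N \<kappa> mu \<rho> (cyc_succ N i) j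
        = (1 / \<kappa> i \<rho> / mu) * (if j = i then 1 else 0) + (1 - 1 / \<kappa> i \<rho> / mu) * nu_coef N \<kappa> mu \<rho> i j"
        using nu_coef_cyc_succ(1)[where \<kappa> = \<kappa> and mu = mu and \<rho> = \<rho>, OF N that] t by blast
    qed
    also have "\<dots> = 1 / \<kappa> i \<rho> / mu * (\<Sum>j\<in>{1..N}. if j = i then 1 else 0)
        + (1 - 1 / \<kappa> i \<rho> / mu) * (\<Sum>j\<in>{1..N}. nu_coef N \<kappa> mu \<rho> i j)"
      by (simp only: sum.distrib sum_distrib_left[symmetric])
    also have "(\<Sum>j\<in>{1..N}. if j = i then 1 else 0 :: real) = 1" using that by simp
    finally have "(\<Sum>j\<in>{1..N}. nu_coef N \<kappa> mu \<rho> (cyc_succ N i) j) - 1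
      = (1 - 1 / \<kappa> i \<rho> / mu) * ((\<Sum>j\<in>{1..N}. nu_coef N \<kappa> mu \<rho> i j) - 1)"
      by (simp only: algebra_simps)
    moreover have "0 \<le> 1 - 1 / \<kappa> i \<rho> / mu" using t[OF that] by linarith
    ultimately show ?thesis by (simp only: s_def abs_mult abs_of_nonneg)
  qed
  \<comment> \<open>At an index of maximal deviation, the predecessor deviates by no more, so the
    factor 1 - t < 1 forces the maximum to be 0.\<close>
  have "Max (s ` {1..N}) \<in> s ` {1..N}" using N by (intro Max_in) auto
  then obtain k where k: "k \<in> {1..N}" "s k = Max (s ` {1..N})" by auto
  obtain k' where k': "k' \<in> {1..N}" "k = cyc_succ N k'" using cyc_succ_surj[OF k(1)] .
  have max: "s x \<le> s k" if "x \<in> {1..N}" for x unfolding k(2) using that by (intro Max_ge) auto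
  have "s k = (1 - 1 / \<kappa> k' \<rho> / mu) * s k'" using step[OF k'(1)] k'(2) by simp
  also have "\<dots> \<le> (1 - 1 / \<kappa> k' \<rho> / mu) * s k"
    using max[OF k'(1)] t[OF k'(1)] by (intro mult_left_mono) auto
  finally have "1 / \<kappa> k' \<rho> / mu * s k \<le> 0" by (simp only: algebra_simps)
  then have "s k \<le> 0" using t[OF k'(1)] by (meson mult_pos_pos not_le)
  then have "s i \<le> 0" using max[OF i] by linarith
  then show ?thesis by (simp add: s_def)
qed

text \<open>The points \<open>\<pi> i\<close> form a \<open>T\<^sub>N\<close> configuration: splitting \<open>\<pi> (i + 1)\<close> between \<open>\<zeta> i\<close> and \<open>\<pi> i\<close> and iterating,
  the unused fraction decays geometrically.\<close>
lemma attains_cycle: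
  assumes W: "open W" and "0 < \<delta>" "\<delta> \<le> 1"
    and seg: "\<And>i. i \<in> {1..N} \<Longrightarrow> closed_segment (\<zeta> i) (\<pi> i) \<subseteq> W"
    and cone: "\<And>i. i \<in> {1..N} \<Longrightarrow> \<zeta> i - \<pi> i \<in> wave_cone"
    and \<zeta>: "\<And>i. i \<in> {1..N} \<Longrightarrow> attains W X J (\<zeta> i) (c i)"
    and c: "\<And>i j. i \<in> {1..N} \<Longrightarrow> j \<in> J \<Longrightarrow> 0 \<le> c i j \<and> c i j \<le> 1"
    and t: "\<And>i. i \<in> {1..N} \<Longrightarrow> \<delta> \<le> t i \<and> t i \<le> 1"
    and \<pi>: "\<And>i. i \<in> {1..N} \<Longrightarrow> \<pi> (cyc_succ N i) = t i *\<^sub>R \<zeta> i + (1 - t i) *\<^sub>R \<pi> i"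
    and \<nu>: "\<And>i j. i \<in> {1..N} \<Longrightarrow> j \<in> J \<Longrightarrow> \<nu> (cyc_succ N i) j = t i * c i j + (1 - t i) * \<nu> i j"
    and \<nu>01: "\<And>i j. i \<in> {1..N} \<Longrightarrow> j \<in> J \<Longrightarrow> 0 \<le> \<nu> i j \<and> \<nu> i j \<le> 1"
    and i: "i \<in> {1..N}"
  shows "attains W X J (\<pi> i) (\<nu> i)"
proof -
  \<comment> \<open>After n splittings the missing weight is at most (1 - \<delta>)^n. The
    truncation at 0 is there because lamination asks for nonnegative weights; for n = 0 nothing is
    claimed beyond weight 0.\<close>
  have iter: "attains W X J (\<pi> i) (\<lambda>j. max 0 (\<nu> i j - (1 - \<delta>) ^ n))" if "i \<in> {1..N}" for n i
    using that
  proof (induction n arbitrary: i)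
    case 0
    have "\<pi> i \<in> W" using seg[OF 0] by auto
    then show ?case by (rule attains_weaken[OF attains_zero]) (use \<nu>01[OF 0] in auto)
  next
    case (Suc n)
    obtain k where k: "k \<in> {1..N}" "i = cyc_succ N k" using cyc_succ_surj[OF Suc.prems] .
    let ?d = "\<lambda>j. max 0 (\<nu> k j - (1 - \<delta>) ^ n)"
    have d01: "0 \<le> ?d j \<and> ?d j \<le> 1" if "j \<in> J" for j
    proof -
      have "0 \<le> (1 - \<delta>) ^ n" using \<open>\<delta> \<le> 1\<close> by simp
      then show ?thesis using \<nu>01[OF k(1) that] by linarith
    qed
    have "attains W X J (t k *\<^sub>R \<zeta> k + (1 - t k) *\<^sub>R \<pi> k) (\<lambda>j. t k * c k j + (1 - t k) * ?d j)"
      using t[OF k(1)] \<open>0 < \<delta>\<close> c[OF k(1)] d01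
      by (intro attains_laminate[OF W seg[OF k(1)] cone[OF k(1)]] \<zeta>[OF k(1)] Suc.IH[OF k(1)]) auto
    then show ?case
      unfolding k(2) \<pi>[OF k(1)]
    proof (rule attains_weaken)
      fix j assume j: "j \<in> J"
      have "(1 - t k) * (\<nu> k j - (1 - \<delta>) ^ n) \<le> (1 - t k) * ?d j"
        using t[OF k(1)] by (intro mult_left_mono) auto
      moreover have "(1 - t k) * (1 - \<delta>) ^ n \<le> (1 - \<delta>) * (1 - \<delta>) ^ n"
        using t[OF k(1)] \<open>\<delta> \<le> 1\<close> by (intro mult_right_mono) auto
      ultimately have "\<nu> (cyc_succ N k) j - (1 - \<delta>) ^ Suc n \<le> t k * c k j + (1 - t k) * ?d j"
        unfolding \<nu>[OF k(1) j] right_diff_distrib power_Suc by linarith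
      moreover have "0 \<le> t k * c k j + (1 - t k) * ?d j"
        using t[OF k(1)] c[OF k(1) j] d01[OF j] \<open>0 < \<delta>\<close> by (intro add_nonneg_nonneg mult_nonneg_nonneg) auto
      ultimately show "max 0 (\<nu> (cyc_succ N k) j - (1 - \<delta>) ^ Suc n) \<le> t k * c k j + (1 - t k) * ?d j"
        by simp
    qed
  qed
  show ?thesis
  proof (rule attains_limit)
    fix d :: real assume "0 < d"
    then obtain n where "(1 - \<delta>) ^ n < d"
      using real_arch_pow_inv[of d "1 - \<delta>"] \<open>0 < \<delta>\<close> by auto
    then show "attains W X J (\<pi> i) (\<lambda>j. \<nu> i j - d)"
      by (intro attains_weaken[OF iter[OF i, of n]]) linarith
  qed
qed

section \<open>Openness of the set of admissible values, and the final assembly\<close>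

lemma wave_cone_scaleR:
  assumes "\<eta> \<in> wave_cone"
  shows "c *\<^sub>R \<eta> \<in> wave_cone"
proof -
  obtain p a B where *: "\<eta> = (outer p a, B)" "a \<noteq> 0" "B *v a = 0"
    using assms by (auto simp: wave_cone_def)
  have "c *\<^sub>R \<eta> = (outer (c *\<^sub>R p) a, c *\<^sub>R B)"
    using * by (simp add: outer_def vec_eq_iff mult.assoc)
  moreover have "(c *\<^sub>R B) *v a = 0" using *(3) by (simp add: scaleR_matrix_vector_assoc[symmetric])
  ultimately show ?thesis using *(2) unfolding wave_cone_def by blast
qed

lemma open_L_i_set:
  assumes "open (S_set \<kappa> \<gamma> i r lam)" "open (S_set \<kappa> \<gamma> i r 0)"
  shows "open (L_i_set \<kappa> \<gamma> i r lam)"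
  unfolding open_dist
proof
  fix y assume "y \<in> L_i_set \<kappa> \<gamma> i r lam"
  then obtain \<alpha> \<beta> where ab: "y \<in> closed_segment \<alpha> \<beta>" "\<alpha> \<in> S_set \<kappa> \<gamma> i r lam" "\<beta> \<in> S_set \<kappa> \<gamma> i r 0"
    "\<alpha> - \<beta> \<in> wave_cone"
    unfolding L_i_set_def by blast
  obtain e1 where e1: "e1 > 0" "\<And>x. dist x \<alpha> < e1 \<Longrightarrow> x \<in> S_set \<kappa> \<gamma> i r lam"
    using assms(1) ab(2) unfolding open_dist by blast
  obtain e2 where e2: "e2 > 0" "\<And>x. dist x \<beta> < e2 \<Longrightarrow> x \<in> S_set \<kappa> \<gamma> i r 0"
    using assms(2) ab(3) unfolding open_dist by blast
  show "\<exists>e>0. \<forall>x. dist x y < e \<longrightarrow> x \<in> L_i_set \<kappa> \<gamma> i r lam"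
  proof (intro exI[of _ "min e1 e2"] conjI allI impI)
    fix x assume x: "dist x y < min e1 e2"
    define h where "h = x - y"
    have "h + \<alpha> \<in> S_set \<kappa> \<gamma> i r lam" using x by (intro e1(2)) (simp add: h_def dist_norm)
    moreover have "h + \<beta> \<in> S_set \<kappa> \<gamma> i r 0" using x by (intro e2(2)) (simp add: h_def dist_norm)
    moreover have "(h + \<alpha>) - (h + \<beta>) \<in> wave_cone" using ab(4) by simp
    moreover have "x \<in> closed_segment (h + \<alpha>) (h + \<beta>)"
      using ab(1) by (simp add: closed_segment_translation h_def image_iff)
    ultimately show "x \<in> L_i_set \<kappa> \<gamma> i r lam" unfolding L_i_set_def by blast
  qed (use e1(1) e2(1) in simp)
qed

lemma segment_subset_Sigma_set:
  assumes "i \<in> {1..N}" "lam \<in> {\<delta>0..mu}" "\<rho> \<in> ball 0 r" "\<rho>' \<in> ball 0 r"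
    "zeta_map \<kappa> \<gamma> i lam \<rho> - pi_map \<gamma> i \<rho>' \<in> wave_cone"
  shows "closed_segment (zeta_map \<kappa> \<gamma> i lam \<rho>) (pi_map \<gamma> i \<rho>') \<subseteq> Sigma_set N \<kappa> \<gamma> \<delta>0 r mu"
proof -
  have "zeta_map \<kappa> \<gamma> i lam \<rho> \<in> S_set \<kappa> \<gamma> i r lam" using assms(3) by (simp add: S_set_def)
  \<comment> \<open>The point \<open>pi_map \<gamma> i \<rho>'\<close> is \<open>zeta_map\<close> at
    parameter 0.\<close>
  moreover have "pi_map \<gamma> i \<rho>' \<in> S_set \<kappa> \<gamma> i r 0"
    using assms(4) by (auto simp: S_set_def zeta_map_def image_iff)
  ultimately have "closed_segment (zeta_map \<kappa> \<gamma> i lam \<rho>) (pi_map \<gamma> i \<rho>') \<subseteq> L_i_set \<kappa> \<gamma> i r lam"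
    using assms(5) unfolding L_i_set_def by blast
  also have "\<dots> \<subseteq> L_set N \<kappa> \<gamma> r lam" using assms(1) unfolding L_set_def by blast
  also have "\<dots> \<subseteq> Sigma_set N \<kappa> \<gamma> \<delta>0 r mu" using assms(2) unfolding Sigma_set_def by blast
  finally show ?thesis .
qed

text \<open>Serves to turn the additive loss into the factor 1 - \<tau>: finitely many positive
  volumes have a positive lower bound, and a target volume 0 demands nothing.\<close>

lemma ex_uniform_tolerance:
  fixes v :: "'j \<Rightarrow> real"
  assumes "finite J" "0 < \<tau>"
  obtains e where "0 < e" "e < \<tau>" "\<And>j. j \<in> J \<Longrightarrow> 0 < v j \<Longrightarrow> e \<le> \<tau> * v j"
proof -
  let ?S = "insert (\<tau> / 2) ((\<lambda>j. \<tau> * v j) ` {j \<in> J. 0 < v j})"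
  have fin: "finite ?S" using assms(1) by simp
  have "0 < Min ?S" using fin assms(2) by (subst Min_gr_iff) auto
  moreover have "Min ?S \<le> \<tau> / 2" using fin by (intro Min_le) auto
  then have "Min ?S < \<tau>" using assms(2) by linarith
  moreover have "Min ?S \<le> \<tau> * v j" if "j \<in> J" "0 < v j" for j
    using fin that by (intro Min_le) auto
  ultimately show thesis using that by blast
qed

theorem theorem3p10:
  fixes \<sigma> :: "real^'n::finite^'m::finite \<Rightarrow> real^'n^'m"
    and N :: nat and r0 \<delta>1 \<delta>2 \<delta>0 :: real
    and \<kappa> :: "nat \<Rightarrow> ('n,'m) mpair \<Rightarrow> real"
    and \<gamma> :: "nat \<Rightarrow> ('n,'m) mpair \<Rightarrow> ('n,'m) mpair"
    and lam lam' mu r q \<tau> :: real and i :: nat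
    and Y \<rho> \<rho>' :: "('n,'m) mpair"
    and G :: "((real^'n) \<times> real) set"
  assumes cond: "cond_O \<sigma> N r0 \<delta>1 \<delta>2 \<delta>0 \<kappa> \<gamma>"
    and lam: "\<delta>0 \<le> lam" "lam \<le> mu" "mu < 1"
    and r: "0 < r" "r \<le> r0"
    and Y: "Y \<in> Sigma_set N \<kappa> \<gamma> \<delta>0 r lam"
    and Yeq: "Y = q *\<^sub>R zeta_map \<kappa> \<gamma> i lam' \<rho> + (1 - q) *\<^sub>R pi_map \<gamma> i \<rho>'"
    and q: "0 \<le> q" "q \<le> 1"
    and i: "1 \<le> i" "i \<le> N"
    and lam': "\<delta>0 \<le> lam'" "lam' \<le> lam"
    and \<rho>: "\<rho> \<in> ball 0 r" "\<rho>' \<in> ball 0 r"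
    and cone: "zeta_map \<kappa> \<gamma> i lam' \<rho> - pi_map \<gamma> i \<rho>' \<in> wave_cone"
    and G: "bounded G" "open G"
    and \<tau>: "0 < \<tau>" "\<tau> < 1"
  shows "\<exists>(\<phi> :: (real^'n) \<times> real \<Rightarrow> real^'m) (\<psi> :: (real^'n) \<times> real \<Rightarrow> real^'n^'m)
           (g :: (real^'n) \<times> real \<Rightarrow> real^'n^'m).
     Cc_inf G \<phi> \<and> Cc_inf G \<psi> \<and> Cc_inf G g \<and>
     \<comment> \<open>(a)\<close>
     (\<forall>z\<in>G. divx \<psi> z = 0 \<and> divx g z = \<phi> z \<and>
              Y + (Dx \<phi> z, dt \<psi> z) \<in> Sigma_set N \<kappa> \<gamma> \<delta>0 r mu) \<and>
     \<comment> \<open>(b): sum of the sup norms over G is < \<tau>\<close>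
     (\<exists>a b c. (\<forall>z\<in>G. norm (\<phi> z) \<le> a \<and> norm (dt \<phi> z) \<le> b \<and> norm (dt g z) \<le> c) \<and> a + b + c < \<tau>) \<and>
     \<comment> \<open>(c)\<close>
     (\<exists>G1 G2 :: nat \<Rightarrow> ((real^'n) \<times> real) set.
        (\<forall>j\<in>{1..N}. open (G1 j) \<and> open (G2 j) \<and> compactly_in (G1 j) G \<and> compactly_in (G2 j) G) \<and>
        (\<forall>j\<in>{1..N}. \<forall>k\<in>{1..N}. (j \<noteq> k \<longrightarrow> G1 j \<inter> G1 k = {} \<and> G2 j \<inter> G2 k = {}) \<and> G1 j \<inter> G2 k = {}) \<and>
        (\<forall>j\<in>{1..N}. \<forall>z\<in>G1 j \<union> G2 j.
            Y + (Dx \<phi> z, dt \<psi> z) =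
              (if z \<in> G1 j then zeta_map \<kappa> \<gamma> j mu \<rho> else 0) + (if z \<in> G2 j then zeta_map \<kappa> \<gamma> j mu \<rho>' else 0) \<and>
            Y + (Dx \<phi> z, dt \<psi> z) \<in> S_set \<kappa> \<gamma> j r mu) \<and>
        measure lborel (G1 i \<union> G2 i) \<ge>
          (1 - \<tau>) * ((1 - q) * nu_coef N \<kappa> mu \<rho>' i i
                     + q * (lam' / mu + (1 - lam' / mu) * nu_coef N \<kappa> mu \<rho> i i)) * measure lborel G \<and>
        (\<forall>j\<in>{1..N}. j \<noteq> i \<longrightarrow>
          measure lborel (G1 j \<union> G2 j) \<ge>
            (1 - \<tau>) * ((1 - q) * nu_coef N \<kappa> mu \<rho>' i j
                       + q * (1 - lam' / mu) * nu_coef N \<kappa> mu \<rho> i j) * measure lborel G) \<and>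
        (\<Sum>j\<in>{1..N}. measure lborel (G1 j \<union> G2 j)) \<ge> (1 - \<tau>) * measure lborel G)"
proof -
  note c = cond[unfolded cond_O_def]
  have N: "2 \<le> N" and \<delta>: "0 < \<delta>1" "\<delta>1 < \<delta>2" "\<delta>2 < 1" "\<delta>2 < \<delta>0" "\<delta>0 < 1"
    using c by simp_all
  have \<kappa>b: "1 / \<delta>2 \<le> \<kappa> k \<theta>" "\<kappa> k \<theta> \<le> 1 / \<delta>1" and \<gamma>c: "\<gamma> k \<theta> \<in> wave_cone"
    if "k \<in> {1..N}" "\<theta> \<in> cball 0 r0" for k \<theta>
    using c that by simp_all
  have \<gamma>sum: "(\<Sum>k\<in>{1..N}. \<gamma> k \<theta>) = 0" if "\<theta> \<in> cball 0 r0" for \<theta>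
    using c that by simp
  have S_open: "open (S_set \<kappa> \<gamma> k r lam)" if "k \<in> {1..N}" "lam = 0 \<or> \<delta>0 \<le> lam \<and> lam < 1" for k lam
    using c that r by simp
  have mu: "\<delta>0 \<le> mu" "0 < mu" "mu < 1" using lam \<delta> by linarith+
  have lam'mu: "lam' \<in> {\<delta>0..mu}" using lam lam' by simp
  have iN: "i \<in> {1..N}" using i by simp
  have ball0: "\<theta> \<in> cball 0 r0" if "\<theta> \<in> ball 0 r" for \<theta> :: "('n,'m) mpair" using that r by simp
  define W where "W = Sigma_set N \<kappa> \<gamma> \<delta>0 r mu"
  \<comment> \<open>Openness of \<open>S_set\<close> is available at 0 and on [\<delta>0, 1), which
    contains [\<delta>0, mu] because mu < 1.\<close>
  have W: "open W"
    unfolding W_def Sigma_set_def L_set_def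
    using mu(3) by (intro open_UN ballI open_L_i_set S_open) auto
  define t where "t \<theta> k = 1 / \<kappa> k \<theta> / mu" for \<theta> k
  have \<kappa>0: "0 < \<kappa> k \<theta>" if "k \<in> {1..N}" "\<theta> \<in> ball 0 r" for k \<theta>
    using \<kappa>b(1)[OF that(1) ball0[OF that(2)]] \<delta> zero_less_divide_1_iff[of \<delta>2] by linarith
  \<comment> \<open>The upper bound comes from 1 / \<kappa> \<le> \<delta>2 < \<delta>0 \<le> mu;
    the lower bound \<delta>1 is uniform in k and sets the contraction rate of the cycle.\<close>
  have t01: "\<delta>1 \<le> t \<theta> k" "0 < t \<theta> k" "t \<theta> k < 1" if "k \<in> {1..N}" "\<theta> \<in> ball 0 r" for k \<theta>
  proof -
    note \<kappa>0 = \<kappa>0[OF that] and b = \<kappa>b[OF that(1) ball0[OF that(2)]]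
    have "\<delta>1 \<le> 1 / \<kappa> k \<theta>" "1 / \<kappa> k \<theta> \<le> \<delta>2" using b \<kappa>0 \<delta> by (simp_all add: field_simps)
    moreover have "1 / \<kappa> k \<theta> \<le> t \<theta> k"
      unfolding t_def using \<kappa>0 mu by (simp add: field_simps)
    moreover have "t \<theta> k < 1 \<longleftrightarrow> 1 / \<kappa> k \<theta> < mu" unfolding t_def using mu by (intro divide_less_eq_1_pos)
    ultimately show "\<delta>1 \<le> t \<theta> k" "0 < t \<theta> k" "t \<theta> k < 1" using \<delta> mu by linarith+
  qed
  \<comment> \<open>The label b tells whether a target belongs to \<rho> or to \<rho>'; it later
    separates the families \<open>G1\<close> and \<open>G2\<close>.\<close>
  define X where "X = (\<lambda>(j, b). zeta_map \<kappa> \<gamma> j mu (if b then \<rho> else \<rho>'))"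
  define J where "J = {1..N} \<times> (UNIV :: bool set)"
  define ind :: "bool \<Rightarrow> nat \<Rightarrow> nat \<times> bool \<Rightarrow> real" where "ind b k = (\<lambda>j. if j = (k, b) then 1 else 0)" for b k
  \<comment> \<open>The cycle at one point produces only targets with the label of that
    point.\<close>
  define \<nu> where "\<nu> b k = (\<lambda>(j, b'). if b' = b then nu_coef N \<kappa> mu (if b then \<rho> else \<rho>') k j else 0)" for b k
  have in_ball: "(if b then \<rho> else \<rho>') \<in> ball 0 r" for b using \<rho> by simp
  have nu: "0 \<le> nu_coef N \<kappa> mu \<theta> k j" "nu_coef N \<kappa> mu \<theta> k j \<le> 1"
    "nu_coef N \<kappa> mu \<theta> (cyc_succ N k) j = t \<theta> k * (if j = k then 1 else 0) + (1 - t \<theta> k) * nu_coef N \<kappa> mu \<theta> k j"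
    "(\<Sum>j\<in>{1..N}. nu_coef N \<kappa> mu \<theta> k j) = 1"
    if "k \<in> {1..N}" "j \<in> {1..N}" "\<theta> \<in> ball 0 r" for k j \<theta>
  proof -
    have th: "0 < 1 / \<kappa> i \<theta> / mu \<and> 1 / \<kappa> i \<theta> / mu < 1" if "i \<in> {1..N}" for i
      using t01(2,3)[OF that \<open>\<theta> \<in> ball 0 r\<close>] unfolding t_def by blast
    show nonneg: "0 \<le> nu_coef N \<kappa> mu \<theta> k j"
      by (rule nu_coef_cyc_succ(2)[OF N that(1,2)]) (rule th)
    show "nu_coef N \<kappa> mu \<theta> (cyc_succ N k) j = t \<theta> k * (if j = k then 1 else 0) + (1 - t \<theta> k) * nu_coef N \<kappa> mu \<theta> k j"
      unfolding t_def by (rule nu_coef_cyc_succ(1)[OF N that(1,2)]) (rule th)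
    show sum1: "(\<Sum>j\<in>{1..N}. nu_coef N \<kappa> mu \<theta> k j) = 1"
      by (rule nu_coef_sum[OF N that(1)]) (rule th)
    have "nu_coef N \<kappa> mu \<theta> k j \<le> (\<Sum>j\<in>{1..N}. nu_coef N \<kappa> mu \<theta> k j)"
    proof (rule member_le_sum[OF that(2)])
      fix l assume "l \<in> {1..N} - {j}"
      then have "l \<in> {1..N}" by simp
      then show "0 \<le> nu_coef N \<kappa> mu \<theta> k l"
        by (rule nu_coef_cyc_succ(2)[OF N that(1)]) (rule th)
    qed simp
    then show "nu_coef N \<kappa> mu \<theta> k j \<le> 1" using sum1 by simp
  qed
  have \<nu>01: "0 \<le> \<nu> b k j \<and> \<nu> b k j \<le> 1" if "k \<in> {1..N}" "j \<in> J" for b k j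
    using that nu(1,2)[OF that(1) _ in_ball[of b]] by (cases j) (auto simp: \<nu>_def J_def)
  have ind01: "0 \<le> ind b k j \<and> ind b k j \<le> 1" for b k j by (simp add: ind_def)
  have conez: "zeta_map \<kappa> \<gamma> k mu \<theta> - pi_map \<gamma> k \<theta> \<in> wave_cone" if "k \<in> {1..N}" "\<theta> \<in> ball 0 r" for k \<theta>
  proof -
    have "zeta_map \<kappa> \<gamma> k mu \<theta> - pi_map \<gamma> k \<theta> = (mu * \<kappa> k \<theta>) *\<^sub>R \<gamma> k \<theta>"
      by (simp add: zeta_map_def xi_map_def algebra_simps)
    then show ?thesis using wave_cone_scaleR[OF \<gamma>c[OF that(1) ball0[OF that(2)]]] by simp
  qed
  have segz: "closed_segment (zeta_map \<kappa> \<gamma> k mu \<theta>) (pi_map \<gamma> k \<theta>) \<subseteq> W" if "k \<in> {1..N}" "\<theta> \<in> ball 0 r" for k \<theta>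
    unfolding W_def using conez[OF that] that mu by (intro segment_subset_Sigma_set) auto
  have pi_succ: "pi_map \<gamma> (cyc_succ N k) \<theta> = pi_map \<gamma> k \<theta> + \<gamma> k \<theta>" if "k \<in> {1..N}" "\<theta> \<in> ball 0 r" for k \<theta>
  proof (cases "k = N")
    case True
    \<comment> \<open>The vanishing sum of all \<gamma> closes the cycle, so that the step after N
      leads back to the first point.\<close>
    have "{1..N} = insert N {1..<N}" using N by auto
    then have "(\<Sum>l\<in>{1..<N}. \<gamma> l \<theta>) + \<gamma> N \<theta> = 0"
      using \<gamma>sum[OF ball0[OF that(2)]] by (simp add: add.commute)
    then show ?thesis using True by (simp add: pi_map_def cyc_succ_def add.assoc)
  next
    case False
    then show ?thesis using that by (simp add: pi_map_def cyc_succ_def add.assoc)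
  qed
  have pi_split: "pi_map \<gamma> (cyc_succ N k) \<theta> = t \<theta> k *\<^sub>R zeta_map \<kappa> \<gamma> k mu \<theta> + (1 - t \<theta> k) *\<^sub>R pi_map \<gamma> k \<theta>"
    if "k \<in> {1..N}" "\<theta> \<in> ball 0 r" for k \<theta>
  proof -
    \<comment> \<open>At parameter mu, \<open>zeta_map\<close> exceeds \<open>pi_map\<close> by mu *
      \<kappa> times \<gamma>; the weight t is the reciprocal of this factor, so exactly one
      \<gamma> is added.\<close>
    have "t \<theta> k * (mu * \<kappa> k \<theta>) = 1" unfolding t_def using \<kappa>0[OF that] mu by simp
    then have "t \<theta> k *\<^sub>R (mu *\<^sub>R \<kappa> k \<theta> *\<^sub>R \<gamma> k \<theta>) = \<gamma> k \<theta>" by (simp add: mult.assoc)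
    moreover have "zeta_map \<kappa> \<gamma> k mu \<theta> = pi_map \<gamma> k \<theta> + mu *\<^sub>R \<kappa> k \<theta> *\<^sub>R \<gamma> k \<theta>"
      by (simp add: zeta_map_def xi_map_def algebra_simps)
    ultimately show ?thesis unfolding pi_succ[OF that] by (simp add: scaleR_add_right scaleR_left_diff_distrib)
  qed
  have att_z: "attains W X J (zeta_map \<kappa> \<gamma> k mu (if b then \<rho> else \<rho>')) (ind b k)" if "k \<in> {1..N}" for b k
  proof -
    have "X (k, b) = zeta_map \<kappa> \<gamma> k mu (if b then \<rho> else \<rho>')" by (simp add: X_def)
    moreover have "zeta_map \<kappa> \<gamma> k mu (if b then \<rho> else \<rho>') \<in> W" using segz[OF that in_ball[of b]] by auto
    ultimately show ?thesis using attains_target[of X "(k, b)" W J] by (simp add: ind_def)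
  qed
  have att_pi: "attains W X J (pi_map \<gamma> k (if b then \<rho> else \<rho>')) (\<nu> b k)" if k: "k \<in> {1..N}" for b k
  proof -
    let ?\<theta> = "if b then \<rho> else \<rho>'"
    note ib = in_ball[of b]
    show ?thesis
    proof (rule attains_cycle[where \<delta> = \<delta>1 and N = N and \<zeta> = "\<lambda>k. zeta_map \<kappa> \<gamma> k mu ?\<theta>"
          and \<pi> = "\<lambda>k. pi_map \<gamma> k ?\<theta>" and c = "ind b" and t = "t ?\<theta>" and \<nu> = "\<nu> b"])
      show "\<delta>1 \<le> t ?\<theta> k \<and> t ?\<theta> k \<le> 1" if "k \<in> {1..N}" for k
        using t01[OF that ib] by linarith
      show "\<nu> b (cyc_succ N k) j = t ?\<theta> k * ind b k j + (1 - t ?\<theta> k) * \<nu> b k j" if "k \<in> {1..N}" "j \<in> J" for k j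
      proof (cases j)
        case (Pair l b')
        then have "l \<in> {1..N}" using that(2) by (simp add: J_def)
        then show ?thesis using nu(3)[OF that(1) _ ib, of l] by (simp add: Pair \<nu>_def ind_def)
      qed
    qed (use W \<delta> segz[OF _ ib] conez[OF _ ib] att_z ind01 pi_split[OF _ ib] \<nu>01 k in auto)
  qed
  \<comment> \<open>The position of the point at parameter lam' on the segment from
    \<open>pi_map\<close> to the point at parameter mu.\<close>
  define s where "s = lam' / mu"
  have s: "0 \<le> s" "s \<le> 1" unfolding s_def using lam' lam mu \<delta> by auto
  define c1 where "c1 j = s * ind True i j + (1 - s) * \<nu> True i j" for j
  have c1_01: "0 \<le> c1 j \<and> c1 j \<le> 1" if "j \<in> J" for j
    using \<nu>01[OF iN that] ind01[of True i j] s
    unfolding c1_def by (auto intro!: convex_bound_le)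
  have "s *\<^sub>R zeta_map \<kappa> \<gamma> i mu \<rho> + (1 - s) *\<^sub>R pi_map \<gamma> i \<rho> = zeta_map \<kappa> \<gamma> i lam' \<rho>"
  proof -
    have "s * mu = lam'" using mu by (simp add: s_def)
    moreover have "s *\<^sub>R zeta_map \<kappa> \<gamma> i mu \<rho> + (1 - s) *\<^sub>R pi_map \<gamma> i \<rho>
        = (s * mu) *\<^sub>R xi_map \<kappa> \<gamma> i \<rho> + (1 - s * mu) *\<^sub>R pi_map \<gamma> i \<rho>"
      by (simp add: zeta_map_def algebra_simps)
    ultimately show ?thesis by (simp add: zeta_map_def)
  qed
  then have att1: "attains W X J (zeta_map \<kappa> \<gamma> i lam' \<rho>) c1"
    using attains_laminate[OF W segz[OF iN \<rho>(1)] conez[OF iN \<rho>(1)] s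
        att_z[OF iN, of True, unfolded if_True] _ att_pi[OF iN, of True, unfolded if_True] \<nu>01[OF iN]] ind01
    unfolding c1_def[abs_def] by simp
  have seg0: "closed_segment (zeta_map \<kappa> \<gamma> i lam' \<rho>) (pi_map \<gamma> i \<rho>') \<subseteq> W"
    unfolding W_def by (rule segment_subset_Sigma_set[OF iN lam'mu \<rho> cone])
  define c2 where "c2 j = q * c1 j + (1 - q) * \<nu> False i j" for j
  have attY: "attains W X J Y c2"
    unfolding Yeq c2_def[abs_def]
    by (rule attains_laminate[OF W seg0 cone q att1 c1_01 att_pi[OF iN, of False, unfolded if_False] \<nu>01[OF iN]])
  \<comment> \<open>Both labels contribute to the j-th set, so v j is the bracket in the volume
    bound.\<close>
  define v where "v j = c2 (j, True) + c2 (j, False)" for j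
  have v_eq: "v j = (1 - q) * nu_coef N \<kappa> mu \<rho>' i j
      + q * (s * (if j = i then 1 else 0) + (1 - s) * nu_coef N \<kappa> mu \<rho> i j)" for j
    by (simp add: v_def c2_def c1_def ind_def \<nu>_def)
  have v0: "0 \<le> v j" if "j \<in> {1..N}" for j
    unfolding v_eq using nu(1)[OF iN that \<rho>(1)] nu(1)[OF iN that \<rho>(2)] s q by simp
  have v_sum: "(\<Sum>j\<in>{1..N}. v j) = 1"
  proof -
    have "(\<Sum>j\<in>{1..N}. v j) = (1 - q) * (\<Sum>j\<in>{1..N}. nu_coef N \<kappa> mu \<rho>' i j)
      + q * (s * (\<Sum>j\<in>{1..N}. if j = i then 1 else 0) + (1 - s) * (\<Sum>j\<in>{1..N}. nu_coef N \<kappa> mu \<rho> i j))"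
      by (simp only: v_eq sum.distrib sum_distrib_left[symmetric])
    also have "(\<Sum>j\<in>{1..N}. if j = i then 1 else 0 :: real) = 1" using iN by simp
    finally show ?thesis using nu(4)[OF iN iN \<rho>(1)] nu(4)[OF iN iN \<rho>(2)] by simp
  qed
  obtain e where e: "0 < e" "e < \<tau>" "\<And>j. j \<in> {1..N} \<Longrightarrow> 0 < v j * measure lborel G \<Longrightarrow> e \<le> \<tau> * (v j * measure lborel G)"
    by (rule ex_uniform_tolerance[OF _ \<tau>(1), of "{1..N}" "\<lambda>j. v j * measure lborel G"]) (simp, rule that)
  have e4: "0 < e / 4" using e by simp
  obtain \<phi> \<psi> g U where sol: "solves W Y G (e / 4) \<phi> \<psi> g"
    and U: "\<And>j. j \<in> J \<Longrightarrow> open (U j)" "\<And>j. j \<in> J \<Longrightarrow> compactly_in (U j) G"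
    "\<And>j z. j \<in> J \<Longrightarrow> z \<in> U j \<Longrightarrow> Y + grad_pair \<phi> \<psi> z = X j"
    "\<And>j. j \<in> J \<Longrightarrow> c2 j * measure lborel G - e / 4 \<le> measure lborel (U j)" "disjoint_family_on U J"
    by (rule attainsE[OF attY G(2,1) e4], rule that)
  note sol = solvesD[OF sol]
  define G1 where "G1 j = U (j, True)" for j
  define G2 where "G2 j = U (j, False)" for j
  have JI: "(j, b) \<in> J" if "j \<in> {1..N}" for j b using that by (simp add: J_def)
  have disj: "U (j, b) \<inter> U (k, b') = {}" if "j \<in> {1..N}" "k \<in> {1..N}" "(j, b) \<noteq> (k, b')" for j k b b'
    by (rule disjoint_family_onD[OF U(5) JI[OF that(1)] JI[OF that(2)] that(3)])
  have meas: "(1 - \<tau>) * v j * measure lborel G \<le> measure lborel (G1 j \<union> G2 j)" if j: "j \<in> {1..N}" for j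
  proof -
    have "bounded (U (j, b))" for b
      using compactly_in_subset[OF U(2)[OF JI[OF j]]] G(1) by (rule bounded_subset[rotated])
    then have "measure lborel (G1 j \<union> G2 j) = measure lborel (U (j, True)) + measure lborel (U (j, False))"
      unfolding G1_def G2_def using disj[OF j j, of True False]
      by (intro measure_lborel_Un_disjoint U(1)[OF JI[OF j]]) simp_all
    then have *: "v j * measure lborel G - e \<le> measure lborel (G1 j \<union> G2 j)"
      using U(4)[OF JI[OF j], of True] U(4)[OF JI[OF j], of False] e(1) unfolding v_def distrib_right by linarith
    show ?thesis
    proof (cases "0 < v j * measure lborel G")
      case True
      have "(1 - \<tau>) * v j * measure lborel G = v j * measure lborel G - \<tau> * (v j * measure lborel G)"
        by (simp add: algebra_simps)
      then show ?thesis using * e(3)[OF j True] by linarith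
    next
      \<comment> \<open>A target volume 0, in particular when G is empty, makes the lower bound
        trivial.\<close>
      case False
      moreover have "0 \<le> v j * measure lborel G" using v0[OF j] by simp
      ultimately have "v j * measure lborel G = 0" by linarith
      then show ?thesis by (auto simp: mult.assoc)
    qed
  qed
  have val: "Y + (Dx \<phi> z, dt \<psi> z) = zeta_map \<kappa> \<gamma> j mu (if b then \<rho> else \<rho>')" if "j \<in> {1..N}" "z \<in> U (j, b)" for j b z
    using U(3)[OF JI[OF that(1)] that(2)] by (simp add: grad_pair_def X_def)
  show ?thesis
  proof (rule exI[of _ \<phi>], rule exI[of _ \<psi>], rule exI[of _ g], intro conjI)
    show "Cc_inf G \<phi>" "Cc_inf G \<psi>" "Cc_inf G g" by (rule sol)+
    show "\<forall>z\<in>G. divx \<psi> z = 0 \<and> divx g z = \<phi> z \<and> Y + (Dx \<phi> z, dt \<psi> z) \<in> Sigma_set N \<kappa> \<gamma> \<delta>0 r mu"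
      using sol(4,5) sol(9)[unfolded grad_pair_def W_def] by blast
    \<comment> \<open>Three norms of at most e / 4 each, with e < \<tau>, keep the sum strictly
      below \<tau>.\<close>
    show "\<exists>a b c. (\<forall>z\<in>G. norm (\<phi> z) \<le> a \<and> norm (dt \<phi> z) \<le> b \<and> norm (dt g z) \<le> c) \<and> a + b + c < \<tau>"
      using sol(6-8) e(1,2) by (intro exI[of _ "e / 4"]) auto
    show "\<exists>G1 G2 :: nat \<Rightarrow> ((real^'n) \<times> real) set.
        (\<forall>j\<in>{1..N}. open (G1 j) \<and> open (G2 j) \<and> compactly_in (G1 j) G \<and> compactly_in (G2 j) G) \<and>
        (\<forall>j\<in>{1..N}. \<forall>k\<in>{1..N}. (j \<noteq> k \<longrightarrow> G1 j \<inter> G1 k = {} \<and> G2 j \<inter> G2 k = {}) \<and> G1 j \<inter> G2 k = {}) \<and>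
        (\<forall>j\<in>{1..N}. \<forall>z\<in>G1 j \<union> G2 j.
            Y + (Dx \<phi> z, dt \<psi> z) =
              (if z \<in> G1 j then zeta_map \<kappa> \<gamma> j mu \<rho> else 0) + (if z \<in> G2 j then zeta_map \<kappa> \<gamma> j mu \<rho>' else 0) \<and>
            Y + (Dx \<phi> z, dt \<psi> z) \<in> S_set \<kappa> \<gamma> j r mu) \<and>
        measure lborel (G1 i \<union> G2 i) \<ge>
          (1 - \<tau>) * ((1 - q) * nu_coef N \<kappa> mu \<rho>' i i
                     + q * (lam' / mu + (1 - lam' / mu) * nu_coef N \<kappa> mu \<rho> i i)) * measure lborel G \<and>
        (\<forall>j\<in>{1..N}. j \<noteq> i \<longrightarrow>
          measure lborel (G1 j \<union> G2 j) \<ge>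
            (1 - \<tau>) * ((1 - q) * nu_coef N \<kappa> mu \<rho>' i j
                       + q * (1 - lam' / mu) * nu_coef N \<kappa> mu \<rho> i j) * measure lborel G) \<and>
        (\<Sum>j\<in>{1..N}. measure lborel (G1 j \<union> G2 j)) \<ge> (1 - \<tau>) * measure lborel G"
    proof (rule exI[of _ G1], rule exI[of _ G2], intro conjI ballI impI)
      fix j assume j: "j \<in> {1..N}"
      show "open (G1 j)" "open (G2 j)" "compactly_in (G1 j) G" "compactly_in (G2 j) G"
        unfolding G1_def G2_def by (rule U JI j)+
      show "G1 j \<inter> G1 k = {}" "G2 j \<inter> G2 k = {}" if "k \<in> {1..N}" "j \<noteq> k" for k
        unfolding G1_def G2_def by (rule disj[OF j that(1)], use that(2) in simp)+
      show disj12: "G1 j \<inter> G2 k = {}" if "k \<in> {1..N}" for k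
        unfolding G1_def G2_def by (rule disj[OF j that]) simp
      fix z assume z: "z \<in> G1 j \<union> G2 j"
      show "Y + (Dx \<phi> z, dt \<psi> z) =
          (if z \<in> G1 j then zeta_map \<kappa> \<gamma> j mu \<rho> else 0) + (if z \<in> G2 j then zeta_map \<kappa> \<gamma> j mu \<rho>' else 0)"
        "Y + (Dx \<phi> z, dt \<psi> z) \<in> S_set \<kappa> \<gamma> j r mu"
        using z disj12[OF j] val[OF j, of z True] val[OF j, of z False] \<rho>
        by (auto simp: G1_def G2_def S_set_def)
    next
      show "(1 - \<tau>) * ((1 - q) * nu_coef N \<kappa> mu \<rho>' i i
          + q * (lam' / mu + (1 - lam' / mu) * nu_coef N \<kappa> mu \<rho> i i)) * measure lborel G
        \<le> measure lborel (G1 i \<union> G2 i)"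
        using meas[OF iN] by (simp add: v_eq s_def)
      show "(1 - \<tau>) * ((1 - q) * nu_coef N \<kappa> mu \<rho>' i j + q * (1 - lam' / mu) * nu_coef N \<kappa> mu \<rho> i j) * measure lborel G
        \<le> measure lborel (G1 j \<union> G2 j)" if "j \<in> {1..N}" "j \<noteq> i" for j
        using meas[OF that(1)] that(2) by (simp add: v_eq s_def mult.assoc)
      have "(1 - \<tau>) * measure lborel G = (\<Sum>j\<in>{1..N}. (1 - \<tau>) * v j * measure lborel G)"
        using v_sum by (simp only: sum_distrib_left[symmetric] sum_distrib_right[symmetric] mult_1_right)
      also have "\<dots> \<le> (\<Sum>j\<in>{1..N}. measure lborel (G1 j \<union> G2 j))" by (intro sum_mono meas)
      finally show "(1 - \<tau>) * measure lborel G \<le> (\<Sum>j\<in>{1..N}. measure lborel (G1 j \<union> G2 j))" .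
    qed
  qed
qed

end
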